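(* Let $X$ be a Banach space, let $n=2k+1$ with $k\in\mathbb{N}$, $k\geq 1$, and let $K\subset\mathbb{R}^n$ be compact. Let $F:\mathbb{R}^n\to X$ be $L^1$-integrable and $k$-times continuously differentiable, and suppose that for some $\delta>0$ the sets $$\left\{r\mapsto\frac{\bar F_x(r)-\mathbf{1}_{(0,\delta)}(r)F(x)}{r}:\ x\in K\right\}$$ and $$\left\{r\mapsto r^{j-1}\left(\frac{d}{dr}\right)^{l}\bar F_x(r):\ x\in K,\ l=0,\dots,j\right\},\qquad j=1,\dots,k,$$ are compact subsets of $L^1((0,\infty);X)$. Then $S_R(F)(x)\to F(x)$ as $R\to\infty$ uniformly in $x\in K$.
   Context: $X$ is a Banach space with complex scalars. For $L^1$-integrable $F:\mathbb{R}^n\to X$ the Fourier transform is $\hat F(\xi)=\int_{\mathbb{R}^n}e^{-i\xi\cdot s}F(s)\,ds$, and $S_R(F)(x)=\frac{1}{(2\pi)^n}\int_{|\xi|\le R}e^{ix\cdot\xi}\hat F(\xi)\,d\xi$ for $R\ge1$, $x\in\mathbb{R}^n$. The spherical mean of $F$ at $x$ is $\bar F_x(r)=\frac{1}{\omega_{n-1}}\int_{\mathbb{S}^{n-1}}F(x+r\omega)\,d\omega$, $r\ge0$, where $\mathbb{S}^{n-1}$ is the unit sphere in $\mathbb{R}^n$, $d\omega$ is surface measure on it and $\omega_{n-1}$ is its total surface measure. $\mathbf{1}_I$ denotes the indicator function of $I\subset\mathbb{R}$. Functions are viewed as functions of $r\in(0,\infty)$; convergence is in the norm of $X$. *)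

theory Defs
  imports "HOL-Analysis.Analysis"
begin

section \<open>Complex Banach spaces\<close>

text \<open>
  The class \<^class>\<open>banach\<close> has real scalars. The complex scalar multiplication added here extends
  the real one, and the norm is homogeneous for complex scalars.
\<close>

class complex_banach = banach +
  fixes scaleC :: "complex \<Rightarrow> 'a \<Rightarrow> 'a"  (infixr "*\<^sub>C" 75)
  assumes scaleC_add_right: "a *\<^sub>C (x + y) = a *\<^sub>C x + a *\<^sub>C y"
    and scaleC_add_left: "(a + b) *\<^sub>C x = a *\<^sub>C x + b *\<^sub>C x"
    and scaleC_scaleC: "a *\<^sub>C (b *\<^sub>C x) = (a * b) *\<^sub>C x"
    and scaleC_of_real: "complex_of_real r *\<^sub>C x = r *\<^sub>R x"
    and norm_scaleC: "norm (a *\<^sub>C x) = cmod a * norm x"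

instantiation complex :: complex_banach
begin
definition scaleC_complex :: "complex \<Rightarrow> complex \<Rightarrow> complex" where
  "scaleC_complex a x = a * x"
instance
  by standard (simp_all add: scaleC_complex_def algebra_simps norm_mult scaleR_conv_of_real)
end


section \<open>The Bochner integral without separability\<close>

text \<open>
  The Bochner integral of \<^theory>\<open>HOL-Analysis.Bochner_Integration\<close> requires a second countable
  (separable) target space. The following is the same construction for an arbitrary Banach space;
  Borel measurability is replaced by strong measurability, which it implies in the separable case.
\<close>

definition strongly_measurable :: "'a measure \<Rightarrow> ('a \<Rightarrow> 'b::real_normed_vector) \<Rightarrow> bool" where
  "strongly_measurable M f \<longleftrightarrow>
    (\<exists>s. (\<forall>i::nat. simple_function M (s i)) \<and> (AE x in M. (\<lambda>i. s i x) \<longlonglongrightarrow> f x))"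

definition has_banach_integral :: "'a measure \<Rightarrow> ('a \<Rightarrow> 'b::banach) \<Rightarrow> 'b \<Rightarrow> bool" where
  "has_banach_integral M f y \<longleftrightarrow> strongly_measurable M f \<and>
    (\<exists>s. (\<forall>i::nat. Bochner_Integration.simple_bochner_integrable M (s i)) \<and>
      (\<lambda>i. \<integral>\<^sup>+x. ennreal (norm (f x - s i x)) \<partial>M) \<longlonglongrightarrow> 0 \<and>
      (\<lambda>i. Bochner_Integration.simple_bochner_integral M (s i)) \<longlonglongrightarrow> y)"

definition banach_integral :: "'a measure \<Rightarrow> ('a \<Rightarrow> 'b::banach) \<Rightarrow> 'b" where
  "banach_integral M f = (THE y. has_banach_integral M f y)"

lemma strongly_measurable_cong_AE:
  assumes "strongly_measurable M f" and "AE x in M. f x = g x"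
  shows "strongly_measurable M g"
proof -
  obtain s where s: "\<And>i::nat. simple_function M (s i)"
    and lim: "AE x in M. (\<lambda>i. s i x) \<longlonglongrightarrow> f x"
    using assms(1) by (auto simp: strongly_measurable_def)
  from lim assms(2) have "AE x in M. (\<lambda>i. s i x) \<longlonglongrightarrow> g x"
    by eventually_elim simp
  with s show ?thesis
    by (auto simp: strongly_measurable_def)
qed

lemma borel_measurable_imp_strongly_measurable:
  fixes f :: "'a \<Rightarrow> 'b::{real_normed_vector, second_countable_topology}"
  assumes "f \<in> borel_measurable M"
  shows "strongly_measurable M f"
proof -
  obtain s where "\<And>i::nat. simple_function M (s i)" "\<forall>x\<in>space M. (\<lambda>i. s i x) \<longlonglongrightarrow> f x"
    using borel_measurable_implies_sequence_metric[OF assms, of 0] by blast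
  then show ?thesis
    unfolding strongly_measurable_def by (intro exI[of _ s] conjI allI AE_I2) auto
qed

lemma strongly_measurable_norm_diff:
  assumes "strongly_measurable M f" and "strongly_measurable M g"
  obtains h :: "'a \<Rightarrow> real"
  where "h \<in> borel_measurable M" and "AE x in M. norm (f x - g x) = h x"
proof -
  obtain s t where st: "\<And>i::nat. simple_function M (s i)" "\<And>i::nat. simple_function M (t i)"
    and lim: "AE x in M. (\<lambda>i. s i x) \<longlonglongrightarrow> f x" "AE x in M. (\<lambda>i. t i x) \<longlonglongrightarrow> g x"
    using assms by (auto simp: strongly_measurable_def)
  define h where "h x = lim (\<lambda>i. norm (s i x - t i x))" for x
  have "(\<lambda>x. norm (s i x - t i x)) \<in> borel_measurable M" for i
    using simple_function_compose2[OF st, of "\<lambda>a b. norm (a - b)" i i]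
    by (rule borel_measurable_simple_function)
  then have "h \<in> borel_measurable M"
    unfolding h_def by (intro borel_measurable_lim_metric)
  moreover have "AE x in M. norm (f x - g x) = h x"
    using lim
  proof eventually_elim
    case (elim x)
    then have "(\<lambda>i. norm (s i x - t i x)) \<longlonglongrightarrow> norm (f x - g x)"
      by (intro tendsto_intros)
    then show ?case
      by (simp add: h_def limI)
  qed
  ultimately show thesis
    by (rule that)
qed

lemma simple_function_imp_strongly_measurable:
  "simple_function M f \<Longrightarrow> strongly_measurable M f"
  unfolding strongly_measurable_def by (intro exI[of _ "\<lambda>_. f"]) auto

lemma nn_integral_norm_diff_triangle:
  assumes "strongly_measurable M f" and "strongly_measurable M g" and "strongly_measurable M h"
  shows "(\<integral>\<^sup>+x. ennreal (norm (f x - h x)) \<partial>M) \<le>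
    (\<integral>\<^sup>+x. ennreal (norm (f x - g x)) \<partial>M) + (\<integral>\<^sup>+x. ennreal (norm (g x - h x)) \<partial>M)"
proof -
  obtain u where u: "u \<in> borel_measurable M" "AE x in M. norm (f x - g x) = u x"
    using strongly_measurable_norm_diff[OF assms(1,2)] .
  obtain v where v: "v \<in> borel_measurable M" "AE x in M. norm (g x - h x) = v x"
    using strongly_measurable_norm_diff[OF assms(2,3)] .
  have "(\<integral>\<^sup>+x. ennreal (norm (f x - h x)) \<partial>M) \<le> (\<integral>\<^sup>+x. ennreal (u x) + ennreal (v x) \<partial>M)"
  proof (intro nn_integral_mono_AE)
    show "AE x in M. ennreal (norm (f x - h x)) \<le> ennreal (u x) + ennreal (v x)"
      using u(2) v(2)
    proof eventually_elim
      case (elim x)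
      have "norm (f x - h x) \<le> norm (f x - g x) + norm (g x - h x)"
        using norm_triangle_ineq[of "f x - g x" "g x - h x"] by simp
      then have "ennreal (norm (f x - h x)) \<le> ennreal (norm (f x - g x) + norm (g x - h x))"
        by (rule ennreal_leI)
      also have "\<dots> = ennreal (norm (f x - g x)) + ennreal (norm (g x - h x))"
        by (rule ennreal_plus) auto
      finally show ?case
        using elim by simp
    qed
  qed
  also have "\<dots> = (\<integral>\<^sup>+x. ennreal (u x) \<partial>M) + (\<integral>\<^sup>+x. ennreal (v x) \<partial>M)"
    using u(1) v(1) by (intro nn_integral_add) auto
  also have "(\<integral>\<^sup>+x. ennreal (u x) \<partial>M) = (\<integral>\<^sup>+x. ennreal (norm (f x - g x)) \<partial>M)"
    using u(2) by (intro nn_integral_cong_AE) (erule eventually_mono, simp)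
  also have "(\<integral>\<^sup>+x. ennreal (v x) \<partial>M) = (\<integral>\<^sup>+x. ennreal (norm (g x - h x)) \<partial>M)"
    using v(2) by (intro nn_integral_cong_AE) (erule eventually_mono, simp)
  finally show ?thesis .
qed

lemma has_banach_integral_unique:
  assumes "has_banach_integral M f y" and "has_banach_integral M f z"
  shows "y = z"
proof -
  obtain s where s: "\<And>i::nat. Bochner_Integration.simple_bochner_integrable M (s i)"
    "(\<lambda>i. \<integral>\<^sup>+x. ennreal (norm (f x - s i x)) \<partial>M) \<longlonglongrightarrow> 0"
    "(\<lambda>i. Bochner_Integration.simple_bochner_integral M (s i)) \<longlonglongrightarrow> y"
    using assms(1) unfolding has_banach_integral_def by blast
  obtain t where t: "\<And>i::nat. Bochner_Integration.simple_bochner_integrable M (t i)"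
    "(\<lambda>i. \<integral>\<^sup>+x. ennreal (norm (f x - t i x)) \<partial>M) \<longlonglongrightarrow> 0"
    "(\<lambda>i. Bochner_Integration.simple_bochner_integral M (t i)) \<longlonglongrightarrow> z"
    using assms(2) unfolding has_banach_integral_def by blast
  have f: "strongly_measurable M f"
    using assms(1) by (simp add: has_banach_integral_def)
  have st: "strongly_measurable M (s i)" "strongly_measurable M (t i)" for i
    using s(1)[of i] t(1)[of i]
    by (auto intro!: simple_function_imp_strongly_measurable
        elim: Bochner_Integration.simple_bochner_integrable.cases)
  let ?I = "Bochner_Integration.simple_bochner_integral M"
  let ?e = "\<lambda>i. (\<integral>\<^sup>+x. ennreal (norm (f x - s i x)) \<partial>M) + (\<integral>\<^sup>+x. ennreal (norm (f x - t i x)) \<partial>M)"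
  have bound: "ennreal (norm (?I (s i) - ?I (t i))) \<le> ?e i" for i
  proof -
    have d: "Bochner_Integration.simple_bochner_integrable M (\<lambda>x. s i x - t i x)"
      using s(1)[of i] t(1)[of i] by (rule simple_bochner_integrable_compose2[rotated]) simp
    then have n: "Bochner_Integration.simple_bochner_integrable M (\<lambda>x. norm (s i x - t i x))"
      using simple_bochner_integrable_compose2[of "\<lambda>a b. norm a", OF _ d d] by simp
    have "norm (?I (s i) - ?I (t i)) = norm (?I (\<lambda>x. s i x - t i x))"
      using s(1) t(1) by (simp add: simple_bochner_integral_diff)
    also have "\<dots> \<le> ?I (\<lambda>x. norm (s i x - t i x))"
      by (rule simple_bochner_integral_norm_bound[OF d])
    finally have "ennreal (norm (?I (s i) - ?I (t i))) \<le> ennreal (?I (\<lambda>x. norm (s i x - t i x)))"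
      by (rule ennreal_leI)
    also have "\<dots> = (\<integral>\<^sup>+x. ennreal (norm (s i x - t i x)) \<partial>M)"
      by (rule simple_bochner_integral_eq_nn_integral[OF n]) simp
    also have "\<dots> \<le> ?e i"
      using nn_integral_norm_diff_triangle[OF st(1) f st(2), of i i] by (simp add: norm_minus_commute)
    finally show ?thesis .
  qed
  have "?e \<longlonglongrightarrow> 0"
    using tendsto_add[OF s(2) t(2)] by simp
  then have "(\<lambda>i. ennreal (norm (?I (s i) - ?I (t i)))) \<longlonglongrightarrow> 0"
    by (rule tendsto_sandwich[OF _ _ tendsto_const, rotated 2]) (simp_all add: bound)
  then have "(\<lambda>i. norm (?I (s i) - ?I (t i))) \<longlonglongrightarrow> 0"
    by (simp add: tendsto_ennreal_iff flip: ennreal_0)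
  moreover have "(\<lambda>i. norm (?I (s i) - ?I (t i))) \<longlonglongrightarrow> norm (y - z)"
    using s(3) t(3) by (intro tendsto_intros)
  ultimately have "norm (y - z) = 0"
    using LIMSEQ_unique by blast
  then show ?thesis
    by simp
qed

lemma has_banach_integral_iff_has_bochner_integral:
  fixes f :: "'a \<Rightarrow> 'b::{banach, second_countable_topology}"
  assumes "f \<in> borel_measurable M"
  shows "has_banach_integral M f y \<longleftrightarrow> has_bochner_integral M f y"
proof
  assume "has_banach_integral M f y"
  then show "has_bochner_integral M f y"
    unfolding has_banach_integral_def using assms by (blast intro: has_bochner_integral.intros)
next
  assume "has_bochner_integral M f y"
  then show "has_banach_integral M f y"
    unfolding has_banach_integral_def using borel_measurable_imp_strongly_measurable[OF assms]
    by cases blast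
qed


section \<open>The space of integrable functions\<close>

definition L1_fun :: "'a measure \<Rightarrow> ('a \<Rightarrow> 'b::banach) set" where
  "L1_fun M = {f. strongly_measurable M f \<and> (\<integral>\<^sup>+x. ennreal (norm (f x)) \<partial>M) < \<infinity>}"

text \<open>
  The points of the Lebesgue space are the classes of integrable functions under equality almost
  everywhere. The class of a function that is not integrable is empty, hence not a point.
\<close>

definition L1_class :: "'a measure \<Rightarrow> ('a \<Rightarrow> 'b::banach) \<Rightarrow> ('a \<Rightarrow> 'b) set" where
  "L1_class M f = {g \<in> L1_fun M. AE x in M. g x = f x}"

definition L1 :: "'a measure \<Rightarrow> ('a \<Rightarrow> 'b::banach) set set" where
  "L1 M = L1_class M ` L1_fun M"

definition L1_dist :: "'a measure \<Rightarrow> ('a \<Rightarrow> 'b::banach) set \<Rightarrow> ('a \<Rightarrow> 'b) set \<Rightarrow> real" where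
  "L1_dist M A B =
    enn2real (\<integral>\<^sup>+x. ennreal (norm ((SOME f. f \<in> A) x - (SOME g. g \<in> B) x)) \<partial>M)"

definition L1_topology :: "'a measure \<Rightarrow> ('a \<Rightarrow> 'b::banach) set topology" where
  "L1_topology M = Metric_space.mtopology (L1 M) (L1_dist M)"

definition compact_in_L1 :: "'a measure \<Rightarrow> ('a \<Rightarrow> 'b::banach) set \<Rightarrow> bool" where
  "compact_in_L1 M S \<longleftrightarrow> compactin (L1_topology M) (L1_class M ` S)"

lemma L1_class_self: "f \<in> L1_fun M \<Longrightarrow> f \<in> L1_class M f"
  by (simp add: L1_class_def)

lemma L1_class_eq_iff:
  assumes "f \<in> L1_fun M" and "g \<in> L1_fun M"
  shows "L1_class M f = L1_class M g \<longleftrightarrow> (AE x in M. f x = g x)"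
proof
  assume "L1_class M f = L1_class M g"
  then show "AE x in M. f x = g x"
    using L1_class_self[OF assms(1)] by (auto simp: L1_class_def)
next
  assume eq: "AE x in M. f x = g x"
  have "(AE x in M. h x = f x) \<longleftrightarrow> (AE x in M. h x = g x)" for h
    using eq by (rule eventually_cong) simp
  then show "L1_class M f = L1_class M g"
    by (simp add: L1_class_def)
qed

lemma L1_class_in_L1_iff: "L1_class M f \<in> L1 M \<longleftrightarrow> f \<in> L1_fun M"
proof
  assume "L1_class M f \<in> L1 M"
  then obtain g where "g \<in> L1_fun M" "L1_class M f = L1_class M g"
    by (auto simp: L1_def)
  then have g: "g \<in> L1_fun M" "AE x in M. g x = f x"
    using L1_class_self[of g M] by (auto simp: L1_class_def)
  have "(\<integral>\<^sup>+x. ennreal (norm (f x)) \<partial>M) = (\<integral>\<^sup>+x. ennreal (norm (g x)) \<partial>M)"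
    using g(2) by (intro nn_integral_cong_AE) (erule eventually_mono, simp)
  moreover have "strongly_measurable M f"
    using g by (intro strongly_measurable_cong_AE[of M g f]) (auto simp: L1_fun_def)
  ultimately show "f \<in> L1_fun M"
    using g(1) by (simp add: L1_fun_def)
qed (auto simp: L1_def)

lemma L1_dist_class:
  assumes "f \<in> L1_fun M" and "g \<in> L1_fun M"
  shows "L1_dist M (L1_class M f) (L1_class M g) =
    enn2real (\<integral>\<^sup>+x. ennreal (norm (f x - g x)) \<partial>M)"
proof -
  have "(SOME h. h \<in> L1_class M k) \<in> L1_class M k" if "k \<in> L1_fun M" for k
    using L1_class_self[OF that] by (rule someI[of "\<lambda>h. h \<in> L1_class M k"])
  from this[OF assms(1)] this[OF assms(2)] have "AE x in M. (SOME h. h \<in> L1_class M f) x = f x"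
    and "AE x in M. (SOME h. h \<in> L1_class M g) x = g x"
    by (auto simp: L1_class_def)
  then have "AE x in M. ennreal (norm ((SOME h. h \<in> L1_class M f) x - (SOME h. h \<in> L1_class M g) x))
      = ennreal (norm (f x - g x))"
    by eventually_elim simp
  from nn_integral_cong_AE[OF this] show ?thesis
    unfolding L1_dist_def by simp
qed

lemma strongly_measurable_zero: "strongly_measurable M (\<lambda>_. 0)"
  unfolding strongly_measurable_def by (intro exI[of _ "\<lambda>_ _. 0"]) auto

lemma L1_dist_finite:
  assumes "f \<in> L1_fun M" and "g \<in> L1_fun M"
  shows "(\<integral>\<^sup>+x. ennreal (norm (f x - g x)) \<partial>M) < \<infinity>"
proof -
  have "(\<integral>\<^sup>+x. ennreal (norm (f x - g x)) \<partial>M) \<le>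
      (\<integral>\<^sup>+x. ennreal (norm (f x)) \<partial>M) + (\<integral>\<^sup>+x. ennreal (norm (g x)) \<partial>M)"
    using nn_integral_norm_diff_triangle[of M f "\<lambda>_. 0" g] assms
    by (simp add: L1_fun_def strongly_measurable_zero)
  also have "\<dots> < \<infinity>"
    using assms by (simp add: L1_fun_def)
  finally show ?thesis .
qed

lemma Metric_space_L1: "Metric_space (L1 M) (L1_dist M)"
proof
  fix A B :: "('a \<Rightarrow> 'b::banach) set"
  show "0 \<le> L1_dist M A B"
    by (simp add: L1_dist_def)
  show "L1_dist M A B = L1_dist M B A"
    by (simp add: L1_dist_def norm_minus_commute)
next
  fix A B :: "('a \<Rightarrow> 'b::banach) set"
  assume "A \<in> L1 M" "B \<in> L1 M"
  then obtain f g where f: "f \<in> L1_fun M" "A = L1_class M f"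
    and g: "g \<in> L1_fun M" "B = L1_class M g"
    by (auto simp: L1_def)
  obtain h where h: "h \<in> borel_measurable M" "AE x in M. norm (f x - g x) = h x"
    using strongly_measurable_norm_diff[of M f g] f g by (auto simp: L1_fun_def)
  have "L1_dist M A B = 0 \<longleftrightarrow> (\<integral>\<^sup>+x. ennreal (norm (f x - g x)) \<partial>M) = 0"
    using L1_dist_finite[OF f(1) g(1)] by (auto simp: f g L1_dist_class enn2real_eq_0_iff)
  also have "(\<integral>\<^sup>+x. ennreal (norm (f x - g x)) \<partial>M) = (\<integral>\<^sup>+x. ennreal (h x) \<partial>M)"
    using h(2) by (intro nn_integral_cong_AE) (erule eventually_mono, simp)
  also have "\<dots> = 0 \<longleftrightarrow> (AE x in M. ennreal (h x) = 0)"
    using h(1) by (intro nn_integral_0_iff_AE) auto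
  also have "\<dots> \<longleftrightarrow> (AE x in M. f x = g x)"
    using h(2)
  proof (intro eventually_cong)
    fix x assume *: "norm (f x - g x) = h x"
    have "ennreal (h x) = 0 \<longleftrightarrow> norm (f x - g x) = 0"
      using norm_ge_zero[of "f x - g x"] unfolding * by (simp add: ennreal_eq_0_iff)
    then show "ennreal (h x) = 0 \<longleftrightarrow> f x = g x"
      by simp
  qed
  also have "\<dots> \<longleftrightarrow> A = B"
    using f g by (simp add: L1_class_eq_iff)
  finally show "L1_dist M A B = 0 \<longleftrightarrow> A = B" .
next
  fix A B C :: "('a \<Rightarrow> 'b::banach) set"
  assume "A \<in> L1 M" "B \<in> L1 M" "C \<in> L1 M"
  then obtain f g h where f: "f \<in> L1_fun M" "A = L1_class M f"
    and g: "g \<in> L1_fun M" "B = L1_class M g" and h: "h \<in> L1_fun M" "C = L1_class M h"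
    by (auto simp: L1_def)
  have fin: "(\<integral>\<^sup>+x. ennreal (norm (f x - g x)) \<partial>M) < \<infinity>" "(\<integral>\<^sup>+x. ennreal (norm (g x - h x)) \<partial>M) < \<infinity>"
    using f g h by (auto intro!: L1_dist_finite simp del: infinity_ennreal_def)
  have "enn2real (\<integral>\<^sup>+x. ennreal (norm (f x - h x)) \<partial>M) \<le>
    enn2real ((\<integral>\<^sup>+x. ennreal (norm (f x - g x)) \<partial>M) + (\<integral>\<^sup>+x. ennreal (norm (g x - h x)) \<partial>M))"
    using f g h fin by (intro enn2real_mono nn_integral_norm_diff_triangle) (auto simp: L1_fun_def)
  also have "\<dots> = enn2real (\<integral>\<^sup>+x. ennreal (norm (f x - g x)) \<partial>M) +
      enn2real (\<integral>\<^sup>+x. ennreal (norm (g x - h x)) \<partial>M)"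
    using fin by (intro enn2real_plus) auto
  finally show "L1_dist M A C \<le> L1_dist M A B + L1_dist M B C"
    using f g h by (simp add: L1_dist_class)
qed


section \<open>Surface measure and spherical means\<close>

text \<open>
  Surface measure on the unit sphere is given by the cone formula: the measure of a Borel set is
  the dimension times the volume of the open cone over the set, see \<open>emeasure_sphere_measure\<close>.
\<close>

definition sphere_measure :: "'a::euclidean_space measure" where
  "sphere_measure =
    distr (scale_measure (of_nat DIM('a)) (restrict_space lborel (ball 0 1 - {0})))
      (restrict_space borel (sphere 0 1)) (\<lambda>x. x /\<^sub>R norm x)"

lemma space_sphere_measure: "space sphere_measure = (sphere 0 1 :: 'a::euclidean_space set)"
  by (simp add: sphere_measure_def space_restrict_space)

lemma emeasure_sphere_measure:
  fixes A :: "'a::euclidean_space set"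
  assumes "A \<in> sets borel" and "A \<subseteq> sphere 0 1"
  shows "emeasure sphere_measure A =
    of_nat DIM('a) * emeasure lborel {t *\<^sub>R \<omega> | t \<omega>. 0 < t \<and> t < 1 \<and> \<omega> \<in> A}"
proof -
  let ?B = "ball 0 1 - {0} :: 'a set"
  have B: "?B \<in> sets borel"
    by auto
  have "(\<lambda>x::'a. x /\<^sub>R norm x) \<in> restrict_space borel ?B \<rightarrow>\<^sub>M borel"
    by (intro borel_measurable_continuous_on_restrict continuous_intros) auto
  moreover have "sets (scale_measure (of_nat DIM('a)) (restrict_space lborel ?B)) =
      sets (restrict_space borel ?B)"
    by (simp add: sets_restrict_space)
  ultimately have "(\<lambda>x::'a. x /\<^sub>R norm x) \<in>
      scale_measure (of_nat DIM('a)) (restrict_space lborel ?B) \<rightarrow>\<^sub>M borel"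
    using measurable_cong_sets by blast
  then have meas: "(\<lambda>x::'a. x /\<^sub>R norm x) \<in>
      scale_measure (of_nat DIM('a)) (restrict_space lborel ?B) \<rightarrow>\<^sub>M restrict_space borel (sphere 0 1)"
    by (intro measurable_restrict_space2) (auto simp: space_restrict_space space_scale_measure)
  have A: "A \<in> sets (restrict_space borel (sphere 0 1))"
    using assms by (auto simp: sets_restrict_space_iff)
  have eq: "(\<lambda>x. x /\<^sub>R norm x) -` A \<inter> ?B = {t *\<^sub>R \<omega> | t \<omega>. 0 < t \<and> t < 1 \<and> \<omega> \<in> A}"
  proof (intro equalityI subsetI)
    fix x assume "x \<in> (\<lambda>x. x /\<^sub>R norm x) -` A \<inter> ?B"
    then have "x = norm x *\<^sub>R (x /\<^sub>R norm x)" "0 < norm x" "norm x < 1" "x /\<^sub>R norm x \<in> A"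
      by simp_all
    then show "x \<in> {t *\<^sub>R \<omega> | t \<omega>. 0 < t \<and> t < 1 \<and> \<omega> \<in> A}"
      by blast
  next
    fix x assume "x \<in> {t *\<^sub>R \<omega> | t \<omega>. 0 < t \<and> t < 1 \<and> \<omega> \<in> A}"
    then obtain t \<omega> where "x = t *\<^sub>R \<omega>" "0 < t" "t < 1" "\<omega> \<in> A"
      by auto
    moreover have "norm \<omega> = 1"
      using \<open>\<omega> \<in> A\<close> assms by auto
    ultimately show "x \<in> (\<lambda>x. x /\<^sub>R norm x) -` A \<inter> ?B"
      by auto
  qed
  have "emeasure (restrict_space lborel ?B) ((\<lambda>x. x /\<^sub>R norm x) -` A \<inter> ?B) =
      emeasure lborel ((\<lambda>x. x /\<^sub>R norm x) -` A \<inter> ?B)"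
    using B by (intro emeasure_restrict_space) auto
  then show ?thesis
    unfolding sphere_measure_def emeasure_distr[OF meas A]
    by (simp add: eq space_scale_measure space_restrict_space)
qed

definition spherical_mean :: "('a::euclidean_space \<Rightarrow> 'b::banach) \<Rightarrow> 'a \<Rightarrow> real \<Rightarrow> 'b" where
  "spherical_mean F x r =
    (1 / measure sphere_measure (sphere 0 1 :: 'a set)) *\<^sub>R
      banach_integral sphere_measure (\<lambda>\<omega>. F (x + r *\<^sub>R \<omega>))"


section \<open>Fourier transform and spherical partial sums\<close>

definition fourier :: "('a::euclidean_space \<Rightarrow> 'b::complex_banach) \<Rightarrow> 'a \<Rightarrow> 'b" where
  "fourier F \<xi> = banach_integral lborel (\<lambda>s. exp (- \<i> * complex_of_real (\<xi> \<bullet> s)) *\<^sub>C F s)"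

definition partial_sum :: "real \<Rightarrow> ('a::euclidean_space \<Rightarrow> 'b::complex_banach) \<Rightarrow> 'a \<Rightarrow> 'b" where
  "partial_sum R F x =
    (1 / (2 * pi) ^ DIM('a)) *\<^sub>R
      banach_integral (restrict_space lborel (cball 0 R))
        (\<lambda>\<xi>. exp (\<i> * complex_of_real (x \<bullet> \<xi>)) *\<^sub>C fourier F \<xi>)"


section \<open>Differentiability\<close>

text \<open>
  In finite dimension, continuity of the Frechet derivative in operator norm is the same as
  continuity of each directional derivative.
\<close>

primrec times_cont_diff :: "nat \<Rightarrow> ('a::euclidean_space \<Rightarrow> 'b::real_normed_vector) \<Rightarrow> bool" where
  "times_cont_diff 0 f \<longleftrightarrow> continuous_on UNIV f"
| "times_cont_diff (Suc k) f \<longleftrightarrow>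
    (\<forall>x. f differentiable (at x)) \<and> (\<forall>v. times_cont_diff k (\<lambda>x. frechet_derivative f (at x) v))"

definition higher_vector_derivative :: "nat \<Rightarrow> (real \<Rightarrow> 'b::real_normed_vector) \<Rightarrow> real \<Rightarrow> 'b" where
  "higher_vector_derivative l = (\<lambda>f r. vector_derivative f (at r)) ^^ l"

end

theory Submission
  imports Defs "HOL-Probability.Sinc_Integral"
begin

text \<open>
  Write \<open>f r\<close> for the spherical mean of \<open>F\<close> at \<open>x\<close> and \<open>n = 2 k + 1\<close>.
  The Fourier transform of the indicator of the ball of radius \<open>R\<close> is radial, and in odd dimension
  its profile is elementary: up to a constant it arises from \<open>sin (R r) / r\<close> by applying the operator
  \<open>- (1 / r) d/dr\<close> exactly \<open>k\<close> times (\<open>fourier_cball\<close>, \<open>has_vector_derivative_odd_ball_kernel\<close>).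
  In polar coordinates the partial sum at \<open>x\<close> becomes the integral of \<open>r ^ (2 k) f r\<close> against this
  profile (\<open>complex_functional_partial_sum_radial\<close>). Moving the \<open>k\<close> derivatives to the other factor
  turns it into a multiple of the integral over \<open>r > 0\<close> of
  \<open>sin (R r) / r * (\<Sum>j\<le>k. a j * r ^ j * (d/dr) ^ j f r)\<close> with constants \<open>a j\<close>
  (\<open>odd_ball_kernel_integral_formula\<close>).

  For \<open>j \<ge> 1\<close> the sine is integrated against \<open>r ^ (j - 1) * (d/dr) ^ j f r\<close>, which runs through a
  compact subset of the integrable functions as \<open>x\<close> runs through \<open>K\<close>. The Riemann-Lebesgue lemma is
  uniform on such sets (\<open>uniform_riemann_lebesgue\<close>), so these terms disappear for large \<open>R\<close>. For
  \<open>j = 0\<close> the factor \<open>f r / r\<close> is split into the Dini quotient of the hypotheses, treated in the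
  same way, and \<open>F x / r\<close> on \<open>(0, \<delta>)\<close>; the latter contributes \<open>F x\<close> times the sine integral at
  \<open>\<delta> R\<close>, which tends to \<open>\<pi> / 2\<close>. All constants multiply to one (\<open>normalising_constant\<close>).

  The boundary terms of the integrations by parts vanish at \<open>0\<close> because of the powers of \<open>r\<close>. At \<open>T\<close>
  they are bounded by a constant times the sum of the norms of \<open>r ^ (i - 1) * (d/dr) ^ l f r\<close> at \<open>r = T\<close> with \<open>l \<le> i \<le> k\<close>.
  This sum is integrable over the half line, so it is small for suitable arbitrarily large \<open>T\<close>, which
  is all that is needed to pass to the limit.

  The values lie in a Banach space that need not be separable. All identities are therefore proved
  after applying a complex linear functional, where the integrands are complex valued. By the
  Hahn-Banach theorem the norm of any given vector is at most the modulus of its image under a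
  functional of norm at most two (\<open>norming_complex_functional\<close>); hence an estimate that is uniform
  over these functionals is an estimate in norm.
\<close>

section \<open>Norming functionals\<close>

text \<open>
  A linear functional on a subspace that is bounded by the norm is encoded by its graph. The bound
  alone makes the graph single valued: if \<open>(0, a)\<close> belongs to it, so does \<open>(0, - a)\<close>, and both
  \<open>a\<close> and \<open>- a\<close> are at most \<open>0\<close>.
\<close>

definition dominated_graph :: "('a::real_normed_vector \<times> real) set \<Rightarrow> bool" where
  "dominated_graph G \<longleftrightarrow> subspace G \<and> (\<forall>v a. (v, a) \<in> G \<longrightarrow> a \<le> norm v)"

text \<open>
  The one-dimensional extension step of the Hahn-Banach theorem. The value \<open>c\<close> at the new vector \<open>w\<close>
  has to lie between all \<open>a - norm (v - w)\<close> and all \<open>norm (v' + w) - a'\<close>; the triangle inequality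
  shows that there is room.
\<close>

lemma dominated_graph_extend:
  fixes w :: "'a::real_normed_vector"
  assumes G: "dominated_graph G"
  obtains c where "dominated_graph ((\<lambda>((v, a), t). (v + t *\<^sub>R w, a + t * c)) ` (G \<times> (UNIV :: real set)))"
proof -
  have sub: "subspace G" and dom: "\<And>v a. (v, a) \<in> G \<Longrightarrow> a \<le> norm v"
    using G by (auto simp: dominated_graph_def)
  have zero: "(0, 0) \<in> G"
    using subspace_0[OF sub] by (simp add: zero_prod_def)
  let ?A = "(\<lambda>(v, a). a - norm (v - w)) ` G"
  define c where "c = Sup ?A"
  have key: "a - norm (v - w) \<le> norm (v' + w) - a'" if "(v, a) \<in> G" "(v', a') \<in> G" for v a v' a'
  proof -
    have "(v + v', a + a') \<in> G"
      using subspace_add[OF sub that] by simp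
    then have "a + a' \<le> norm (v + v')"
      by (rule dom)
    also have "\<dots> \<le> norm (v - w) + norm (v' + w)"
      using norm_triangle_ineq[of "v - w" "v' + w"] by simp
    finally show ?thesis
      by simp
  qed
  have bdd: "bdd_above ?A"
    using key[OF _ zero] by (intro bdd_aboveI[of _ "norm (0 + w) - 0"]) auto
  have lower: "a - norm (v - w) \<le> c" if "(v, a) \<in> G" for v a
    unfolding c_def using that bdd by (intro cSup_upper) auto
  have upper: "c \<le> norm (v + w) - a" if "(v, a) \<in> G" for v a
    unfolding c_def using zero key[OF _ that] by (intro cSup_least) auto
  have "a + t * c \<le> norm (v + t *\<^sub>R w)" if va: "(v, a) \<in> G" for v a t
  proof -
    consider "t = 0" | "t > 0" | "t < 0"
      by linarith
    then show ?thesis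
    proof cases
      case 1
      then show ?thesis
        using dom[OF va] by simp
    next
      case 2
      have "((1/t) *\<^sub>R v, a / t) \<in> G"
        using subspace_scale[OF sub va, of "1/t"] by simp
      from upper[OF this] 2 have "t * c \<le> t * norm ((1/t) *\<^sub>R v + w) - a"
        by (simp add: field_simps)
      also have "t * norm ((1/t) *\<^sub>R v + w) = norm (t *\<^sub>R ((1/t) *\<^sub>R v + w))"
        using 2 by simp
      also have "t *\<^sub>R ((1/t) *\<^sub>R v + w) = v + t *\<^sub>R w"
        using 2 by (simp add: scaleR_add_right)
      finally show ?thesis
        by simp
    next
      case 3
      have "((-1/t) *\<^sub>R v, - a / t) \<in> G"
        using subspace_scale[OF sub va, of "-1/t"] by simp
      from mult_left_mono[OF lower[OF this], of "-t"] 3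
      have "- t * (- a / t - norm ((-1/t) *\<^sub>R v - w)) \<le> - t * c"
        by simp
      then have "a + t * c \<le> - t * norm ((-1/t) *\<^sub>R v - w)"
        using 3 by (simp add: algebra_simps)
      also have "\<dots> = norm ((- t) *\<^sub>R ((-1/t) *\<^sub>R v - w))"
        using 3 by simp
      also have "(- t) *\<^sub>R ((-1/t) *\<^sub>R v - w) = v + t *\<^sub>R w"
        using 3 by (simp add: algebra_simps)
      finally show ?thesis .
    qed
  qed
  moreover have "subspace ((\<lambda>((v, a), t). (v + t *\<^sub>R w, a + t * c)) ` (G \<times> (UNIV :: real set)))"
  proof (rule linear_subspace_image)
    show "linear (\<lambda>((v, a), t). (v + t *\<^sub>R w, a + t * c))"
      by (rule linearI) (auto simp: algebra_simps)
    show "subspace (G \<times> (UNIV :: real set))"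
      using sub by (intro subspace_Times) auto
  qed
  ultimately have "dominated_graph ((\<lambda>((v, a), t). (v + t *\<^sub>R w, a + t * c)) ` (G \<times> (UNIV :: real set)))"
    unfolding dominated_graph_def by auto
  then show thesis
    by (rule that)
qed

text \<open>
  By Zorn's lemma there is a maximal graph above the line through \<open>(x, norm x)\<close>; by the extension
  step its domain is the whole space.
\<close>

lemma norming_real_functional:
  fixes x :: "'a::real_normed_vector"
  obtains \<phi> :: "'a \<Rightarrow> real" where "linear \<phi>" "\<And>v. \<phi> v \<le> norm v" "\<phi> x = norm x"
proof -
  let ?G0 = "range (\<lambda>t. (t *\<^sub>R x, t * norm x))"
  have sub0: "subspace ?G0"
    by (intro linear_subspace_image[of _ UNIV, simplified] linearI) (auto simp: algebra_simps)
  have G0: "dominated_graph ?G0"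
    unfolding dominated_graph_def using sub0 by (auto intro!: mult_right_mono simp del: mult_le_cancel_right)
  let ?S = "{G. dominated_graph G \<and> ?G0 \<subseteq> G}"
  have ub: "\<Union>C \<in> ?S" if ne: "C \<noteq> {}" and C: "subset.chain ?S C" for C
  proof (intro CollectI conjI)
    have sub: "C \<subseteq> {G. dominated_graph G \<and> ?G0 \<subseteq> G}"
      and chain: "\<And>X Y. X \<in> C \<Longrightarrow> Y \<in> C \<Longrightarrow> X \<subseteq> Y \<or> Y \<subseteq> X"
      using C by (auto simp: subset_chain_def)
    have mem: "subspace X" "\<forall>v a. (v, a) \<in> X \<longrightarrow> a \<le> norm v" "?G0 \<subseteq> X" if "X \<in> C" for X
      using subsetD[OF sub that] by (simp_all add: dominated_graph_def)
    have "subspace (\<Union>C)"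
    proof (rule subspaceI)
      show "0 \<in> \<Union>C"
        using ne mem(1) subspace_0 by blast
      fix p assume "p \<in> \<Union>C"
      then obtain X where X: "X \<in> C" "p \<in> X"
        by auto
      show "c *\<^sub>R p \<in> \<Union>C" for c
        using subspace_scale[OF mem(1)[OF X(1)] X(2)] X by blast
      fix q assume "q \<in> \<Union>C"
      then obtain Y where Y: "Y \<in> C" "q \<in> Y"
        by auto
      show "p + q \<in> \<Union>C"
        using chain[OF X(1) Y(1)]
      proof
        assume "X \<subseteq> Y"
        then show ?thesis
          using subspace_add[OF mem(1)[OF Y(1)], of p q] X Y by blast
      next
        assume "Y \<subseteq> X"
        then show ?thesis
          using subspace_add[OF mem(1)[OF X(1)], of p q] X Y by blast
      qed
    qed
    then show "dominated_graph (\<Union>C)"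
      using mem(2) unfolding dominated_graph_def by blast
    obtain X where "X \<in> C"
      using ne by blast
    then show "?G0 \<subseteq> \<Union>C"
      using mem(3)[of X] by blast
  qed
  have "\<exists>G\<in>?S. \<forall>X\<in>?S. G \<subseteq> X \<longrightarrow> X = G"
  proof (rule subset_Zorn_nonempty)
    show "?S \<noteq> {}"
      using G0 by (metis (mono_tags, lifting) empty_iff mem_Collect_eq order_refl)
  qed (rule ub)
  then obtain G where "G \<in> ?S" and m: "\<forall>X\<in>?S. G \<subseteq> X \<longrightarrow> X = G"
    by (rule bexE)
  then have G: "dominated_graph G" "?G0 \<subseteq> G"
    by simp_all
  have max: "X = G" if "dominated_graph X" "?G0 \<subseteq> X" "G \<subseteq> X" for X
    using bspec[OF m, of X] that by simp
  have sub: "subspace G" and dom: "\<And>v a. (v, a) \<in> G \<Longrightarrow> a \<le> norm v"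
    using G(1) by (auto simp: dominated_graph_def)
  have ex: "\<exists>a. (v, a) \<in> G" for v
  proof -
    obtain c where c: "dominated_graph ((\<lambda>((u, a), t). (u + t *\<^sub>R v, a + t * c)) ` (G \<times> (UNIV :: real set)))"
      (is "dominated_graph ?H")
      using dominated_graph_extend[OF G(1)] .
    have "G \<subseteq> ?H"
    proof clarify
      fix u a assume "(u, a) \<in> G"
      then show "(u, a) \<in> ?H"
        by (intro image_eqI[of _ _ "((u, a), 0)"]) auto
    qed
    then have "?H = G"
      using c G(2) by (intro max) auto
    moreover have "(v, c) \<in> ?H"
      using subspace_0[OF sub] by (intro image_eqI[of _ _ "((0, 0), 1)"]) (auto simp: zero_prod_def)
    ultimately show ?thesis
      by blast
  qed
  have uniq: "a = b" if "(v, a) \<in> G" "(v, b) \<in> G" for v a b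
  proof -
    have "(0, a - b) \<in> G" "(0, b - a) \<in> G"
      using subspace_diff[OF sub that] subspace_diff[OF sub that(2,1)] by auto
    from dom[OF this(1)] dom[OF this(2)] show ?thesis
      by simp
  qed
  define \<phi> where "\<phi> v = (THE a. (v, a) \<in> G)" for v
  have \<phi>: "(v, \<phi> v) \<in> G" for v
  proof -
    have "\<exists>!a. (v, a) \<in> G"
      using ex[of v] uniq[of v] by blast
    then show ?thesis
      unfolding \<phi>_def by (rule theI')
  qed
  have eq: "\<phi> v = a" if "(v, a) \<in> G" for v a
    using uniq[OF \<phi> that] .
  show thesis
  proof
    show "linear \<phi>"
    proof (rule linearI)
      show "\<phi> (u + v) = \<phi> u + \<phi> v" for u v
        using subspace_add[OF sub \<phi> \<phi>, of u v] by (intro eq) simp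
      show "\<phi> (r *\<^sub>R v) = r *\<^sub>R \<phi> v" for r v
        using subspace_scale[OF sub \<phi>, of r v] by (intro eq) simp
    qed
    show "\<phi> v \<le> norm v" for v
      using dom[OF \<phi>] .
    have "(1 *\<^sub>R x, 1 * norm x) \<in> G"
      using G(2) by blast
    then show "\<phi> x = norm x"
      by (intro eq) simp
  qed
qed

text \<open>
  The bound is two rather than one because a real functional \<open>\<phi>\<close> of norm one is complexified to
  \<open>\<phi> v - \<i> \<phi> (\<i> v)\<close>, and the crude estimate of both parts suffices.
\<close>

definition complex_functional :: "('a::complex_banach \<Rightarrow> complex) \<Rightarrow> bool" where
  "complex_functional \<Phi> \<longleftrightarrow> (\<forall>u v. \<Phi> (u + v) = \<Phi> u + \<Phi> v) \<and> (\<forall>a v. \<Phi> (a *\<^sub>C v) = a * \<Phi> v) \<and>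
    (\<forall>v. cmod (\<Phi> v) \<le> 2 * norm v)"

lemma norming_complex_functional:
  fixes x :: "'a::complex_banach"
  obtains \<Phi> where "complex_functional \<Phi>" "norm x \<le> cmod (\<Phi> x)"
proof -
  obtain \<phi> :: "'a \<Rightarrow> real" where lin: "linear \<phi>" and le: "\<And>v. \<phi> v \<le> norm v" and x: "\<phi> x = norm x"
    using norming_real_functional[of x] by blast
  define \<Phi> where "\<Phi> v = Complex (\<phi> v) (- \<phi> (\<i> *\<^sub>C v))" for v
  have abs: "\<bar>\<phi> v\<bar> \<le> norm v" for v
    using le[of v] le[of "-v"] linear_neg[OF lin, of v] by simp
  have split: "a *\<^sub>C v = Re a *\<^sub>R v + Im a *\<^sub>R (\<i> *\<^sub>C v)" for a and v :: 'a
  proof -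
    have "a *\<^sub>C v = (complex_of_real (Re a) + complex_of_real (Im a) * \<i>) *\<^sub>C v"
      by (simp add: complex_eq mult.commute flip: complex_eq)
    then show ?thesis
      by (simp only: scaleC_add_left scaleC_of_real flip: scaleC_scaleC)
  qed
  have ii: "\<i> *\<^sub>C (\<i> *\<^sub>C v) = - v" for v :: 'a
    using scaleC_of_real[of "-1" v] by (simp add: scaleC_scaleC)
  have i_scale: "\<i> *\<^sub>C (r *\<^sub>R v) = r *\<^sub>R (\<i> *\<^sub>C v)" for r and v :: 'a
    by (simp add: scaleC_scaleC mult.commute flip: scaleC_of_real)
  have mult: "\<Phi> (a *\<^sub>C v) = a * \<Phi> v" for a v
    unfolding \<Phi>_def split[of a]
    by (simp add: complex_eq_iff linear_add[OF lin] linear_scale[OF lin] linear_neg[OF lin] linear_diff[OF lin] scaleC_add_right i_scale ii)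
  have bound: "cmod (\<Phi> v) \<le> 2 * norm v" for v
  proof -
    have "cmod (\<Phi> v) \<le> \<bar>\<phi> v\<bar> + \<bar>\<phi> (\<i> *\<^sub>C v)\<bar>"
      using cmod_le[of "\<Phi> v"] by (simp add: \<Phi>_def)
    also have "\<dots> \<le> 2 * norm v"
      using abs[of v] abs[of "\<i> *\<^sub>C v"] by (simp add: norm_scaleC)
    finally show ?thesis .
  qed
  have "complex_functional \<Phi>"
    unfolding complex_functional_def
  proof (intro conjI allI)
    show "\<Phi> (u + v) = \<Phi> u + \<Phi> v" for u v
      by (simp add: \<Phi>_def linear_add[OF lin] scaleC_add_right complex_eq_iff)
  qed (rule mult, rule bound)
  moreover have "norm x \<le> cmod (\<Phi> x)"
    using abs_Re_le_cmod[of "\<Phi> x"] by (simp add: \<Phi>_def x)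
  ultimately show thesis
    by (rule that)
qed

lemma complex_functional_bounded_linear:
  assumes "complex_functional \<Phi>"
  shows "bounded_linear \<Phi>"
proof (rule bounded_linear_intro)
  show "\<Phi> (u + v) = \<Phi> u + \<Phi> v" for u v
    using assms by (simp add: complex_functional_def)
  show "\<Phi> (r *\<^sub>R v) = r *\<^sub>R \<Phi> v" for r v
    using assms by (simp add: complex_functional_def scaleR_conv_of_real flip: scaleC_of_real)
  show "norm (\<Phi> v) \<le> norm v * 2" for v
    using assms by (simp add: complex_functional_def mult.commute)
qed

section \<open>The Bochner integral under functionals\<close>

abbreviation (input) simple_integrable :: "'a measure \<Rightarrow> ('a \<Rightarrow> 'b::real_vector) \<Rightarrow> bool" where
  "simple_integrable \<equiv> Bochner_Integration.simple_bochner_integrable"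

abbreviation (input) simple_integral :: "'a measure \<Rightarrow> ('a \<Rightarrow> 'b::real_vector) \<Rightarrow> 'b" where
  "simple_integral \<equiv> Bochner_Integration.simple_bochner_integral"

abbreviation (input) L1_gap :: "'a measure \<Rightarrow> ('a \<Rightarrow> 'b::real_normed_vector) \<Rightarrow> ('a \<Rightarrow> 'b) \<Rightarrow> ennreal" where
  "L1_gap M f g \<equiv> \<integral>\<^sup>+x. ennreal (norm (f x - g x)) \<partial>M"

text \<open>
  The given simple functions converge only pointwise. Cutting each of them off where its norm exceeds
  twice the norm of the limit keeps it simple, keeps the pointwise limit, and gives an integrable
  majorant for dominated convergence.
\<close>

lemma L1_fun_simple_approximation:
  fixes f :: "'a \<Rightarrow> 'b::banach"
  assumes "f \<in> L1_fun M"
  obtains s where "\<And>i::nat. simple_integrable M (s i)"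
    and "(\<lambda>i. L1_gap M f (s i)) \<longlonglongrightarrow> 0"
proof -
  have f: "strongly_measurable M f" and fin: "(\<integral>\<^sup>+x. ennreal (norm (f x)) \<partial>M) < \<infinity>"
    using assms by (auto simp: L1_fun_def)
  obtain s where s: "\<And>i::nat. simple_function M (s i)" and lim: "AE x in M. (\<lambda>i. s i x) \<longlonglongrightarrow> f x"
    using f by (auto simp: strongly_measurable_def)
  obtain h where h: "h \<in> borel_measurable M" "AE x in M. norm (f x - 0) = h x"
    using strongly_measurable_norm_diff[OF f strongly_measurable_zero] .
  (* h is a measurable version of the norm of f, which itself need not be Borel measurable *)
  define t where "t i x = (if norm (s i x) \<le> 2 * h x then s i x else 0)" for i x
  have s_norm: "(\<lambda>x. norm (s i x)) \<in> borel_measurable M" for i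
    using simple_function_compose1[OF s, of norm i] by (rule borel_measurable_simple_function)
  have t: "simple_function M (t i)" for i
    unfolding t_def using s s_norm h(1) by (intro simple_function_If) auto
  have fin_h: "(\<integral>\<^sup>+x. ennreal (3 * h x) \<partial>M) < \<infinity>"
  proof -
    have "(\<integral>\<^sup>+x. ennreal (3 * h x) \<partial>M) = (\<integral>\<^sup>+x. 3 * ennreal (h x) \<partial>M)"
      by (simp add: ennreal_mult')
    also have "\<dots> = 3 * (\<integral>\<^sup>+x. ennreal (h x) \<partial>M)"
      using h(1) by (intro nn_integral_cmult) auto
    also have "(\<integral>\<^sup>+x. ennreal (h x) \<partial>M) = (\<integral>\<^sup>+x. ennreal (norm (f x)) \<partial>M)"
      using h(2) by (intro nn_integral_cong_AE) (auto elim!: eventually_mono)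
    also have "3 * \<dots> < \<infinity>"
      using fin by (simp add: ennreal_mult_less_top)
    finally show ?thesis .
  qed
  have "\<exists>u. u \<in> borel_measurable M \<and> (AE x in M. norm (f x - t i x) = u x)" for i
    using strongly_measurable_norm_diff[OF f simple_function_imp_strongly_measurable[OF t[of i]]] by blast
  then obtain u where u: "\<And>i. u i \<in> borel_measurable M" "\<And>i. AE x in M. norm (f x - t i x) = u i x"
    by metis
  have "(\<lambda>i. \<integral>\<^sup>+x. ennreal (norm (0 - u i x)) \<partial>M) \<longlonglongrightarrow> 0"
  proof (rule nn_integral_dominated_convergence_norm[where w = "\<lambda>x. 3 * h x"])
    show "AE x in M. norm (u j x) \<le> 3 * h x" for j
      using h(2) u(2)[of j]
    proof eventually_elim
      case (elim x)
      have "norm (f x - t j x) \<le> norm (f x) + norm (t j x)"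
        by (rule norm_triangle_ineq4)
      also have "norm (t j x) \<le> 2 * h x"
        using elim(1) norm_ge_zero[of "f x"] by (simp add: t_def)
      finally have "norm (f x - t j x) \<le> 3 * h x"
        using elim(1) by simp
      then show ?case
        using elim(2) norm_ge_zero[of "f x - t j x"] by simp
    qed
    have all: "AE x in M. \<forall>i. norm (f x - t i x) = u i x"
      using u(2) by (simp add: AE_all_countable)
    show "AE x in M. (\<lambda>i. u i x) \<longlonglongrightarrow> 0"
      using h(2) lim all
    proof eventually_elim
      case (elim x)
      have "(\<lambda>i. t i x) \<longlonglongrightarrow> f x"
      proof (cases "f x = 0")
        case True
        then have "(\<lambda>i. s i x) \<longlonglongrightarrow> 0"
          using elim by simp
        then show ?thesis
          unfolding True by (rule Lim_null_comparison[OF always_eventually tendsto_norm_zero, rotated]) (simp add: t_def)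
      next
        case False
        have "(\<lambda>i. norm (s i x)) \<longlonglongrightarrow> norm (f x)"
          using elim(2) by (rule tendsto_norm)
        then have "eventually (\<lambda>i. norm (s i x) < 2 * norm (f x)) sequentially"
          using False by (intro order_tendstoD) auto
        then have "eventually (\<lambda>i. t i x = s i x) sequentially"
          by eventually_elim (use elim(1) in \<open>simp add: t_def\<close>)
        then show ?thesis
          using elim(2) by (simp add: tendsto_cong)
      qed
      then have "(\<lambda>i. norm (f x - t i x)) \<longlonglongrightarrow> norm (f x - f x)"
        by (intro tendsto_intros)
      then show ?case
        using elim(3) by simp
    qed
  qed (use u(1) h(1) fin_h in auto)
  moreover have "(\<integral>\<^sup>+x. ennreal (norm (0 - u i x)) \<partial>M) = L1_gap M f (t i)" for i
    using u(2)[of i] by (intro nn_integral_cong_AE, eventually_elim) (metis abs_norm_cancel norm_minus_commute real_norm_def diff_zero)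
  ultimately have conv: "(\<lambda>i. L1_gap M f (t i)) \<longlonglongrightarrow> 0"
    by simp
  have "simple_integrable M (t i)" for i
  proof (rule simple_bochner_integrableI_bounded[OF t])
    have "(\<integral>\<^sup>+x. ennreal (norm (t i x)) \<partial>M) \<le> (\<integral>\<^sup>+x. ennreal (3 * h x) \<partial>M)"
    proof (rule nn_integral_mono_AE)
      show "AE x in M. ennreal (norm (t i x)) \<le> ennreal (3 * h x)"
        using h(2)
      proof eventually_elim
        case (elim x)
        have "0 \<le> h x"
          using elim norm_ge_zero[of "f x"] by simp
        then show ?case
          by (intro ennreal_leI) (simp add: t_def)
      qed
    qed
    then show "(\<integral>\<^sup>+x. ennreal (norm (t i x)) \<partial>M) < \<infinity>"
      using fin_h by (rule order.strict_trans1)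
  qed
  then show thesis
    using conv by (rule that)
qed

text \<open>
  Both integrals are compared with a common function \<open>f\<close>, so that closeness to \<open>f\<close> in mean forces
  the integrals of simple approximations to form a Cauchy sequence.
\<close>

lemma simple_bochner_integral_diff_le:
  fixes f :: "'a \<Rightarrow> 'b::banach"
  assumes f: "strongly_measurable M f"
    and s: "simple_integrable M s"
    and t: "simple_integrable M t"
  shows "ennreal (norm (simple_integral M s -
      simple_integral M t)) \<le>
    L1_gap M f s + L1_gap M f t"
proof -
  let ?I = "simple_integral M"
  have d: "simple_integrable M (\<lambda>x. s x - t x)"
    using s t by (rule simple_bochner_integrable_compose2[rotated]) simp
  then have n: "simple_integrable M (\<lambda>x. norm (s x - t x))"
    using simple_bochner_integrable_compose2[of "\<lambda>a b. norm a", OF _ d d] by simp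
  have "norm (?I s - ?I t) = norm (?I (\<lambda>x. s x - t x))"
    using s t by (simp add: simple_bochner_integral_diff)
  also have "\<dots> \<le> ?I (\<lambda>x. norm (s x - t x))"
    by (rule simple_bochner_integral_norm_bound[OF d])
  finally have "ennreal (norm (?I s - ?I t)) \<le> ennreal (?I (\<lambda>x. norm (s x - t x)))"
    by (rule ennreal_leI)
  also have "\<dots> = L1_gap M s t"
    by (rule simple_bochner_integral_eq_nn_integral[OF n]) simp
  also have "\<dots> \<le> L1_gap M s f + L1_gap M f t"
    using s t f by (intro nn_integral_norm_diff_triangle)
      (auto intro!: simple_function_imp_strongly_measurable elim: Bochner_Integration.simple_bochner_integrable.cases)
  finally show ?thesis
    by (simp add: norm_minus_commute)
qed

lemma has_banach_integral_banach_integral: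
  fixes f :: "'a \<Rightarrow> 'b::banach"
  assumes "f \<in> L1_fun M"
  shows "has_banach_integral M f (banach_integral M f)"
proof -
  let ?I = "simple_integral M"
  have f: "strongly_measurable M f"
    using assms by (auto simp: L1_fun_def)
  obtain s where s: "\<And>i::nat. simple_integrable M (s i)"
    and lim: "(\<lambda>i. L1_gap M f (s i)) \<longlonglongrightarrow> 0"
    using L1_fun_simple_approximation[OF assms] by blast
  have "Cauchy (\<lambda>i. ?I (s i))"
  proof (rule metric_CauchyI)
    fix e :: real assume "e > 0"
    then have "eventually (\<lambda>i. L1_gap M f (s i) < ennreal (e / 2)) sequentially"
      using lim by (intro order_tendstoD(2)[OF lim]) auto
    then obtain N where N: "\<And>i. i \<ge> N \<Longrightarrow> (L1_gap M f (s i)) < ennreal (e / 2)"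
      by (auto simp: eventually_sequentially)
    have "dist (?I (s m)) (?I (s n)) < e" if "m \<ge> N" "n \<ge> N" for m n
    proof -
      have "ennreal (norm (?I (s m) - ?I (s n))) < ennreal (e / 2) + ennreal (e / 2)"
        using simple_bochner_integral_diff_le[OF f s s, of m n] add_strict_mono[OF N[OF that(1)] N[OF that(2)]]
        by (rule order.strict_trans1)
      also have "\<dots> = ennreal e"
        using \<open>e > 0\<close> by (simp flip: ennreal_plus)
      finally show ?thesis
        using \<open>e > 0\<close> by (simp add: dist_norm ennreal_less_iff)
    qed
    then show "\<exists>N. \<forall>m\<ge>N. \<forall>n\<ge>N. dist (?I (s m)) (?I (s n)) < e"
      by blast
  qed
  then obtain y where "(\<lambda>i. ?I (s i)) \<longlonglongrightarrow> y"
    using Cauchy_convergent convergent_def by blast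
  then have "has_banach_integral M f y"
    unfolding has_banach_integral_def using f s lim by blast
  then show ?thesis
    unfolding banach_integral_def using has_banach_integral_unique by (metis theI)
qed

lemma has_banach_integral_bounded_linear:
  fixes f :: "'a \<Rightarrow> 'b::banach" and T :: "'b \<Rightarrow> 'c::banach"
  assumes T: "bounded_linear T" and f: "has_banach_integral M f y"
  shows "has_banach_integral M (\<lambda>x. T (f x)) (T y)"
proof -
  interpret T: bounded_linear T by fact
  have fm: "strongly_measurable M f"
    using f by (simp add: has_banach_integral_def)
  obtain s where s: "\<And>i::nat. simple_integrable M (s i)"
    "(\<lambda>i. L1_gap M f (s i)) \<longlonglongrightarrow> 0"
    "(\<lambda>i. simple_integral M (s i)) \<longlonglongrightarrow> y"
    using f unfolding has_banach_integral_def by blast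
  obtain B where B: "B > 0" "\<And>x. norm (T x) \<le> norm x * B"
    using T.pos_bounded by blast
  obtain q where q: "\<And>i::nat. simple_function M (q i)" "AE x in M. (\<lambda>i. q i x) \<longlonglongrightarrow> f x"
    using fm by (auto simp: strongly_measurable_def)
  have Tf: "strongly_measurable M (\<lambda>x. T (f x))"
    unfolding strongly_measurable_def
  proof (intro exI[of _ "\<lambda>i x. T (q i x)"] conjI allI)
    show "simple_function M (\<lambda>x. T (q i x))" for i
      using simple_function_compose1[OF q(1)[of i], of T] by simp
    show "AE x in M. (\<lambda>i. T (q i x)) \<longlonglongrightarrow> T (f x)"
      using q(2) by eventually_elim (rule T.tendsto)
  qed
  have Ts: "simple_integrable M (\<lambda>x. T (s i x))" for i
    using simple_bochner_integrable_compose2[of "\<lambda>a b. T a", OF _ s(1)[of i] s(1)[of i]] by (simp add: T.zero)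
  have lim: "(\<lambda>i. \<integral>\<^sup>+x. ennreal (norm (T (f x) - T (s i x))) \<partial>M) \<longlonglongrightarrow> 0"
  proof (rule tendsto_sandwich[OF _ _ tendsto_const])
    have "(\<integral>\<^sup>+x. ennreal (norm (T (f x) - T (s i x))) \<partial>M) \<le> ennreal B * (L1_gap M f (s i))" for i
    proof -
      have si: "strongly_measurable M (s i)"
        using s(1)[of i] by (auto intro!: simple_function_imp_strongly_measurable elim: Bochner_Integration.simple_bochner_integrable.cases)
      obtain h where h: "h \<in> borel_measurable M" "AE x in M. norm (f x - s i x) = h x"
        using strongly_measurable_norm_diff[OF fm si] .
      have "(\<integral>\<^sup>+x. ennreal (norm (T (f x) - T (s i x))) \<partial>M) \<le> (\<integral>\<^sup>+x. ennreal B * ennreal (h x) \<partial>M)"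
      proof (rule nn_integral_mono_AE)
        show "AE x in M. ennreal (norm (T (f x) - T (s i x))) \<le> ennreal B * ennreal (h x)"
          using h(2)
        proof eventually_elim
          case (elim x)
          then have "norm (T (f x) - T (s i x)) \<le> B * h x"
            using B(2)[of "f x - s i x"] by (simp add: T.diff mult.commute)
          then show ?case
            using B(1) by (simp add: ennreal_leI flip: ennreal_mult')
        qed
      qed
      also have "\<dots> = ennreal B * (\<integral>\<^sup>+x. ennreal (h x) \<partial>M)"
        using h(1) by (intro nn_integral_cmult) auto
      also have "(\<integral>\<^sup>+x. ennreal (h x) \<partial>M) = L1_gap M f (s i)"
        using h(2) by (intro nn_integral_cong_AE) (auto elim!: eventually_mono)
      finally show ?thesis .
    qed
    then show "eventually (\<lambda>i. (\<integral>\<^sup>+x. ennreal (norm (T (f x) - T (s i x))) \<partial>M) \<le> ennreal B * (L1_gap M f (s i))) sequentially"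
      by simp
    show "(\<lambda>i. ennreal B * (L1_gap M f (s i))) \<longlonglongrightarrow> 0"
      using ennreal_tendsto_cmult[OF _ s(2), of "ennreal B"] by simp
  qed simp
  have "simple_integral M (\<lambda>x. T (s i x)) =
      T (simple_integral M (s i))" for i
    by (rule simple_bochner_integral_linear[OF T.linear_axioms s(1)])
  then have "(\<lambda>i. simple_integral M (\<lambda>x. T (s i x))) \<longlonglongrightarrow> T y"
    using T.tendsto[OF s(3)] by simp
  then show ?thesis
    unfolding has_banach_integral_def using Tf Ts lim by (intro conjI exI[of _ "\<lambda>i x. T (s i x)"] allI)
qed

text \<open>
  Simple functions that approximate \<open>g\<close> in the finite-dimensional space are mapped by \<open>f\<close> to simple
  functions, and continuity carries the convergence over, even if the target is not separable.
\<close>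

lemma continuous_imp_strongly_measurable:
  fixes f :: "'a::euclidean_space \<Rightarrow> 'b::real_normed_vector"
  assumes f: "continuous_on UNIV f" and g: "g \<in> borel_measurable M"
  shows "strongly_measurable M (\<lambda>x. f (g x))"
proof -
  obtain s where s: "\<And>i::nat. simple_function M (s i)" "\<And>x. x \<in> space M \<Longrightarrow> (\<lambda>i. s i x) \<longlonglongrightarrow> g x"
    using borel_measurable_implies_sequence_metric[OF g, of 0] by blast
  show ?thesis
    unfolding strongly_measurable_def
  proof (intro exI[of _ "\<lambda>i x. f (s i x)"] conjI allI AE_I2)
    show "simple_function M (\<lambda>x. f (s i x))" for i
      using simple_function_compose1[OF s(1)[of i], of f] by simp
    show "(\<lambda>i. f (s i x)) \<longlonglongrightarrow> f (g x)" if "x \<in> space M" for x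
      using f s(2)[OF that] by (auto simp: continuous_on_eq_continuous_at intro: isCont_tendsto_compose)
  qed
qed

text \<open>
  Functionals commute with the integral, and the image is an ordinary complex Bochner integral. This
  is the bridge on which every identity and every norm estimate below rests.
\<close>

lemma
  assumes \<Phi>: "complex_functional \<Phi>" and f: "f \<in> L1_fun M" and m: "(\<lambda>x. \<Phi> (f x)) \<in> borel_measurable M"
  shows complex_functional_integrable: "integrable M (\<lambda>x. \<Phi> (f x))"
    and complex_functional_banach_integral: "\<Phi> (banach_integral M f) = (\<integral>x. \<Phi> (f x) \<partial>M)"
  using has_banach_integral_bounded_linear[OF complex_functional_bounded_linear[OF \<Phi>] has_banach_integral_banach_integral[OF f]]
  by (simp_all add: has_banach_integral_iff_has_bochner_integral[OF m] has_bochner_integral_iff)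

lemma L1_fun_finite_measure_compact:
  fixes g :: "'a::euclidean_space \<Rightarrow> 'b::banach"
  assumes M: "finite_measure M" "(\<lambda>x. x) \<in> borel_measurable M" "space M \<subseteq> C" and C: "compact C"
    and g: "continuous_on UNIV g"
  shows "g \<in> L1_fun M"
proof -
  interpret finite_measure M
    by fact
  have "compact (g ` C)"
    using continuous_on_subset[OF g] C by (intro compact_continuous_image) auto
  then obtain B where "\<forall>v\<in>g ` C. norm v \<le> B"
    using compact_imp_bounded[of "g ` C"] unfolding bounded_iff by blast
  then have B: "norm (g x) \<le> B" if "x \<in> space M" for x
    using that M(3) by blast
  have "(\<integral>\<^sup>+x. ennreal (norm (g x)) \<partial>M) \<le> nn_integral M (\<lambda>x. ennreal B)"
    using B by (intro nn_integral_mono ennreal_leI)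
  also have "\<dots> < \<infinity>"
  proof -
    have "emeasure M (space M) < top"
      using emeasure_finite[of "space M"] by (metis less_top infinity_ennreal_def)
    then show ?thesis
      by (simp add: ennreal_mult_less_top)
  qed
  finally show ?thesis
    using continuous_imp_strongly_measurable[OF g M(2)] by (simp add: L1_fun_def)
qed

section \<open>Polar coordinates\<close>

text \<open>
  The density is cut off at \<open>0\<close> by the indicator, so that the measure can live on all reals.
\<close>

definition radial_measure :: "nat \<Rightarrow> real measure" where
  "radial_measure n = density lborel (\<lambda>r. ennreal (indicator {0<..} r * r ^ (n - 1)))"

lemma sets_radial_measure [measurable_cong, simp]: "sets (radial_measure n) = sets borel"
  by (simp add: radial_measure_def)

lemma space_radial_measure [simp]: "space (radial_measure n) = UNIV"
  by (simp add: radial_measure_def)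

lemma emeasure_radial_measure_lessThan:
  assumes "n > 0" "a \<ge> 0"
  shows "emeasure (radial_measure n) {..<a} = ennreal (a ^ n / real n)"
proof -
  have "emeasure (radial_measure n) {..<a} =
      (\<integral>\<^sup>+r. ennreal (indicator {0<..} r * r ^ (n - 1)) * indicator {..<a} r \<partial>lborel)"
    unfolding radial_measure_def by (rule emeasure_density) auto
  also have "\<dots> = (\<integral>\<^sup>+r. ennreal (r ^ (n - 1)) * indicator {0..a} r \<partial>lborel)"
  proof (rule nn_integral_cong_AE)
    have "AE r in lborel. r \<noteq> 0 \<and> r \<noteq> (a::real)"
      using AE_lborel_singleton[of 0] AE_lborel_singleton[of a] by eventually_elim simp
    then show "AE r in lborel. ennreal (indicator {0<..} r * r ^ (n - 1)) * indicator {..<a} r =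
        ennreal (r ^ (n - 1)) * indicator {0..a} r"
      by eventually_elim (auto simp: indicator_def)
  qed
  also have "\<dots> = ennreal (a ^ n / real n - 0 ^ n / real n)"
    using assms
    by (intro nn_integral_FTC_Icc)
       (auto intro!: derivative_eq_intros simp: field_simps simp flip: power_Suc)
  finally show ?thesis
    using assms by (simp add: zero_power)
qed

lemma sigma_finite_radial_measure:
  assumes "n > 0"
  shows "sigma_finite_measure (radial_measure n)"
proof
  show "\<exists>A. countable A \<and> A \<subseteq> sets (radial_measure n) \<and> \<Union> A = space (radial_measure n) \<and>
      (\<forall>a\<in>A. emeasure (radial_measure n) a \<noteq> \<infinity>)"
  proof (intro exI[of _ "range (\<lambda>i::nat. {..<real i})"] conjI ballI)
    show "\<Union> (range (\<lambda>i::nat. {..<real i})) = space (radial_measure n)"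
      using reals_Archimedean2 by auto
  qed (use assms in \<open>auto simp: emeasure_radial_measure_lessThan\<close>)
qed

text \<open>
  Surface measure is defined through cones of height one; dilation by \<open>a\<close> multiplies Lebesgue measure
  by \<open>a ^ DIM\<close>.
\<close>

lemma emeasure_scaled_cone:
  fixes A :: "'a::euclidean_space set"
  assumes "A \<in> sets borel" "A \<subseteq> sphere 0 1" "a > 0"
  shows "of_nat DIM('a) * emeasure lborel {x. x \<noteq> 0 \<and> x /\<^sub>R norm x \<in> A \<and> norm x < a} =
    ennreal (a ^ DIM('a)) * emeasure sphere_measure A"
proof -
  let ?S = "{x. x \<noteq> 0 \<and> x /\<^sub>R norm x \<in> A \<and> norm x < a}"
  have S: "?S \<in> sets borel"
    using assms(1) by measurable
  have "emeasure lborel ?S = (\<integral>\<^sup>+x. indicator ?S x \<partial>lborel)"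
    using S by simp
  also have "\<dots> = ennreal (a ^ DIM('a)) * (\<integral>\<^sup>+x. indicator ?S (a *\<^sub>R x) \<partial>lborel)"
  proof -
    have "(\<integral>\<^sup>+x. indicator ?S x \<partial>lborel) =
        (\<integral>\<^sup>+x. indicator ?S x \<partial>density (distr lborel borel (\<lambda>x. 0 + a *\<^sub>R x)) (\<lambda>_. \<bar>a\<bar> ^ DIM('a)))"
      using lborel_affine[of a "0::'a"] assms(3) by simp
    also have "\<dots> = (\<integral>\<^sup>+x. ennreal (a ^ DIM('a)) * indicator ?S (a *\<^sub>R x) \<partial>lborel)"
      using S assms(3) by (simp add: nn_integral_density nn_integral_distr del: nn_integral_indicator)
    also have "\<dots> = ennreal (a ^ DIM('a)) * (\<integral>\<^sup>+x. indicator ?S (a *\<^sub>R x) \<partial>lborel)"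
      using S by (intro nn_integral_cmult) simp
    finally show ?thesis .
  qed
  also have "(\<lambda>x. indicator ?S (a *\<^sub>R x) :: ennreal) = indicator {x. x \<noteq> 0 \<and> x /\<^sub>R norm x \<in> A \<and> norm x < 1}"
  proof
    fix x :: 'a
    have "(a *\<^sub>R x) /\<^sub>R norm (a *\<^sub>R x) = x /\<^sub>R norm x" "norm (a *\<^sub>R x) < a \<longleftrightarrow> norm x < 1"
      using assms(3) by simp_all
    then have "a *\<^sub>R x \<in> ?S \<longleftrightarrow> x \<in> {x. x \<noteq> 0 \<and> x /\<^sub>R norm x \<in> A \<and> norm x < 1}"
      using assms(3) by (simp only: mem_Collect_eq) simp
    then show "(indicator ?S (a *\<^sub>R x) :: ennreal) = indicator {x. x \<noteq> 0 \<and> x /\<^sub>R norm x \<in> A \<and> norm x < 1} x"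
      by (simp only: indicator_def)
  qed
  also have "{x. x \<noteq> 0 \<and> x /\<^sub>R norm x \<in> A \<and> norm x < 1} = {t *\<^sub>R \<omega> | t \<omega>. 0 < t \<and> t < 1 \<and> \<omega> \<in> A}"
    (is "?L = ?R")
  proof (intro equalityI subsetI)
    fix x assume "x \<in> ?L"
    then have "x = norm x *\<^sub>R (x /\<^sub>R norm x)" "0 < norm x" "norm x < 1" "x /\<^sub>R norm x \<in> A"
      by simp_all
    then show "x \<in> ?R"
      by blast
  next
    fix x assume "x \<in> ?R"
    then obtain t \<omega> where "x = t *\<^sub>R \<omega>" "0 < t" "t < 1" "\<omega> \<in> A"
      by auto
    moreover have "norm \<omega> = 1"
      using \<open>\<omega> \<in> A\<close> assms(2) by auto
    ultimately show "x \<in> ?L"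
      by auto
  qed
  also have "(\<integral>\<^sup>+x. indicator ?R x \<partial>lborel) = emeasure lborel ?R"
  proof (rule nn_integral_indicator)
    have "?L \<in> sets borel"
      using assms(1) by measurable
    then show "?R \<in> sets lborel"
      using \<open>?L = ?R\<close> by simp
  qed
  finally show ?thesis
    using assms by (simp add: emeasure_sphere_measure mult_ac)
qed

lemma emeasure_sphere_finite: "emeasure sphere_measure A < \<infinity>"
proof (cases "A \<in> sets (sphere_measure :: 'a::euclidean_space measure)")
  case True
  have B: "of_nat DIM('a) * emeasure lborel {x::'a. x \<noteq> 0 \<and> x /\<^sub>R norm x \<in> sphere 0 1 \<and> norm x < (1::real)} =
      ennreal (1 ^ DIM('a)) * emeasure sphere_measure (sphere 0 1 :: 'a set)"
    by (rule emeasure_scaled_cone) auto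
  have "emeasure lborel {x::'a. x \<noteq> 0 \<and> x /\<^sub>R norm x \<in> sphere 0 1 \<and> norm x < (1::real)} \<le> emeasure lborel (ball (0::'a) 1)"
    by (intro emeasure_mono) auto
  also have "\<dots> < \<infinity>"
    by (rule emeasure_bounded_finite) simp
  finally have "of_nat DIM('a) * emeasure lborel {x::'a. x \<noteq> 0 \<and> x /\<^sub>R norm x \<in> sphere 0 1 \<and> norm x < (1::real)} < \<infinity>"
    by (simp add: ennreal_mult_less_top of_nat_less_top)
  then have "emeasure sphere_measure (sphere 0 1 :: 'a set) < \<infinity>"
    unfolding B by simp
  moreover have "emeasure sphere_measure A \<le> emeasure sphere_measure (sphere 0 1 :: 'a set)"
    using emeasure_space[of sphere_measure A] by (simp add: space_sphere_measure)
  ultimately show ?thesis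
    by (rule order.strict_trans1[rotated])
qed (simp add: emeasure_notin_sets)

lemma finite_measure_sphere_measure: "finite_measure (sphere_measure :: 'a::euclidean_space measure)"
  using emeasure_sphere_finite[of "space (sphere_measure :: 'a measure)"] by (intro finite_measureI) auto

lemma sets_sphere_measure [measurable_cong]: "sets sphere_measure = sets (restrict_space borel (sphere 0 1))"
  by (simp add: sphere_measure_def)

lemma lessThan_Int_real: "{..<a} \<inter> {..<b} = {..<min a (b::real)}"
  by auto

text \<open>
  For fixed \<open>A\<close> both sides are measures in \<open>B\<close>. They agree on \<open>{..<a}\<close> by the dilation formula, and
  these sets generate the Borel sets.
\<close>

lemma emeasure_polar_rectangle:
  fixes A :: "'a::euclidean_space set"
  assumes A: "A \<in> sets borel" "A \<subseteq> sphere 0 1" and B: "B \<in> sets borel"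
  shows "emeasure lborel {x. x \<noteq> 0 \<and> x /\<^sub>R norm x \<in> A \<and> norm x \<in> B} =
    emeasure (radial_measure DIM('a)) B * emeasure sphere_measure A"
proof -
  let ?C = "{x::'a. x \<noteq> 0 \<and> x /\<^sub>R norm x \<in> A}"
  have C: "?C \<in> sets borel"
    using A(1) by measurable
  let ?N = "distr (restrict_space lborel ?C) borel norm"
  let ?P = "scale_measure (emeasure sphere_measure A) (radial_measure DIM('a))"
  have N: "emeasure ?N B = emeasure lborel {x. x \<noteq> 0 \<and> x /\<^sub>R norm x \<in> A \<and> norm x \<in> B}" if "B \<in> sets borel" for B
  proof -
    have "norm \<in> restrict_space lborel ?C \<rightarrow>\<^sub>M borel"
      by (intro measurable_restrict_space1) simp
    then have "emeasure ?N B = emeasure (restrict_space lborel ?C) (norm -` B \<inter> ?C)"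
      using that by (subst emeasure_distr) (auto simp: space_restrict_space)
    also have "\<dots> = emeasure lborel (norm -` B \<inter> ?C)"
      using C by (intro emeasure_restrict_space) auto
    also have "norm -` B \<inter> ?C = {x. x \<noteq> 0 \<and> x /\<^sub>R norm x \<in> A \<and> norm x \<in> B}"
      by auto
    finally show ?thesis .
  qed
  have eq: "emeasure ?N {..<a} = emeasure ?P {..<a}" for a
  proof (cases "a > 0")
    case True
    have "of_nat DIM('a) * emeasure ?N {..<a} = ennreal (a ^ DIM('a)) * emeasure sphere_measure A"
      using emeasure_scaled_cone[OF A True] by (simp add: N)
    also have "ennreal (a ^ DIM('a)) = of_nat DIM('a) * ennreal (a ^ DIM('a) / DIM('a))"
      using True by (simp add: ennreal_of_nat_eq_real_of_nat flip: ennreal_mult')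
    also have "\<dots> * emeasure sphere_measure A = of_nat DIM('a) * emeasure ?P {..<a}"
      using True by (simp add: emeasure_radial_measure_lessThan mult_ac)
    finally show ?thesis
      by (simp add: ennreal_mult_cancel_left)
  next
    case False
    have "emeasure (radial_measure DIM('a)) {..<a} \<le> emeasure (radial_measure DIM('a)) {..<0}"
      using False by (intro emeasure_mono) auto
    then have P0: "emeasure ?P {..<a} = 0"
      by (simp add: emeasure_radial_measure_lessThan zero_power)
    have empty: "{x. x \<noteq> 0 \<and> x /\<^sub>R norm x \<in> A \<and> norm x \<in> {..<a}} = {}"
      using False norm_ge_zero by (auto simp: not_less intro: order_trans)
    have "emeasure ?N {..<a} = 0"
      using N[of "{..<a}"] unfolding empty by simp
    then show ?thesis
      using P0 by simp
  qed
  have "?N = ?P"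
  proof (rule measure_eqI_generator_eq[where E = "range lessThan" and \<Omega> = UNIV and A = "\<lambda>i::nat. {..<real i}"])
    show "Int_stable (range (lessThan :: real \<Rightarrow> _))"
      by (auto simp: Int_stable_def lessThan_Int_real)
    show "sets ?N = sigma_sets UNIV (range lessThan)"
      by (subst borel_Iio) (simp add: sets_distr)
    then show "sets ?P = sigma_sets UNIV (range lessThan)"
      by simp
    show "(\<Union>i::nat. {..<real i}) = UNIV"
      using reals_Archimedean2 by auto
    show "emeasure ?N {..<real i} \<noteq> \<infinity>" for i
      unfolding eq using emeasure_sphere_finite[of A]
      by (simp add: emeasure_radial_measure_lessThan ennreal_mult_eq_top_iff)
  qed (use eq in auto)
  then show ?thesis
    using N[OF B] by (simp add: mult.commute)
qed

lemma measurable_polar_map: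
  "(\<lambda>x :: 'a::euclidean_space. (norm x, x /\<^sub>R norm x)) \<in>
    restrict_space lborel (- {0}) \<rightarrow>\<^sub>M borel \<Otimes>\<^sub>M restrict_space borel (sphere 0 1)"
proof (intro measurable_Pair measurable_restrict_space2)
  show "(\<lambda>x::'a. x /\<^sub>R norm x) \<in> restrict_space lborel (- {0}) \<rightarrow>\<^sub>M borel"
    by (intro measurable_restrict_space1) simp
qed (auto simp: space_restrict_space intro!: measurable_restrict_space1)

text \<open>
  The product measure is the image of Lebesgue measure under \<open>x \<mapsto> (norm x, x / norm x)\<close>: by
  uniqueness of product measures it is enough to compare rectangles.
\<close>

lemma polar_measure:
  "radial_measure DIM('a) \<Otimes>\<^sub>M sphere_measure =
    distr (restrict_space lborel (- {0})) (borel \<Otimes>\<^sub>M restrict_space borel (sphere 0 1))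
      (\<lambda>x :: 'a::euclidean_space. (norm x, x /\<^sub>R norm x))"
proof (rule pair_measure_eqI)
  show "sigma_finite_measure (radial_measure DIM('a))"
    by (rule sigma_finite_radial_measure) simp
  show "sigma_finite_measure (sphere_measure :: 'a measure)"
    by (rule finite_measure.axioms[OF finite_measure_sphere_measure])
  show "sets (radial_measure DIM('a) \<Otimes>\<^sub>M (sphere_measure :: 'a measure)) =
      sets (distr (restrict_space lborel (- {0})) (borel \<Otimes>\<^sub>M restrict_space borel (sphere 0 1))
        (\<lambda>x :: 'a. (norm x, x /\<^sub>R norm x)))"
    by (simp add: sets_sphere_measure cong: sets_pair_measure_cong)
  fix B :: "real set" and A :: "'a set"
  assume "B \<in> sets (radial_measure DIM('a))" "A \<in> sets (sphere_measure :: 'a measure)"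
  then have B: "B \<in> sets borel" and A: "A \<in> sets borel" "A \<subseteq> sphere 0 1"
    by (auto simp: sets_sphere_measure sets_restrict_space_iff)
  note pm = measurable_polar_map
  have "emeasure (distr (restrict_space lborel (- {0})) (borel \<Otimes>\<^sub>M restrict_space borel (sphere 0 1))
      (\<lambda>x :: 'a. (norm x, x /\<^sub>R norm x))) (B \<times> A) =
      emeasure (restrict_space lborel (- {0}))
        ((\<lambda>x :: 'a. (norm x, x /\<^sub>R norm x)) -` (B \<times> A) \<inter> - {0})"
    using A B by (subst emeasure_distr[OF pm]) (auto simp: space_restrict_space sets_restrict_space_iff intro!: pair_measureI)
  also have "\<dots> = emeasure lborel ((\<lambda>x :: 'a. (norm x, x /\<^sub>R norm x)) -` (B \<times> A) \<inter> - {0})"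
    by (rule emeasure_restrict_space) auto
  also have "(\<lambda>x :: 'a. (norm x, x /\<^sub>R norm x)) -` (B \<times> A) \<inter> - {0} =
      {x. x \<noteq> 0 \<and> x /\<^sub>R norm x \<in> A \<and> norm x \<in> B}"
    by auto
  also have "emeasure lborel \<dots> = emeasure (radial_measure DIM('a)) B * emeasure sphere_measure A"
    using A B by (rule emeasure_polar_rectangle)
  finally show "emeasure (radial_measure DIM('a)) B * emeasure sphere_measure A =
      emeasure (distr (restrict_space lborel (- {0})) (borel \<Otimes>\<^sub>M restrict_space borel (sphere 0 1))
      (\<lambda>x :: 'a. (norm x, x /\<^sub>R norm x))) (B \<times> A)"
    by simp
qed

lemma
  fixes f :: "'a::euclidean_space \<Rightarrow> complex"
  assumes f: "integrable lborel f"
  defines "g \<equiv> \<lambda>r. \<integral>\<omega>. f (r *\<^sub>R \<omega>) \<partial>sphere_measure"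
  shows integrable_polar: "set_integrable lborel {0<..} (\<lambda>r. r ^ (DIM('a) - 1) *\<^sub>R g r)"
    and integral_polar: "(\<integral>x. f x \<partial>lborel) = (LINT r:{0<..}|lborel. r ^ (DIM('a) - 1) *\<^sub>R g r)"
proof -
  let ?Q = "radial_measure DIM('a) \<Otimes>\<^sub>M (sphere_measure :: 'a measure)"
  let ?R = "restrict_space lborel (- {0}) :: 'a measure"
  let ?h = "\<lambda>(r, \<omega> :: 'a). f (r *\<^sub>R \<omega>)"
  interpret R: sigma_finite_measure "radial_measure DIM('a)"
    by (rule sigma_finite_radial_measure) simp
  interpret S: finite_measure "sphere_measure :: 'a measure"
    by (rule finite_measure_sphere_measure)
  interpret pair_sigma_finite "radial_measure DIM('a)" "sphere_measure :: 'a measure" ..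
  have [measurable]: "f \<in> borel_measurable borel"
    using f by simp
  note pm = measurable_polar_map[where 'a = 'a]
  have id: "(\<lambda>\<omega>. \<omega>) \<in> restrict_space borel (sphere 0 1) \<rightarrow>\<^sub>M (borel :: 'a measure)"
    by (intro measurable_restrict_space1) simp
  have hm: "?h \<in> borel_measurable (borel \<Otimes>\<^sub>M restrict_space borel (sphere 0 1))"
    unfolding case_prod_beta
    by (rule measurable_compose[of _ _ borel, OF _ \<open>f \<in> borel_measurable borel\<close>])
       (intro borel_measurable_scaleR measurable_fst measurable_compose[OF measurable_snd id])
  have comp: "?h (norm x, x /\<^sub>R norm x) = f x" if "x \<in> space ?R" for x
    using that by (simp add: space_restrict_space)
  have fR: "integrable ?R f"
    using f by (subst integrable_restrict_space) (auto intro!: integrable_mult_indicator)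
  then have "integrable ?R (\<lambda>x. ?h (norm x, x /\<^sub>R norm x))"
    by (subst Bochner_Integration.integrable_cong[OF refl comp]) auto
  then have hQ: "integrable ?Q ?h"
    unfolding polar_measure by (subst integrable_distr_eq[OF pm hm])
  have g: "integrable (radial_measure DIM('a)) g"
    using integrable_fst[OF hQ] by (simp add: g_def)
  then have [measurable]: "g \<in> borel_measurable borel"
    by (auto dest: borel_measurable_integrable)
  show "set_integrable lborel {0<..} (\<lambda>r. r ^ (DIM('a) - 1) *\<^sub>R g r)"
    using g unfolding radial_measure_def set_integrable_def
    by (subst (asm) integrable_density) (auto simp: indicator_def)
  have "(\<integral>x. f x \<partial>lborel) = (\<integral>x. indicator (- {0}) x *\<^sub>R f x \<partial>lborel)"
    using AE_lborel_singleton[of 0] by (intro integral_cong_AE) (auto elim!: eventually_mono)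
  also have "\<dots> = integral\<^sup>L ?R f"
    by (subst integral_restrict_space) auto
  also have "\<dots> = integral\<^sup>L ?R (\<lambda>x. ?h (norm x, x /\<^sub>R norm x))"
    by (intro Bochner_Integration.integral_cong[OF refl] comp[symmetric])
  also have "\<dots> = integral\<^sup>L ?Q ?h"
    unfolding polar_measure by (rule integral_distr[OF pm hm, symmetric])
  also have "\<dots> = (\<integral>r. g r \<partial>radial_measure DIM('a))"
    using integral_fst[OF hQ] by (simp add: g_def)
  also have "\<dots> = (\<integral>r. (indicator {0<..} r * r ^ (DIM('a) - 1)) *\<^sub>R g r \<partial>lborel)"
    unfolding radial_measure_def by (subst integral_density) (auto simp: indicator_def)
  finally show "(\<integral>x. f x \<partial>lborel) = (LINT r:{0<..}|lborel. r ^ (DIM('a) - 1) *\<^sub>R g r)"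
    by (simp add: set_lebesgue_integral_def)
qed

section \<open>The Fourier transform of a ball in odd dimension\<close>

text \<open>
  Uniqueness of Haar measure in a special case. The image measure is invariant under translations, and
  Fubini's theorem applied to \<open>I y * J (T z + y)\<close>, where \<open>I\<close> is the indicator of the unit ball and \<open>J\<close>
  that of \<open>E\<close>, gives \<open>\<lambda> (ball) * \<mu> E = \<lambda> (ball) * \<lambda> E\<close>: one inner integral is \<open>\<mu> E\<close> by translation
  invariance, the other is the volume of a ball because \<open>T\<close> is an isometry.
\<close>

lemma distr_lborel_orthogonal_transformation:
  fixes T :: "'a::euclidean_space \<Rightarrow> 'a"
  assumes T: "orthogonal_transformation T"
  shows "distr lborel borel T = lborel"
proof (rule measure_eqI)
  have lin: "linear T"
    using T by (rule orthogonal_transformation_linear)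
  have cont: "continuous_on UNIV T"
    using lin by (simp add: linear_continuous_on linear_conv_bounded_linear)
  have Tm [measurable]: "T \<in> borel_measurable borel"
    using cont by (rule borel_measurable_continuous_onI)
  have shift: "(\<integral>\<^sup>+x. f (x + a) \<partial>lborel) = (\<integral>\<^sup>+x. f x \<partial>lborel)"
    if [measurable]: "f \<in> borel_measurable borel" for f :: "'a \<Rightarrow> ennreal" and a
  proof -
    have "(\<integral>\<^sup>+x. f x \<partial>distr lborel borel ((+) a)) = (\<integral>\<^sup>+x. f (a + x) \<partial>lborel)"
      by (rule nn_integral_distr) auto
    then show ?thesis
      by (simp add: lborel_distr_plus add.commute)
  qed
  fix E :: "'a set"
  assume "E \<in> sets (distr lborel borel T)"
  then have [measurable]: "E \<in> sets borel"
    by simp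
  let ?B = "ball (0::'a) 1"
  define I where "I = (indicator ?B :: 'a \<Rightarrow> ennreal)"
  define J where "J = (indicator E :: 'a \<Rightarrow> ennreal)"
  have [measurable]: "I \<in> borel_measurable borel" "J \<in> borel_measurable borel"
    by (auto simp: I_def J_def intro!: borel_measurable_indicator)
  have inner: "(\<integral>\<^sup>+z. I (y - T z) \<partial>lborel) = emeasure lborel ?B" for y
  proof -
    obtain w where w: "y = T w"
      using orthogonal_transformation_surj[OF T] by (metis surjD)
    have "norm (y - T z) = norm (z - w)" for z
      using orthogonal_transformation_norm[OF T, of "w - z"]
      by (simp add: w norm_minus_commute linear_diff[OF lin])
    then have "(\<integral>\<^sup>+z. I (y - T z) \<partial>lborel) = (\<integral>\<^sup>+z. I (z + - w) \<partial>lborel)"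
      by (intro nn_integral_cong) (simp add: I_def indicator_def)
    also have "\<dots> = (\<integral>\<^sup>+z. I z \<partial>lborel)"
      by (rule shift) measurable
    finally show ?thesis
      by (simp add: I_def)
  qed
  have outer: "(\<integral>\<^sup>+z. J (T z + y) \<partial>lborel) = emeasure (distr lborel borel T) E" for y
  proof -
    obtain w where w: "y = T w"
      using orthogonal_transformation_surj[OF T] by (metis surjD)
    have "(\<integral>\<^sup>+z. J (T z + y) \<partial>lborel) = (\<integral>\<^sup>+z. J (T (z + w)) \<partial>lborel)"
      by (simp add: w linear_add[OF lin])
    also have "\<dots> = (\<integral>\<^sup>+z. J (T z) \<partial>lborel)"
      by (rule shift[of "\<lambda>z. J (T z)"]) measurable
    also have "\<dots> = (\<integral>\<^sup>+z. J z \<partial>distr lborel borel T)"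
      by (rule nn_integral_distr[symmetric]) measurable
    finally show ?thesis
      by (simp add: J_def)
  qed
  have "emeasure (distr lborel borel T) E * emeasure lborel ?B =
      (\<integral>\<^sup>+y. emeasure (distr lborel borel T) E * I y \<partial>lborel)"
    unfolding I_def by (subst nn_integral_cmult_indicator) auto
  also have "\<dots> = (\<integral>\<^sup>+y. (\<integral>\<^sup>+z. I y * J (T z + y) \<partial>lborel) \<partial>lborel)"
    by (subst nn_integral_cmult) (auto simp: outer mult.commute)
  also have "\<dots> = (\<integral>\<^sup>+z. (\<integral>\<^sup>+y. I y * J (T z + y) \<partial>lborel) \<partial>lborel)"
    by (rule lborel_pair.Fubini') measurable
  also have "\<dots> = (\<integral>\<^sup>+z. (\<integral>\<^sup>+y. J y * I (y - T z) \<partial>lborel) \<partial>lborel)"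
  proof (rule nn_integral_cong)
    fix z
    show "(\<integral>\<^sup>+y. I y * J (T z + y) \<partial>lborel) = (\<integral>\<^sup>+y. J y * I (y - T z) \<partial>lborel)"
      using shift[of "\<lambda>y. J y * I (y - T z)" "T z"] by (simp add: mult.commute add.commute)
  qed
  also have "\<dots> = (\<integral>\<^sup>+y. (\<integral>\<^sup>+z. J y * I (y - T z) \<partial>lborel) \<partial>lborel)"
    by (rule lborel_pair.Fubini'[symmetric]) measurable
  also have "\<dots> = (\<integral>\<^sup>+y. emeasure lborel ?B * J y \<partial>lborel)"
    by (subst nn_integral_cmult) (auto simp: inner mult.commute)
  also have "\<dots> = emeasure lborel ?B * emeasure lborel E"
    unfolding J_def by (subst nn_integral_cmult_indicator) auto
  finally have eq: "emeasure lborel ?B * emeasure (distr lborel borel T) E = emeasure lborel ?B * emeasure lborel E"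
    by (simp add: mult.commute)
  have "emeasure lborel ?B \<noteq> 0" "emeasure lborel ?B < \<infinity>"
    using unit_ball_vol_pos[of "real DIM('a)"] by (simp_all add: emeasure_ball ennreal_eq_0_iff not_le del: unit_ball_vol_pos)
  then show "emeasure (distr lborel borel T) E = emeasure lborel E"
    using eq by (auto simp: ennreal_mult_cancel_left)
qed simp

text \<open>
  Slicing the ball by the hyperplanes orthogonal to \<open>e\<close>: the slice at height \<open>t\<close> is a ball of radius
  \<open>sqrt (R\<^sup>2 - t\<^sup>2)\<close> in one dimension less.
\<close>

lemma distr_cball_inner_Basis:
  fixes e :: "'a::euclidean_space"
  assumes e: "e \<in> Basis" and R: "R > 0"
  shows "distr (restrict_space lborel (cball 0 R)) borel (\<lambda>\<xi>. \<xi> \<bullet> e) =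
    density lborel (\<lambda>t. ennreal (indicator {-R..R} t * (unit_ball_vol (DIM('a) - 1) * sqrt (R\<^sup>2 - t\<^sup>2) ^ (DIM('a) - 1))))"
proof (rule measure_eqI)
  fix B assume "B \<in> sets (distr (restrict_space lborel (cball 0 R)) borel (\<lambda>\<xi>::'a. \<xi> \<bullet> e))"
  then have [measurable]: "B \<in> sets borel"
    by simp
  define A where "A = Basis - {e}"
  have A: "finite A" "e \<notin> A" "Basis = insert e A" "card A = DIM('a) - 1"
    using e by (auto simp: A_def)
  interpret product_sigma_finite "\<lambda>_::'a. lborel :: real measure"
    by standard
  let ?P = "\<lambda>A::'a set. \<Pi>\<^sub>M b\<in>A. (lborel :: real measure)"
  let ?S = "{\<xi>::'a. norm \<xi> \<le> R \<and> \<xi> \<bullet> e \<in> B}"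
  let ?S' = "{f. sqrt (\<Sum>i\<in>Basis. (f i)\<^sup>2) \<le> R \<and> f e \<in> B} \<inter> space (?P Basis)"
  have fe: "(\<lambda>f. f e) \<in> borel_measurable (?P Basis)"
    using measurable_component_singleton[OF e, of "\<lambda>_. lborel"] by simp
  have "{f \<in> space (?P Basis). sqrt (\<Sum>i\<in>Basis. (f i)\<^sup>2) \<le> R} \<inter> ((\<lambda>f. f e) -` B \<inter> space (?P Basis)) \<in> sets (?P Basis)"
  proof (rule sets.Int)
    show "{f \<in> space (?P Basis). sqrt (\<Sum>i\<in>Basis. (f i)\<^sup>2) \<le> R} \<in> sets (?P Basis)"
      by measurable
    show "(\<lambda>f. f e) -` B \<inter> space (?P Basis) \<in> sets (?P Basis)"
      by (rule measurable_sets[OF fe]) simp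
  qed
  also have "{f \<in> space (?P Basis). sqrt (\<Sum>i\<in>Basis. (f i)\<^sup>2) \<le> R} \<inter> ((\<lambda>f. f e) -` B \<inter> space (?P Basis)) = ?S'"
    by auto
  finally have S'_sets: "?S' \<in> sets (?P Basis)" .
  have "emeasure (distr (restrict_space lborel (cball 0 R)) borel (\<lambda>\<xi>::'a. \<xi> \<bullet> e)) B =
      emeasure (restrict_space lborel (cball 0 R)) ((\<lambda>\<xi>::'a. \<xi> \<bullet> e) -` B \<inter> cball 0 R)"
  proof -
    have "(\<lambda>\<xi>::'a. \<xi> \<bullet> e) \<in> restrict_space lborel (cball 0 R) \<rightarrow>\<^sub>M borel"
      by (intro measurable_restrict_space1) simp
    then show ?thesis
      by (subst emeasure_distr) (auto simp: space_restrict_space)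
  qed
  also have "\<dots> = emeasure lborel ((\<lambda>\<xi>::'a. \<xi> \<bullet> e) -` B \<inter> cball 0 R)"
    by (rule emeasure_restrict_space) auto
  also have "(\<lambda>\<xi>::'a. \<xi> \<bullet> e) -` B \<inter> cball 0 R = ?S"
    by auto
  also have "emeasure lborel ?S = emeasure (distr (?P Basis) borel (\<lambda>f. \<Sum>b\<in>Basis. f b *\<^sub>R b)) ?S"
    by (subst lborel_eq) simp
  also have "\<dots> = emeasure (?P Basis) ((\<lambda>f. \<Sum>b\<in>Basis. f b *\<^sub>R b) -` ?S \<inter> space (?P Basis))"
    by (subst emeasure_distr) auto
  also have "(\<lambda>f. \<Sum>b\<in>Basis. f b *\<^sub>R b) -` ?S \<inter> space (?P Basis) = ?S'"
  proof -
    have "norm (\<Sum>b\<in>Basis. f b *\<^sub>R b :: 'a) = sqrt (\<Sum>i\<in>Basis. (f i)\<^sup>2)" for f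
      using euclidean_dist_l2[of "0::'a" "\<Sum>b\<in>Basis. f b *\<^sub>R b"] by (simp add: L2_set_def)
    then show ?thesis
      using e by auto
  qed
  also have "emeasure (?P Basis) ?S' = (\<integral>\<^sup>+f. indicator ?S' f \<partial>?P Basis)"
    using S'_sets by simp
  also have "\<dots> = (\<integral>\<^sup>+t. \<integral>\<^sup>+f. indicator ?S' (f(e := t)) \<partial>?P A \<partial>lborel)"
    unfolding A(3) using A(1,2) S'_sets[unfolded A(3)] by (intro product_nn_integral_insert_rev) auto
  also have "\<dots> = (\<integral>\<^sup>+t. \<integral>\<^sup>+f. indicator B t * indicator {-R..R} t *
      indicator ({f. sqrt (\<Sum>i\<in>A. (f i)\<^sup>2) \<le> sqrt (R\<^sup>2 - t\<^sup>2)} \<inter> space (?P A)) f \<partial>?P A \<partial>lborel)"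
  proof (intro nn_integral_cong, goal_cases)
    case (1 t f)
    have *: "t \<in> {-R..R}" if "t\<^sup>2 + c \<le> R\<^sup>2" "c \<ge> 0" for c
    proof -
      have "t\<^sup>2 \<le> R\<^sup>2"
        using that by simp
      then show ?thesis
        using R by (simp add: power2_le_iff_abs_le abs_if split: if_splits)
    qed
    have sum: "(\<Sum>i\<in>Basis. ((f(e := t)) i)\<^sup>2) = t\<^sup>2 + (\<Sum>i\<in>A. (f i)\<^sup>2)"
      unfolding A(3) using A(1,2) by (auto intro!: sum.cong)
    have "sqrt (t\<^sup>2 + (\<Sum>i\<in>A. (f i)\<^sup>2)) \<le> R \<longleftrightarrow> t\<^sup>2 + (\<Sum>i\<in>A. (f i)\<^sup>2) \<le> R\<^sup>2"
      using R by (intro real_sqrt_le_iff') (auto intro!: add_nonneg_nonneg sum_nonneg)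
    also have "\<dots> \<longleftrightarrow> t \<in> {-R..R} \<and> sqrt (\<Sum>i\<in>A. (f i)\<^sup>2) \<le> sqrt (R\<^sup>2 - t\<^sup>2)"
      using *[of "\<Sum>i\<in>A. (f i)\<^sup>2", OF _ sum_nonneg] by auto
    finally have iff: "sqrt (t\<^sup>2 + (\<Sum>i\<in>A. (f i)\<^sup>2)) \<le> R \<longleftrightarrow>
        t \<in> {-R..R} \<and> sqrt (\<Sum>i\<in>A. (f i)\<^sup>2) \<le> sqrt (R\<^sup>2 - t\<^sup>2)" .
    have "f(e := t) \<in> space (?P Basis)"
      using 1 unfolding A(3) by (auto simp: space_PiM PiE_def extensional_def)
    then have "f(e := t) \<in> ?S' \<longleftrightarrow>
        t \<in> B \<and> t \<in> {-R..R} \<and> f \<in> {f. sqrt (\<Sum>i\<in>A. (f i)\<^sup>2) \<le> sqrt (R\<^sup>2 - t\<^sup>2)} \<inter> space (?P A)"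
      using 1 unfolding Int_iff mem_Collect_eq sum iff by auto
    then show ?case
      by (simp only: indicator_def) simp
  qed
  also have "\<dots> = (\<integral>\<^sup>+t. indicator B t * indicator {-R..R} t *
      emeasure (?P A) ({f. sqrt (\<Sum>i\<in>A. (f i)\<^sup>2) \<le> sqrt (R\<^sup>2 - t\<^sup>2)} \<inter> space (?P A)) \<partial>lborel)"
    using A(1) by (intro nn_integral_cong, subst nn_integral_cmult) auto
  also have "\<dots> = (\<integral>\<^sup>+t. ennreal (indicator {-R..R} t * (unit_ball_vol (DIM('a) - 1) * sqrt (R\<^sup>2 - t\<^sup>2) ^ (DIM('a) - 1))) *
      indicator B t \<partial>lborel)"
  proof (rule nn_integral_cong_AE)
    (* at the endpoints the slice degenerates to a point, which the volume formula used here
       excludes *)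
    have "AE t in lborel. t \<noteq> R \<and> t \<noteq> -R"
      using AE_lborel_singleton[of R] AE_lborel_singleton[of "-R"] by eventually_elim simp
    then show "AE t in lborel. indicator B t * indicator {-R..R} t *
        emeasure (?P A) ({f. sqrt (\<Sum>i\<in>A. (f i)\<^sup>2) \<le> sqrt (R\<^sup>2 - t\<^sup>2)} \<inter> space (?P A)) =
      ennreal (indicator {-R..R} t * (unit_ball_vol (DIM('a) - 1) * sqrt (R\<^sup>2 - t\<^sup>2) ^ (DIM('a) - 1))) * indicator B t"
    proof eventually_elim
      case (elim t)
      show ?case
      proof (cases "t \<in> {-R<..<R}")
        case True
        then have "\<bar>t\<bar> < \<bar>R\<bar>"
          by auto
        then have "t\<^sup>2 < R\<^sup>2"
          by (simp add: power2_strict_mono)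
        then show ?thesis
          using A True emeasure_cball_aux[OF A(1), of "sqrt (R\<^sup>2 - t\<^sup>2)"] by (simp add: indicator_def)
      next
        case False
        then have "t \<notin> {-R..R}"
          using elim by auto
        then have "indicator {-R..R} t = (0::real)" "indicator {-R..R} t = (0::ennreal)"
          by (auto simp: indicator_def)
        then show ?thesis
          by (simp only:) simp
      qed
    qed
  qed
  also have "\<dots> = emeasure (density lborel (\<lambda>t. ennreal (indicator {-R..R} t *
      (unit_ball_vol (DIM('a) - 1) * sqrt (R\<^sup>2 - t\<^sup>2) ^ (DIM('a) - 1))))) B"
    by (rule emeasure_density[symmetric]) auto
  finally show "emeasure (distr (restrict_space lborel (cball 0 R)) borel (\<lambda>\<xi>::'a. \<xi> \<bullet> e)) B = \<dots>" .
qed simp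

text \<open>
  The one-dimensional Fourier transform of the truncated power \<open>(R\<^sup>2 - t\<^sup>2) ^ m\<close>; up to a constant and a
  power of \<open>r\<close> it is the Bessel function of order \<open>m + 1/2\<close> at \<open>R r\<close>.
\<close>

definition odd_ball_kernel :: "real \<Rightarrow> nat \<Rightarrow> real \<Rightarrow> complex" where
  "odd_ball_kernel R m r = integral {-R..R} (\<lambda>t. (R\<^sup>2 - t\<^sup>2) ^ m *\<^sub>R cis (r * t))"

text \<open>
  A rotation takes \<open>y\<close> to a multiple of a basis vector \<open>e\<close>, after which the integrand depends only on
  \<open>\<xi> \<bullet> e\<close>. As the dimension is odd, the density \<open>sqrt (R\<^sup>2 - t\<^sup>2) ^ (2 * k)\<close> of that coordinate is a
  polynomial on the interval.
\<close>

lemma fourier_cball: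
  fixes y :: "real ^ 'n"
  assumes n: "CARD('n) = 2 * k + 1" and R: "R > 0"
  shows "(\<integral>\<xi>. indicator (cball 0 R) \<xi> *\<^sub>R cis (y \<bullet> \<xi>) \<partial>lborel) = unit_ball_vol (real (2 * k)) *\<^sub>R odd_ball_kernel R k (norm y)"
proof -
  obtain e :: "real ^ 'n" where e: "e \<in> Basis"
    using nonempty_Basis by blast
  have "norm (norm y *\<^sub>R e) = norm y"
    using e by simp
  then obtain T where T: "orthogonal_transformation T" "T (norm y *\<^sub>R e) = y"
    using orthogonal_transformation_exists[of "norm y *\<^sub>R e" y] by blast
  have [measurable]: "T \<in> borel_measurable borel"
    using T(1) by (intro borel_measurable_continuous_onI linear_continuous_on)
      (simp add: orthogonal_transformation_linear flip: linear_conv_bounded_linear)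
  have cis_m: "(cis :: real \<Rightarrow> complex) \<in> borel_measurable borel"
    by (intro borel_measurable_continuous_onI continuous_intros)
  have *: "y \<bullet> T \<xi> = norm y * (\<xi> \<bullet> e)" for \<xi>
  proof -
    have "y \<bullet> T \<xi> = T (norm y *\<^sub>R e) \<bullet> T \<xi>"
      by (simp add: T(2))
    also have "\<dots> = (norm y *\<^sub>R e) \<bullet> \<xi>"
      using T(1) by (simp only: orthogonal_transformation_def)
    finally show ?thesis
      by (simp add: inner_commute)
  qed
  have "(\<integral>\<xi>. indicator (cball 0 R) \<xi> *\<^sub>R cis (y \<bullet> \<xi>) \<partial>lborel) =
      (\<integral>\<xi>. indicator (cball 0 R) \<xi> *\<^sub>R cis (y \<bullet> \<xi>) \<partial>distr lborel borel T)"
    by (simp add: distr_lborel_orthogonal_transformation[OF T(1)])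
  also have "\<dots> = (\<integral>\<xi>. indicator (cball 0 R) (T \<xi>) *\<^sub>R cis (y \<bullet> T \<xi>) \<partial>lborel)"
    by (rule integral_distr) (auto intro!: borel_measurable_scaleR borel_measurable_indicator measurable_compose[OF _ cis_m])
  also have "\<dots> = (\<integral>\<xi>. indicator (cball 0 R) \<xi> *\<^sub>R cis (norm y * (\<xi> \<bullet> e)) \<partial>lborel)"
    unfolding * by (simp add: indicator_def orthogonal_transformation_norm[OF T(1)])
  also have "\<dots> = (\<integral>\<xi>. cis (norm y * (\<xi> \<bullet> e)) \<partial>restrict_space lborel (cball 0 R))"
    by (subst integral_restrict_space) auto
  also have "\<dots> = (\<integral>t. cis (norm y * t) \<partial>distr (restrict_space lborel (cball 0 R)) borel (\<lambda>\<xi>. \<xi> \<bullet> e))"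
    by (rule integral_distr[symmetric]) (auto intro!: measurable_restrict_space1 measurable_compose[OF _ cis_m])
  also have "\<dots> = (\<integral>t. (indicator {-R..R} t * (unit_ball_vol (2 * k) * sqrt (R\<^sup>2 - t\<^sup>2) ^ (2 * k))) *\<^sub>R cis (norm y * t) \<partial>lborel)"
    unfolding distr_cball_inner_Basis[OF e R] by (subst integral_density) (auto simp: n indicator_def power2_le_iff_abs_le intro!: measurable_compose[OF _ cis_m])
  also have "\<dots> = (\<integral>t. unit_ball_vol (2 * k) *\<^sub>R (indicator {-R..R} t *\<^sub>R ((R\<^sup>2 - t\<^sup>2) ^ k *\<^sub>R cis (norm y * t))) \<partial>lborel)"
  proof (rule Bochner_Integration.integral_cong[OF refl])
    fix t :: real
    have "sqrt (R\<^sup>2 - t\<^sup>2) ^ (2 * k) = (R\<^sup>2 - t\<^sup>2) ^ k" if "t \<in> {-R..R}"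
    proof -
      have "t\<^sup>2 \<le> R\<^sup>2"
        using that R by (simp add: power2_le_iff_abs_le abs_le_iff)
      then show ?thesis
        by (simp add: power_mult)
    qed
    then show "(indicator {-R..R} t * (unit_ball_vol (2 * k) * sqrt (R\<^sup>2 - t\<^sup>2) ^ (2 * k))) *\<^sub>R cis (norm y * t) =
        unit_ball_vol (2 * k) *\<^sub>R (indicator {-R..R} t *\<^sub>R ((R\<^sup>2 - t\<^sup>2) ^ k *\<^sub>R cis (norm y * t)))"
      by (simp add: indicator_def)
  qed
  also have "\<dots> = unit_ball_vol (2 * k) *\<^sub>R (LINT t:{-R..R}|lborel. (R\<^sup>2 - t\<^sup>2) ^ k *\<^sub>R cis (norm y * t))"
    unfolding set_lebesgue_integral_def by (rule integral_scaleR_right)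
  also have "(LINT t:{-R..R}|lborel. (R\<^sup>2 - t\<^sup>2) ^ k *\<^sub>R cis (norm y * t)) = odd_ball_kernel R k (norm y)"
    unfolding odd_ball_kernel_def
    by (intro set_borel_integral_eq_integral borel_integrable_atLeastAtMost' continuous_intros)
  finally show ?thesis .
qed

lemma has_vector_derivative_cis: "((\<lambda>t. cis (r * t)) has_vector_derivative (\<i> * r) * cis (r * t)) (at t within S)"
proof -
  have "((\<lambda>z. exp (\<i> * (of_real r * z))) has_field_derivative (\<i> * r) * exp (\<i> * (of_real r * of_real t))) (at (of_real t))"
    by (auto intro!: derivative_eq_intros)
  from has_vector_derivative_real_field[OF this] show ?thesis
    by (simp add: cis_conv_exp)
qed

lemma DERIV_ball_weight:
  "((\<lambda>t::real. (R\<^sup>2 - t\<^sup>2) ^ Suc m) has_real_derivative (-2 * (real m + 1)) * t * (R\<^sup>2 - t\<^sup>2) ^ m) (at t)"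
proof -
  have "((\<lambda>t. R\<^sup>2 - t\<^sup>2) has_real_derivative - (2 * t)) (at t)"
    by (auto intro!: derivative_eq_intros)
  from DERIV_power_Suc[OF this, of m] show ?thesis
    by (rule DERIV_cong) (simp add: algebra_simps)
qed

lemma integral_by_parts_cis:
  fixes w w' :: "real \<Rightarrow> real"
  assumes R: "R \<ge> 0" and r: "r \<noteq> 0"
    and w: "\<And>t. (w has_real_derivative w' t) (at t)" and w': "continuous_on UNIV w'"
  shows "integral {-R..R} (\<lambda>t. w t *\<^sub>R cis (r * t)) =
    (w R *\<^sub>R cis (r * R) - w (-R) *\<^sub>R cis (- (r * R)) - integral {-R..R} (\<lambda>t. w' t *\<^sub>R cis (r * t))) / (\<i> * r)"
proof -
  have wc: "continuous_on {-R..R} w"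
    using w by (meson DERIV_continuous continuous_at_imp_continuous_on)
  have i1: "(\<lambda>t. w t *\<^sub>R ((\<i> * r) * cis (r * t))) integrable_on {-R..R}"
    and i2: "(\<lambda>t. w' t *\<^sub>R cis (r * t)) integrable_on {-R..R}"
    using wc continuous_on_subset[OF w'] by (auto intro!: integrable_continuous_interval continuous_intros)
  have "((\<lambda>t. w t *\<^sub>R ((\<i> * r) * cis (r * t)) + w' t *\<^sub>R cis (r * t)) has_integral
      (w R *\<^sub>R cis (r * R) - w (-R) *\<^sub>R cis (r * (-R)))) {-R..R}"
    using R by (intro fundamental_theorem_of_calculus has_vector_derivative_scaleR has_vector_derivative_cis
        DERIV_subset[OF w]) auto
  then have "integral {-R..R} (\<lambda>t. w t *\<^sub>R ((\<i> * r) * cis (r * t))) + integral {-R..R} (\<lambda>t. w' t *\<^sub>R cis (r * t)) =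
      w R *\<^sub>R cis (r * R) - w (-R) *\<^sub>R cis (- (r * R))"
    using i1 i2 by (simp add: integral_unique flip: Henstock_Kurzweil_Integration.integral_add)
  moreover have "integral {-R..R} (\<lambda>t. w t *\<^sub>R ((\<i> * r) * cis (r * t))) = (\<i> * r) * integral {-R..R} (\<lambda>t. w t *\<^sub>R cis (r * t))"
    by (subst integral_mult_right[symmetric]) (simp add: mult_ac)
  ultimately show ?thesis
    using r by (simp add: field_simps)
qed

lemma odd_ball_kernel_0:
  assumes "R \<ge> 0" "r \<noteq> 0"
  shows "odd_ball_kernel R 0 r = of_real (2 * sin (R * r) / r)"
  using integral_by_parts_cis[OF assms, of "\<lambda>_. 1" "\<lambda>_. 0"] assms
  by (simp add: odd_ball_kernel_def complex_eq_iff field_simps Re_divide Im_divide power2_eq_square)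

text \<open>
  Differentiation under the integral sign produces the factor \<open>\<i> t\<close>. Since \<open>t (R\<^sup>2 - t\<^sup>2) ^ m\<close> is a
  multiple of the derivative of \<open>(R\<^sup>2 - t\<^sup>2) ^ Suc m\<close>, integrating by parts in \<open>t\<close> gives back a kernel,
  of the next order.
\<close>

lemma has_vector_derivative_odd_ball_kernel:
  assumes R: "R \<ge> 0"
  shows "(odd_ball_kernel R m has_vector_derivative (- r / (2 * (real m + 1))) *\<^sub>R odd_ball_kernel R (Suc m) r) (at r)"
proof -
  have deriv: "((\<lambda>r. integral (cbox (-R) R) (\<lambda>t. (R\<^sup>2 - t\<^sup>2) ^ m *\<^sub>R cis (r * t))) has_vector_derivative
      integral (cbox (-R) R) (\<lambda>t. (R\<^sup>2 - t\<^sup>2) ^ m *\<^sub>R ((\<i> * t) * cis (r * t)))) (at r within UNIV)"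
  proof (rule leibniz_rule_vector_derivative)
    show "((\<lambda>r. (R\<^sup>2 - t\<^sup>2) ^ m *\<^sub>R cis (r * t)) has_vector_derivative
        (R\<^sup>2 - t\<^sup>2) ^ m *\<^sub>R ((\<i> * t) * cis (r * t))) (at r within UNIV)" for r t
      using has_vector_derivative_cis[of t r UNIV]
      by (intro bounded_linear.has_vector_derivative[OF bounded_linear_scaleR_right]) (simp add: mult.commute)
    show "(\<lambda>t. (R\<^sup>2 - t\<^sup>2) ^ m *\<^sub>R cis (r * t)) integrable_on cbox (-R) R" for r
      by (intro integrable_continuous continuous_intros)
    show "continuous_on (UNIV \<times> cbox (-R) R) (\<lambda>(r, t). (R\<^sup>2 - t\<^sup>2) ^ m *\<^sub>R ((\<i> * t) * cis (r * t)))"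
      unfolding case_prod_beta by (intro continuous_intros)
  qed auto
  have "integral {-R..R} (\<lambda>t. (R\<^sup>2 - t\<^sup>2) ^ m *\<^sub>R ((\<i> * t) * cis (r * t))) =
      (- r / (2 * (real m + 1))) *\<^sub>R odd_ball_kernel R (Suc m) r"
  proof (cases "r = 0")
    case True
    let ?f = "\<lambda>t. t * (R\<^sup>2 - t\<^sup>2) ^ m"
    have "((\<lambda>t. (-2 * (real m + 1)) * t * (R\<^sup>2 - t\<^sup>2) ^ m) has_integral ((R\<^sup>2 - R\<^sup>2) ^ Suc m - (R\<^sup>2 - (-R)\<^sup>2) ^ Suc m)) {-R..R}"
      by (rule fundamental_theorem_of_calculus[OF _
          has_real_derivative_iff_has_vector_derivative[THEN iffD1, OF DERIV_subset[OF DERIV_ball_weight]]])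
         (use R in auto)
    then have "integral {-R..R} (\<lambda>t. (-2 * (real m + 1)) * ?f t) = (R\<^sup>2 - R\<^sup>2) ^ Suc m - (R\<^sup>2 - (-R)\<^sup>2) ^ Suc m"
      by (simp only: integral_unique mult.assoc)
    also have "\<dots> = 0"
      by simp
    finally have "(-2 * (real m + 1)) * integral {-R..R} ?f = 0"
      by (simp only: integral_mult_right)
    then have "integral {-R..R} ?f = 0"
      using of_nat_0_le_iff[of m, where 'a = real] by (simp only: mult_eq_0_iff) linarith
    moreover have "integral {-R..R} (\<lambda>t. (R\<^sup>2 - t\<^sup>2) ^ m *\<^sub>R ((\<i> * t) * cis (r * t))) = \<i> * of_real (integral {-R..R} ?f)"
    proof -
      have "?f integrable_on {-R..R}"
        by (intro integrable_continuous_interval continuous_intros)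
      then have *: "((\<lambda>t. \<i> * of_real (?f t)) has_integral \<i> * of_real (integral {-R..R} ?f)) {-R..R}"
        by (intro has_integral_mult_right has_integral_of_real integrable_integral)
      have "integral {-R..R} (\<lambda>t. (R\<^sup>2 - t\<^sup>2) ^ m *\<^sub>R ((\<i> * t) * cis (r * t))) = integral {-R..R} (\<lambda>t. \<i> * of_real (?f t))"
        using True by (intro integral_cong) (simp add: scaleR_conv_of_real mult_ac)
      also have "\<dots> = \<i> * of_real (integral {-R..R} ?f)"
        using * by (rule integral_unique)
      finally show ?thesis .
    qed
    ultimately show ?thesis
      using True by simp
  next
    case False
    define c where "c = 2 * (real m + 1)"
    have c: "c > 0" "-2 * (real m + 1) = - c"
      by (simp_all add: c_def)
    let ?J = "integral {-R..R} (\<lambda>t. (R\<^sup>2 - t\<^sup>2) ^ m *\<^sub>R ((\<i> * t) * cis (r * t)))"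
    have "integral {-R..R} (\<lambda>t. (R\<^sup>2 - t\<^sup>2) ^ Suc m *\<^sub>R cis (r * t)) =
        ((R\<^sup>2 - R\<^sup>2) ^ Suc m *\<^sub>R cis (r * R) - (R\<^sup>2 - (-R)\<^sup>2) ^ Suc m *\<^sub>R cis (- (r * R)) -
          integral {-R..R} (\<lambda>t. ((-2 * (real m + 1)) * t * (R\<^sup>2 - t\<^sup>2) ^ m) *\<^sub>R cis (r * t))) / (\<i> * r)"
      using R False
      by (intro integral_by_parts_cis DERIV_ball_weight continuous_intros) auto
    also have "integral {-R..R} (\<lambda>t. ((-2 * (real m + 1)) * t * (R\<^sup>2 - t\<^sup>2) ^ m) *\<^sub>R cis (r * t)) =
        integral {-R..R} (\<lambda>t. (of_real c * \<i>) * ((R\<^sup>2 - t\<^sup>2) ^ m *\<^sub>R ((\<i> * t) * cis (r * t))))"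
      unfolding c(2) by (intro integral_cong) (simp add: scaleR_conv_of_real mult_ac)
    also have "\<dots> = (of_real c * \<i>) * ?J"
      by (rule integral_mult_right)
    finally have "odd_ball_kernel R (Suc m) r = - (of_real c * \<i> * ?J) / (\<i> * of_real r)"
      by (simp add: odd_ball_kernel_def)
    then have "(- r / c) *\<^sub>R odd_ball_kernel R (Suc m) r = ?J"
      using False c(1) by (simp add: scaleR_conv_of_real)
    then show ?thesis
      by (simp only: c_def)
  qed
  then show ?thesis
    using deriv unfolding odd_ball_kernel_def[abs_def] by simp
qed

lemma continuous_on_odd_ball_kernel:
  assumes "R \<ge> 0"
  shows "continuous_on S (odd_ball_kernel R m)"
  using has_vector_derivative_odd_ball_kernel[OF assms]
  by (meson has_vector_derivative_continuous continuous_at_imp_continuous_on)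

text \<open>
  Every integration by parts in \<open>t\<close> gains a factor \<open>1 / r\<close> and loses one of the \<open>m\<close> zeros at the
  endpoints; the last one gains a final factor together with boundary values. The polynomial factor
  \<open>q\<close> makes the class of integrands closed under this step.
\<close>

lemma odd_ball_kernel_decay_poly:
  fixes q :: "real poly"
  assumes R: "R > 0"
  shows "\<exists>C. \<forall>r>0. norm (integral {-R..R} (\<lambda>t. ((R\<^sup>2 - t\<^sup>2) ^ m * poly q t) *\<^sub>R cis (r * t))) \<le> C / r ^ Suc m"
proof (induction m arbitrary: q)
  case 0
  define C where "C = \<bar>poly q R\<bar> + \<bar>poly q (-R)\<bar> + integral {-R..R} (\<lambda>t. \<bar>poly (pderiv q) t\<bar>)"
  have "norm (integral {-R..R} (\<lambda>t. poly q t *\<^sub>R cis (r * t))) \<le> C / r" if r: "r > 0" for r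
  proof -
    have "integral {-R..R} (\<lambda>t. poly q t *\<^sub>R cis (r * t)) =
      (poly q R *\<^sub>R cis (r * R) - poly q (-R) *\<^sub>R cis (- (r * R)) -
        integral {-R..R} (\<lambda>t. poly (pderiv q) t *\<^sub>R cis (r * t))) / (\<i> * r)"
      using R r by (intro integral_by_parts_cis poly_DERIV continuous_intros) auto
    moreover have "norm (integral {-R..R} (\<lambda>t. poly (pderiv q) t *\<^sub>R cis (r * t))) \<le> integral {-R..R} (\<lambda>t. \<bar>poly (pderiv q) t\<bar>)"
      by (intro integral_norm_bound_integral integrable_continuous_interval continuous_intros) simp
    then have "norm (poly q R *\<^sub>R cis (r * R) - poly q (-R) *\<^sub>R cis (- (r * R)) -
        integral {-R..R} (\<lambda>t. poly (pderiv q) t *\<^sub>R cis (r * t))) \<le> C"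
      unfolding C_def by (intro order_trans[OF norm_triangle_ineq4] add_mono) auto
    ultimately show ?thesis
      using r by (simp add: norm_divide norm_mult divide_right_mono)
  qed
  then show ?case
    by auto
next
  case (Suc m)
  (* p is chosen so that (R^2 - t^2)^m * p is the derivative of (R^2 - t^2)^(m+1) * q *)
  define p where "p = smult (- 2 * (real m + 1)) ([:0, 1:] * q) + [:R\<^sup>2, 0, -1:] * pderiv q"
  obtain C where C: "\<And>r. r > 0 \<Longrightarrow>
      norm (integral {-R..R} (\<lambda>t. ((R\<^sup>2 - t\<^sup>2) ^ m * poly p t) *\<^sub>R cis (r * t))) \<le> C / r ^ Suc m"
    using Suc.IH[of p] by blast
  have "norm (integral {-R..R} (\<lambda>t. ((R\<^sup>2 - t\<^sup>2) ^ Suc m * poly q t) *\<^sub>R cis (r * t))) \<le> C / r ^ Suc (Suc m)"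
    if r: "r > 0" for r
  proof -
    have "integral {-R..R} (\<lambda>t. ((R\<^sup>2 - t\<^sup>2) ^ Suc m * poly q t) *\<^sub>R cis (r * t)) =
      (((R\<^sup>2 - R\<^sup>2) ^ Suc m * poly q R) *\<^sub>R cis (r * R) - ((R\<^sup>2 - (-R)\<^sup>2) ^ Suc m * poly q (-R)) *\<^sub>R cis (- (r * R)) -
        integral {-R..R} (\<lambda>t. ((R\<^sup>2 - t\<^sup>2) ^ m * poly p t) *\<^sub>R cis (r * t))) / (\<i> * r)"
    proof (intro integral_by_parts_cis continuous_intros)
      show "((\<lambda>t. (R\<^sup>2 - t\<^sup>2) ^ Suc m * poly q t) has_real_derivative (R\<^sup>2 - t\<^sup>2) ^ m * poly p t) (at t)" for t
        by (rule DERIV_cong[OF DERIV_mult[OF DERIV_ball_weight poly_DERIV]])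
           (simp add: p_def algebra_simps power2_eq_square)
    qed (use R r in auto)
    also have "norm \<dots> = norm (integral {-R..R} (\<lambda>t. ((R\<^sup>2 - t\<^sup>2) ^ m * poly p t) *\<^sub>R cis (r * t))) / r"
      using r by (simp add: norm_divide norm_mult)
    also have "\<dots> \<le> (C / r ^ Suc m) / r"
      using C[OF r] r by (intro divide_right_mono) auto
    finally show ?thesis
      by (simp add: mult.commute)
  qed
  then show ?case
    by blast
qed

lemma odd_ball_kernel_decay:
  assumes "R > 0"
  obtains C where "\<And>r. r > 0 \<Longrightarrow> norm (odd_ball_kernel R m r) \<le> C / r ^ Suc m"
  using odd_ball_kernel_decay_poly[OF assms, of m 1] unfolding odd_ball_kernel_def by auto

lemma odd_ball_kernel_bounded:
  assumes "R \<ge> 0"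
  shows "norm (odd_ball_kernel R m r) \<le> integral {-R..R} (\<lambda>t. \<bar>R\<^sup>2 - t\<^sup>2\<bar> ^ m)"
  unfolding odd_ball_kernel_def
  by (intro integral_norm_bound_integral integrable_continuous_interval continuous_intros) (simp add: power_abs)

section \<open>Differentiating spherical means\<close>

lemma measurable_ident_sphere_measure: "(\<lambda>\<omega>. \<omega>) \<in> borel_measurable (sphere_measure :: 'a::euclidean_space measure)"
proof -
  have "(\<lambda>\<omega>. \<omega>) \<in> restrict_space borel (sphere 0 1) \<rightarrow>\<^sub>M (borel :: 'a measure)"
    by (intro measurable_restrict_space1) simp
  then show ?thesis
    by (simp cong: measurable_cong_sets add: sets_sphere_measure)
qed

lemma borel_measurable_sphere_measure:
  assumes "continuous_on UNIV g"
  shows "(\<lambda>\<omega>. g \<omega> :: 'b::topological_space) \<in> borel_measurable sphere_measure"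
  by (rule measurable_compose[OF measurable_ident_sphere_measure borel_measurable_continuous_onI[OF assms]])

lemma L1_fun_sphere_measure:
  fixes g :: "'a::euclidean_space \<Rightarrow> 'b::banach"
  assumes "continuous_on UNIV g"
  shows "g \<in> L1_fun sphere_measure"
  by (intro L1_fun_finite_measure_compact[where C = "sphere 0 1"] finite_measure_sphere_measure
      measurable_ident_sphere_measure assms) (auto simp: space_sphere_measure)

abbreviation (input) sphere_integral :: "('a::euclidean_space \<Rightarrow> 'b::banach) \<Rightarrow> 'b" where
  "sphere_integral \<equiv> banach_integral sphere_measure"

abbreviation (input) sphere_average :: "('a::euclidean_space \<Rightarrow> 'b::banach) \<Rightarrow> 'b" where
  "sphere_average G \<equiv> (1 / measure sphere_measure (sphere 0 1 :: 'a set)) *\<^sub>R sphere_integral G"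

text \<open>
  The norm estimate is transferred to a complex integral by a norming functional; the factor two is
  the bound of that functional. Only this combination is used below: it covers both continuity
  (\<open>a = 0\<close>) and differentiability of spherical means.
\<close>

lemma norm_sphere_integral_combination_le:
  fixes f g h :: "'a::euclidean_space \<Rightarrow> 'b::complex_banach"
  assumes c: "continuous_on UNIV f" "continuous_on UNIV g" "continuous_on UNIV h"
    and le: "\<And>\<omega>. norm \<omega> = 1 \<Longrightarrow> norm (f \<omega> - g \<omega> - a *\<^sub>R h \<omega>) \<le> B"
  shows "norm (sphere_integral f - sphere_integral g - a *\<^sub>R sphere_integral h)
    \<le> 2 * B * measure sphere_measure (sphere 0 1 :: 'a set)"
proof -
  let ?V = "sphere_integral f - sphere_integral g - a *\<^sub>R sphere_integral h"
  interpret finite_measure "sphere_measure :: 'a measure"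
    by (rule finite_measure_sphere_measure)
  obtain \<Phi> :: "'b \<Rightarrow> complex" where \<Phi>: "complex_functional \<Phi>" and norming: "norm ?V \<le> cmod (\<Phi> ?V)"
    by (rule norming_complex_functional)
  interpret bounded_linear \<Phi>
    by (rule complex_functional_bounded_linear[OF \<Phi>])
  have m: "(\<lambda>\<omega>. \<Phi> (u \<omega>)) \<in> borel_measurable sphere_measure" if "continuous_on UNIV u" for u :: "'a \<Rightarrow> 'b"
    using that by (intro borel_measurable_sphere_measure continuous_on) 
  have int: "integrable sphere_measure (\<lambda>\<omega>. \<Phi> (u \<omega>))" if "continuous_on UNIV u" for u :: "'a \<Rightarrow> 'b"
    using \<Phi> L1_fun_sphere_measure[OF that] m[OF that] by (rule complex_functional_integrable)
  have eq: "\<Phi> (sphere_integral u) = (\<integral>\<omega>. \<Phi> (u \<omega>) \<partial>sphere_measure)" if "continuous_on UNIV u" for u :: "'a \<Rightarrow> 'b"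
    using \<Phi> L1_fun_sphere_measure[OF that] m[OF that] by (rule complex_functional_banach_integral)
  have "\<Phi> ?V = (\<integral>\<omega>. \<Phi> (f \<omega>) - \<Phi> (g \<omega>) - a *\<^sub>R \<Phi> (h \<omega>) \<partial>sphere_measure)"
    using c by (simp add: diff scaleR eq int)
  also have "\<dots> = (\<integral>\<omega>. \<Phi> (f \<omega> - g \<omega> - a *\<^sub>R h \<omega>) \<partial>sphere_measure)"
    by (simp add: diff scaleR)
  also have "norm \<dots> \<le> integral\<^sup>L sphere_measure (\<lambda>\<omega>::'a. 2 * B)"
  proof (rule Bochner_Integration.integral_norm_bound_integral)
    show "integrable sphere_measure (\<lambda>\<omega>. \<Phi> (f \<omega> - g \<omega> - a *\<^sub>R h \<omega>))"
      using c by (intro int continuous_intros)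
    show "cmod (\<Phi> (f \<omega> - g \<omega> - a *\<^sub>R h \<omega>)) \<le> 2 * B" if "\<omega> \<in> space sphere_measure" for \<omega>
    proof -
      have "cmod (\<Phi> (f \<omega> - g \<omega> - a *\<^sub>R h \<omega>)) \<le> 2 * norm (f \<omega> - g \<omega> - a *\<^sub>R h \<omega>)"
        using \<Phi> by (simp add: complex_functional_def)
      also have "\<dots> \<le> 2 * B"
        using le[of \<omega>] that by (simp add: space_sphere_measure)
      finally show ?thesis .
    qed
  qed simp
  also have "\<dots> = 2 * B * measure sphere_measure (sphere 0 1 :: 'a set)"
    by (simp add: space_sphere_measure)
  finally show ?thesis
    using norming by simp
qed

lemma uniformly_close_on_sphere:
  fixes G :: "real \<Rightarrow> 'a::euclidean_space \<Rightarrow> 'b::real_normed_vector"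
  assumes G: "continuous_on UNIV (\<lambda>p. G (fst p) (snd p))" and e: "e > 0"
  obtains d where "d > 0" "\<And>s \<omega>. \<bar>s - r\<bar> < d \<Longrightarrow> norm \<omega> = 1 \<Longrightarrow> norm (G s \<omega> - G r \<omega>) \<le> e"
proof -
  have "uniformly_continuous_on ({r - 1..r + 1} \<times> sphere 0 1) (\<lambda>p. G (fst p) (snd p))"
    by (intro compact_uniformly_continuous continuous_on_subset[OF G] compact_Times) auto
  from uniformly_continuous_onE[OF this e]
  obtain d where d: "d > 0" "\<And>p q. p \<in> {r - 1..r + 1} \<times> sphere 0 1 \<Longrightarrow> q \<in> {r - 1..r + 1} \<times> sphere 0 1 \<Longrightarrow>
      dist q p < d \<Longrightarrow> dist (G (fst q) (snd q)) (G (fst p) (snd p)) < e"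
    by metis
  show thesis
  proof
    show "min d 1 > 0"
      using d(1) by simp
    fix s and \<omega> :: 'a
    assume s: "\<bar>s - r\<bar> < min d 1" and \<omega>: "norm \<omega> = 1"
    have "dist (s, \<omega>) (r, \<omega>) = \<bar>s - r\<bar>"
      by (simp add: dist_Pair_Pair dist_real_def)
    then show "norm (G s \<omega> - G r \<omega>) \<le> e"
      using d(2)[of "(r, \<omega>)" "(s, \<omega>)"] s \<omega> by (simp add: dist_norm abs_less_iff)
  qed
qed

lemma continuous_on_slice:
  assumes "continuous_on UNIV (\<lambda>p. G (fst p) (snd p))"
  shows "continuous_on UNIV (G s)"
proof -
  have "continuous_on UNIV (\<lambda>\<omega>. (s, \<omega>))"
    by (intro continuous_intros)
  from continuous_on_compose2[OF assms this] show ?thesis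
    by simp
qed

text \<open>
  The difference quotients converge uniformly on the sphere, because \<open>G'\<close> is uniformly continuous on a
  compact neighbourhood and the mean value inequality bounds the linearisation error by the oscillation
  of \<open>G'\<close>.
\<close>

lemma has_vector_derivative_sphere_integral:
  fixes G G' :: "real \<Rightarrow> 'a::euclidean_space \<Rightarrow> 'b::complex_banach"
  assumes G: "continuous_on UNIV (\<lambda>p. G (fst p) (snd p))" and G': "continuous_on UNIV (\<lambda>p. G' (fst p) (snd p))"
    and deriv: "\<And>r \<omega>. ((\<lambda>r. G r \<omega>) has_vector_derivative G' r \<omega>) (at r)"
  shows "((\<lambda>r. sphere_integral (G r)) has_vector_derivative sphere_integral (G' r)) (at r)"
  unfolding has_vector_derivative_def has_derivative_at_alt
proof (intro conjI allI impI)
  show "bounded_linear (\<lambda>x. x *\<^sub>R sphere_integral (G' r))"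
    by (rule bounded_linear_scaleR_left)
  fix e :: real assume "e > 0"
  define S where "S = measure sphere_measure (sphere 0 1 :: 'a set)"
  have S: "S \<ge> 0"
    by (simp add: S_def)
  (* S + 1 instead of S avoids a case distinction; the 2 absorbs the bound of the norming
     functional *)
  define e' where "e' = e / (2 * (S + 1))"
  have e': "e' > 0"
    using \<open>e > 0\<close> S by (simp add: e'_def)
  obtain d where d: "d > 0" "\<And>s \<omega>. \<bar>s - r\<bar> < d \<Longrightarrow> norm \<omega> = 1 \<Longrightarrow> norm (G' s \<omega> - G' r \<omega>) \<le> e'"
    using uniformly_close_on_sphere[OF G' e', of r] by blast
  have "norm (sphere_integral (G s) - sphere_integral (G r) -
      (s - r) *\<^sub>R sphere_integral (G' r)) \<le> e * norm (s - r)" if s: "norm (s - r) < d" for s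
  proof -
    have "norm (sphere_integral (G s) - sphere_integral (G r) -
        (s - r) *\<^sub>R sphere_integral (G' r)) \<le> 2 * (norm (s - r) * e') * S"
      unfolding S_def
    proof (rule norm_sphere_integral_combination_le)
      fix \<omega> :: 'a assume \<omega>: "norm \<omega> = 1"
      show "norm (G s \<omega> - G r \<omega> - (s - r) *\<^sub>R G' r \<omega>) \<le> norm (s - r) * e'"
      proof (rule vector_differentiable_bound_linearization[where S = "{r - d<..<r + d}"])
        show "((\<lambda>r. G r \<omega>) has_vector_derivative G' t \<omega>) (at t within {r - d<..<r + d})" for t
          using deriv by (rule has_vector_derivative_at_within)
        show "closed_segment r s \<subseteq> {r - d<..<r + d}"
          using s d(1) by (intro closed_segment_subset) (auto simp: abs_less_iff)
      qed (use d \<omega> in \<open>auto simp: abs_less_iff\<close>)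
    qed (use G G' in \<open>auto intro: continuous_on_slice\<close>)
    also have "\<dots> \<le> e * norm (s - r)"
    proof -
      have "2 * e' * S \<le> e"
        using \<open>e > 0\<close> S by (simp add: e'_def field_simps)
      from mult_right_mono[OF this, of "norm (s - r)"] show ?thesis
        by (simp add: mult_ac)
    qed
    finally show ?thesis .
  qed
  then show "\<exists>d>0. \<forall>s. norm (s - r) < d \<longrightarrow> norm (sphere_integral (G s) - sphere_integral (G r) -
      (s - r) *\<^sub>R sphere_integral (G' r)) \<le> e * norm (s - r)"
    using d(1) by blast
qed

lemma continuous_sphere_integral:
  fixes G :: "real \<Rightarrow> 'a::euclidean_space \<Rightarrow> 'b::complex_banach"
  assumes G: "continuous_on UNIV (\<lambda>p. G (fst p) (snd p))"
  shows "continuous_on UNIV (\<lambda>r. sphere_integral (G r))"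
  unfolding continuous_on_iff
proof (intro ballI allI impI)
  fix r e :: real assume "e > 0"
  define S where "S = measure sphere_measure (sphere 0 1 :: 'a set)"
  have S: "S \<ge> 0"
    by (simp add: S_def)
  define e' where "e' = e / (4 * (S + 1))"
  have e': "e' > 0"
    using \<open>e > 0\<close> S by (simp add: e'_def)
  obtain d where d: "d > 0" "\<And>s \<omega>. \<bar>s - r\<bar> < d \<Longrightarrow> norm \<omega> = 1 \<Longrightarrow> norm (G s \<omega> - G r \<omega>) \<le> e'"
    using uniformly_close_on_sphere[OF G e', of r] by blast
  have "dist (sphere_integral (G s)) (sphere_integral (G r)) < e" if "dist s r < d" for s
  proof -
    have "norm (sphere_integral (G s) - sphere_integral (G r) -
        0 *\<^sub>R sphere_integral (G r)) \<le> 2 * e' * S"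
      unfolding S_def using d(2)[of s] that
      by (intro norm_sphere_integral_combination_le continuous_on_slice[OF G]) (simp add: dist_real_def)
    also have "\<dots> < e"
      using \<open>e > 0\<close> S by (simp add: e'_def field_simps add_pos_nonneg)
    finally show ?thesis
      by (simp add: dist_norm)
  qed
  then show "\<exists>d>0. \<forall>s\<in>UNIV. dist s r < d \<longrightarrow>
      dist (sphere_integral (G s)) (sphere_integral (G r)) < e"
    using d(1) by blast
qed

text \<open>
  The iterated derivatives of \<open>r \<mapsto> F (x + r *\<^sub>R \<omega>)\<close> in \<open>r\<close> are values at \<open>x + r *\<^sub>R \<omega>\<close> of sums of
  products of a polynomial in \<open>\<omega>\<close> with a partial derivative of \<open>F\<close>. The predicate describes such sums,
  with continuous functions of \<open>\<omega>\<close> in place of the polynomials,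
  \<open>m\<close> being the number of derivatives still available. It makes the derivatives jointly continuous in
  \<open>\<omega>\<close> and \<open>y\<close>, although the differentiability class is given only for fixed directions.
\<close>

inductive angular_family :: "nat \<Rightarrow> ('a::euclidean_space \<Rightarrow> 'a \<Rightarrow> 'b::real_normed_vector) \<Rightarrow> bool" for m where
  angular_family_scaleR: "continuous_on UNIV p \<Longrightarrow> times_cont_diff m f \<Longrightarrow> angular_family m (\<lambda>\<omega> y. p \<omega> *\<^sub>R f y)"
| angular_family_sum: "finite I \<Longrightarrow> (\<And>i::'a. i \<in> I \<Longrightarrow> angular_family m (Q i)) \<Longrightarrow> angular_family m (\<lambda>\<omega> y. \<Sum>i\<in>I. Q i \<omega> y)"

lemma times_cont_diff_imp_continuous:
  assumes "times_cont_diff m f"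
  shows "continuous_on UNIV f"
proof (cases m)
  case 0
  then show ?thesis
    using assms by simp
next
  case (Suc k)
  then show ?thesis
    using assms by (auto simp: continuous_on_eq_continuous_at intro: differentiable_imp_continuous_within)
qed

lemma angular_family_continuous:
  assumes "angular_family m Q"
  shows "continuous_on UNIV (\<lambda>p. Q (fst p) (snd p))"
  using assms
proof induction
  case (angular_family_scaleR p f)
  have "continuous_on UNIV (\<lambda>x. p (fst x))"
    by (rule continuous_on_compose2[OF angular_family_scaleR(1) continuous_on_fst[OF continuous_on_id]]) simp
  moreover have "continuous_on UNIV (\<lambda>x. f (snd x))"
    by (rule continuous_on_compose2[OF times_cont_diff_imp_continuous[OF angular_family_scaleR(2)]
          continuous_on_snd[OF continuous_on_id]]) simp
  ultimately show ?case
    by (intro continuous_intros)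
next
  case (angular_family_sum I Q)
  then show ?case
    by (intro continuous_on_sum) auto
qed

text \<open>
  The chain rule, with the direction \<open>\<omega>\<close> expanded in the basis so that only derivatives in fixed
  directions occur.
\<close>

lemma angular_family_radial_derivative:
  fixes Q :: "'a::euclidean_space \<Rightarrow> 'a \<Rightarrow> 'b::real_normed_vector"
  assumes "angular_family (Suc m) Q"
  shows "\<exists>Q'. angular_family m Q' \<and>
    (\<forall>\<omega> y r. ((\<lambda>r. Q \<omega> (y + r *\<^sub>R \<omega>)) has_vector_derivative Q' \<omega> (y + r *\<^sub>R \<omega>)) (at r))"
  using assms
proof induction
  case (angular_family_scaleR p f)
  let ?D = "\<lambda>y. frechet_derivative f (at y)"
  let ?Q' = "\<lambda>\<omega> y. \<Sum>b\<in>Basis. (p \<omega> * (\<omega> \<bullet> b)) *\<^sub>R ?D y b"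
  have der: "(f has_derivative ?D y) (at y)" for y
    using angular_family_scaleR(2) by (simp add: frechet_derivative_works)
  have "angular_family m ?Q'"
    using angular_family_scaleR
    by (intro angular_family.angular_family_sum angular_family.angular_family_scaleR) (auto intro!: continuous_intros)
  moreover have "((\<lambda>r. p \<omega> *\<^sub>R f (y + r *\<^sub>R \<omega>)) has_vector_derivative ?Q' \<omega> (y + r *\<^sub>R \<omega>)) (at r)" for \<omega> y r
  proof -
    let ?z = "y + r *\<^sub>R \<omega>"
    interpret D: linear "?D ?z"
      using der by (rule has_derivative_linear)
    have "((\<lambda>r. y + r *\<^sub>R \<omega>) has_derivative (\<lambda>h. h *\<^sub>R \<omega>)) (at r)"
      by (auto intro!: derivative_eq_intros)
    from has_derivative_compose[OF this der]
    have "((\<lambda>r. f (y + r *\<^sub>R \<omega>)) has_vector_derivative ?D ?z \<omega>) (at r)"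
      by (simp add: has_vector_derivative_def D.scaleR)
    then have "((\<lambda>r. p \<omega> *\<^sub>R f (y + r *\<^sub>R \<omega>)) has_vector_derivative p \<omega> *\<^sub>R ?D ?z \<omega>) (at r)"
      by (rule bounded_linear.has_vector_derivative[OF bounded_linear_scaleR_right])
    also have "?D ?z \<omega> = ?D ?z (\<Sum>b\<in>Basis. (\<omega> \<bullet> b) *\<^sub>R b)"
      by (simp add: euclidean_representation)
    also have "\<dots> = (\<Sum>b\<in>Basis. (\<omega> \<bullet> b) *\<^sub>R ?D ?z b)"
      by (simp add: D.sum D.scaleR)
    finally show ?thesis
      by (simp add: scaleR_sum_right)
  qed
  ultimately show ?case
    by (intro exI[of _ ?Q']) blast
next
  case (angular_family_sum I Q)
  then obtain Q' where Q': "\<And>i. i \<in> I \<Longrightarrow> angular_family m (Q' i)"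
    "\<And>i \<omega> y r. i \<in> I \<Longrightarrow> ((\<lambda>r. Q i \<omega> (y + r *\<^sub>R \<omega>)) has_vector_derivative Q' i \<omega> (y + r *\<^sub>R \<omega>)) (at r)"
    by metis
  show ?case
    using Q' angular_family_sum(1)
    by (intro exI[of _ "\<lambda>\<omega> y. \<Sum>i\<in>I. Q' i \<omega> y"]) (auto intro!: angular_family.angular_family_sum has_vector_derivative_sum)
qed

lemma angular_family_polar_continuous:
  assumes "angular_family m Q"
  shows "continuous_on UNIV (\<lambda>p. Q (snd p) (x + fst p *\<^sub>R snd p))"
proof -
  have "continuous_on UNIV (\<lambda>p. (snd p, x + fst p *\<^sub>R snd p))"
    by (intro continuous_intros)
  from continuous_on_compose2[OF angular_family_continuous[OF assms] this] show ?thesis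
    by simp
qed

lemma sphere_average_derivative:
  fixes Q :: "'a::euclidean_space \<Rightarrow> 'a \<Rightarrow> 'b::complex_banach"
  assumes Q: "angular_family (Suc m) Q"
  obtains Q' where "angular_family m Q'"
    and "\<And>r. ((\<lambda>r. sphere_average (\<lambda>\<omega>. Q \<omega> (x + r *\<^sub>R \<omega>))) has_vector_derivative
      sphere_average (\<lambda>\<omega>. Q' \<omega> (x + r *\<^sub>R \<omega>))) (at r)"
proof -
  obtain Q' where Q': "angular_family m Q'"
    and d: "\<And>\<omega> y r. ((\<lambda>r. Q \<omega> (y + r *\<^sub>R \<omega>)) has_vector_derivative Q' \<omega> (y + r *\<^sub>R \<omega>)) (at r)"
    using angular_family_radial_derivative[OF Q] by blast
  have "((\<lambda>r. sphere_average (\<lambda>\<omega>. Q \<omega> (x + r *\<^sub>R \<omega>))) has_vector_derivative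
      sphere_average (\<lambda>\<omega>. Q' \<omega> (x + r *\<^sub>R \<omega>))) (at r)" for r
    by (intro bounded_linear.has_vector_derivative[OF bounded_linear_scaleR_right] has_vector_derivative_sphere_integral
        angular_family_polar_continuous[OF Q] angular_family_polar_continuous[OF Q'] d)
  with Q' show thesis
    by (rule that)
qed

lemma higher_vector_derivative_Suc:
  "higher_vector_derivative (Suc l) f r = vector_derivative (higher_vector_derivative l f) (at r)"
  by (simp add: higher_vector_derivative_def)

lemma higher_derivative_spherical_mean:
  fixes F :: "'a::euclidean_space \<Rightarrow> 'b::complex_banach"
  assumes F: "times_cont_diff k F" and "l \<le> k"
  shows "\<exists>Q. angular_family (k - l) Q \<and> higher_vector_derivative l (spherical_mean F x) =
    (\<lambda>r. sphere_average (\<lambda>\<omega>. Q \<omega> (x + r *\<^sub>R \<omega>)))"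
  using \<open>l \<le> k\<close>
proof (induction l)
  case 0
  have "angular_family k (\<lambda>\<omega> y. 1 *\<^sub>R F y)"
    using F by (intro angular_family_scaleR) auto
  then show ?case
    by (intro exI[of _ "\<lambda>\<omega> y. F y"]) (auto simp: higher_vector_derivative_def spherical_mean_def[abs_def])
next
  case (Suc l)
  then obtain Q where Q: "angular_family (Suc (k - Suc l)) Q"
    and eq: "higher_vector_derivative l (spherical_mean F x) = (\<lambda>r. sphere_average (\<lambda>\<omega>. Q \<omega> (x + r *\<^sub>R \<omega>)))"
    by (auto simp: Suc_diff_Suc)
  obtain Q' where Q': "angular_family (k - Suc l) Q'"
    and d: "\<And>r. (higher_vector_derivative l (spherical_mean F x) has_vector_derivative
      sphere_average (\<lambda>\<omega>. Q' \<omega> (x + r *\<^sub>R \<omega>))) (at r)"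
    unfolding eq using sphere_average_derivative[OF Q] by blast
  have "higher_vector_derivative (Suc l) (spherical_mean F x) = (\<lambda>r. sphere_average (\<lambda>\<omega>. Q' \<omega> (x + r *\<^sub>R \<omega>)))"
    by (rule ext) (simp only: higher_vector_derivative_Suc vector_derivative_at[OF d])
  then show ?case
    using Q' by blast
qed

lemma continuous_on_higher_derivative_spherical_mean:
  fixes F :: "'a::euclidean_space \<Rightarrow> 'b::complex_banach"
  assumes "times_cont_diff k F" and "l \<le> k"
  shows "continuous_on UNIV (higher_vector_derivative l (spherical_mean F x))"
proof -
  obtain Q where Q: "angular_family (k - l) Q"
    and eq: "higher_vector_derivative l (spherical_mean F x) = (\<lambda>r. sphere_average (\<lambda>\<omega>. Q \<omega> (x + r *\<^sub>R \<omega>)))"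
    using higher_derivative_spherical_mean[OF assms] by blast
  show ?thesis
    unfolding eq by (intro continuous_intros continuous_sphere_integral angular_family_polar_continuous[OF Q])
qed

lemma has_vector_derivative_higher_derivative_spherical_mean:
  fixes F :: "'a::euclidean_space \<Rightarrow> 'b::complex_banach"
  assumes "times_cont_diff k F" and "l < k"
  shows "(higher_vector_derivative l (spherical_mean F x) has_vector_derivative
    higher_vector_derivative (Suc l) (spherical_mean F x) r) (at r)"
proof -
  have "l \<le> k"
    using assms(2) by simp
  from higher_derivative_spherical_mean[OF assms(1) this, of x]
  obtain Q where Q: "angular_family (Suc (k - Suc l)) Q"
    and eq: "higher_vector_derivative l (spherical_mean F x) = (\<lambda>r. sphere_average (\<lambda>\<omega>. Q \<omega> (x + r *\<^sub>R \<omega>)))"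
    using assms(2) by (auto simp: Suc_diff_Suc)
  obtain Q' where d: "\<And>r. (higher_vector_derivative l (spherical_mean F x) has_vector_derivative
      sphere_average (\<lambda>\<omega>. Q' \<omega> (x + r *\<^sub>R \<omega>))) (at r)"
    unfolding eq using sphere_average_derivative[OF Q] by blast
  show ?thesis
    unfolding higher_vector_derivative_Suc vector_derivative_at[OF d] by (rule d)
qed

section \<open>Integration by parts against the kernel\<close>

text \<open>
  One integration by parts. The kernel of order \<open>Suc m\<close> is the derivative of the kernel of order \<open>m\<close>
  divided by \<open>r\<close>; hence the weight drops by two powers of \<open>r\<close>, and \<open>h\<close> is replaced by
  \<open>(2 m + 1) h + r h'\<close>. The boundary term at \<open>0\<close> vanishes because of the odd power of \<open>r\<close>.
\<close>

lemma odd_ball_kernel_integral_step: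
  fixes h h' :: "real \<Rightarrow> complex"
  assumes R: "R \<ge> 0" and T: "T \<ge> 0"
    and h: "\<And>r. (h has_vector_derivative h' r) (at r)" and h': "continuous_on UNIV h'"
  shows "integral {0..T} (\<lambda>r. r ^ (2 * Suc m) *\<^sub>R (odd_ball_kernel R (Suc m) r * h r)) =
    (2 * real (Suc m)) *\<^sub>R
      (integral {0..T} (\<lambda>r. r ^ (2 * m) *\<^sub>R (odd_ball_kernel R m r * (real (2 * m + 1) *\<^sub>R h r + r *\<^sub>R h' r))) -
       T ^ (2 * m + 1) *\<^sub>R (odd_ball_kernel R m T * h T))"
proof -
  let ?K = "odd_ball_kernel R"
  define c where "c = 2 * real (Suc m)"
  have c: "c > 0"
    by (simp add: c_def)
  have hc: "continuous_on S h" for S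
    using h by (meson has_vector_derivative_continuous continuous_at_imp_continuous_on)
  note [continuous_intros] = hc continuous_on_subset[OF h'] continuous_on_odd_ball_kernel[OF R]
  let ?f = "\<lambda>r. r ^ (2 * m) *\<^sub>R (?K m r * (real (2 * m + 1) *\<^sub>R h r + r *\<^sub>R h' r))"
  let ?g = "\<lambda>r. r ^ (2 * Suc m) *\<^sub>R (?K (Suc m) r * h r)"
  have "((\<lambda>r. r ^ (2 * m + 1) *\<^sub>R (?K m r * h r)) has_vector_derivative ?f r - (1 / c) *\<^sub>R ?g r) (at r within {0..T})" for r
  proof -
    have "((\<lambda>r. r ^ (2 * m + 1)) has_real_derivative real (2 * m + 1) * r ^ (2 * m)) (at r)"
      by (rule DERIV_cong[OF DERIV_pow]) simp
    moreover have "(?K m has_vector_derivative (- r / c) *\<^sub>R ?K (Suc m) r) (at r)"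
      using has_vector_derivative_odd_ball_kernel[OF R, of m r] by (simp add: c_def add.commute)
    then have "((\<lambda>r. ?K m r * h r) has_vector_derivative ?K m r * h' r + ((- r / c) *\<^sub>R ?K (Suc m) r) * h r) (at r)"
      using h by (intro has_vector_derivative_mult)
    ultimately have "((\<lambda>r. r ^ (2 * m + 1) *\<^sub>R (?K m r * h r)) has_vector_derivative
        r ^ (2 * m + 1) *\<^sub>R (?K m r * h' r + ((- r / c) *\<^sub>R ?K (Suc m) r) * h r) +
        (real (2 * m + 1) * r ^ (2 * m)) *\<^sub>R (?K m r * h r)) (at r)"
      by (rule has_vector_derivative_scaleR)
    also have "r ^ (2 * m + 1) *\<^sub>R (?K m r * h' r + ((- r / c) *\<^sub>R ?K (Suc m) r) * h r) +
        (real (2 * m + 1) * r ^ (2 * m)) *\<^sub>R (?K m r * h r) = ?f r - (1 / c) *\<^sub>R ?g r"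
      using c by (simp add: scaleR_conv_of_real field_simps power2_eq_square)
    finally show ?thesis
      by (rule has_vector_derivative_at_within)
  qed
  from fundamental_theorem_of_calculus[OF T this]
  have "((\<lambda>r. ?f r - (1 / c) *\<^sub>R ?g r) has_integral T ^ (2 * m + 1) *\<^sub>R (?K m T * h T)) {0..T}"
    by simp
  then have "integral {0..T} (\<lambda>r. ?f r - (1 / c) *\<^sub>R ?g r) = T ^ (2 * m + 1) *\<^sub>R (?K m T * h T)"
    by (rule integral_unique)
  moreover have "integral {0..T} (\<lambda>r. ?f r - (1 / c) *\<^sub>R ?g r) = integral {0..T} ?f - (1 / c) *\<^sub>R integral {0..T} ?g"
  proof -
    have f: "?f integrable_on {0..T}" and g: "?g integrable_on {0..T}"
      by (auto intro!: integrable_continuous_interval continuous_intros simp del: power_Suc mult_Suc_right)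
    show ?thesis
      using Henstock_Kurzweil_Integration.integral_diff[OF f integrable_cmul[OF g]] by (simp only: integral_cmul)
  qed
  ultimately have "(1 / c) *\<^sub>R integral {0..T} ?g = integral {0..T} ?f - T ^ (2 * m + 1) *\<^sub>R (?K m T * h T)"
    by (simp add: algebra_simps)
  then have "c *\<^sub>R ((1 / c) *\<^sub>R integral {0..T} ?g) = c *\<^sub>R (integral {0..T} ?f - T ^ (2 * m + 1) *\<^sub>R (?K m T * h T))"
    by (simp only:)
  then show ?thesis
    using c by (simp add: c_def del: of_nat_Suc)
qed

text \<open>
  Expressed in the products \<open>r ^ j * u j r\<close>, where \<open>u j\<close> is the \<open>j\<close>-th derivative of \<open>u 0\<close>, the operator
  \<open>h \<mapsto> (2 m + 1) h + r h'\<close> with \<open>m = k - Suc s\<close> acts on the coefficients by this recursion, since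
  \<open>r d/dr (r ^ j * u j) = j * r ^ j * u j + r ^ Suc j * u (Suc j)\<close>.
\<close>

primrec euler_coeff :: "nat \<Rightarrow> nat \<Rightarrow> nat \<Rightarrow> real" where
  "euler_coeff k 0 j = (if j = 0 then 1 else 0)"
| "euler_coeff k (Suc s) j = (2 * real (k - s) - 1 + real j) * euler_coeff k s j +
    (if j = 0 then 0 else euler_coeff k s (j - 1))"

lemma euler_coeff_eq_0: "s < j \<Longrightarrow> euler_coeff k s j = 0"
  by (induction s arbitrary: j) auto

lemma euler_coeff_at_0: "euler_coeff k s 0 = (\<Prod>i<s. 2 * real (k - i) - 1)"
  by (induction s) (auto simp: mult.commute)

definition euler_sum :: "nat \<Rightarrow> nat \<Rightarrow> (nat \<Rightarrow> real \<Rightarrow> complex) \<Rightarrow> real \<Rightarrow> complex" where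
  "euler_sum k s u r = (\<Sum>j\<le>s. (euler_coeff k s j * r ^ j) *\<^sub>R u j r)"

lemma has_vector_derivative_euler_sum:
  assumes u: "\<And>j. j < k \<Longrightarrow> (u j has_vector_derivative u (Suc j) r) (at r)" and "s < k"
  shows "(euler_sum k s u has_vector_derivative
    (\<Sum>j\<le>s. (euler_coeff k s j * r ^ j) *\<^sub>R u (Suc j) r + (euler_coeff k s j * (real j * r ^ (j - 1))) *\<^sub>R u j r)) (at r)"
  unfolding euler_sum_def[abs_def]
proof (intro has_vector_derivative_sum has_vector_derivative_scaleR)
  fix j assume "j \<in> {..s}"
  then show "(u j has_vector_derivative u (Suc j) r) (at r)"
    using \<open>s < k\<close> by (intro u) simp
  show "((\<lambda>r. euler_coeff k s j * r ^ j) has_real_derivative euler_coeff k s j * (real j * r ^ (j - 1))) (at r)"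
    by (auto intro!: derivative_eq_intros)
qed

lemma euler_sum_Suc:
  assumes "s < k"
  shows "euler_sum k (Suc s) u r = (2 * real (k - s) - 1) *\<^sub>R euler_sum k s u r +
    r *\<^sub>R (\<Sum>j\<le>s. (euler_coeff k s j * r ^ j) *\<^sub>R u (Suc j) r + (euler_coeff k s j * (real j * r ^ (j - 1))) *\<^sub>R u j r)"
proof -
  let ?e = "euler_coeff k s" and ?c = "2 * real (k - s) - 1"
  have "euler_sum k (Suc s) u r = (\<Sum>j\<le>Suc s. ((?c + real j) * ?e j * r ^ j) *\<^sub>R u j r) +
      (\<Sum>j\<le>Suc s. ((if j = 0 then 0 else ?e (j - 1)) * r ^ j) *\<^sub>R u j r)"
    unfolding euler_sum_def by (simp add: algebra_simps flip: sum.distrib del: sum.atMost_Suc)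
  also have "(\<Sum>j\<le>Suc s. ((?c + real j) * ?e j * r ^ j) *\<^sub>R u j r) = (\<Sum>j\<le>s. ((?c + real j) * ?e j * r ^ j) *\<^sub>R u j r)"
    by (simp add: euler_coeff_eq_0)
  also have "(\<Sum>j\<le>Suc s. ((if j = 0 then 0 else ?e (j - 1)) * r ^ j) *\<^sub>R u j r) =
      (\<Sum>j\<le>s. (?e j * r ^ Suc j) *\<^sub>R u (Suc j) r)"
    by (subst sum.atMost_Suc_shift) simp
  also have "(\<Sum>j\<le>s. ((?c + real j) * ?e j * r ^ j) *\<^sub>R u j r) + (\<Sum>j\<le>s. (?e j * r ^ Suc j) *\<^sub>R u (Suc j) r) =
      (\<Sum>j\<le>s. (?c * (?e j * r ^ j)) *\<^sub>R u j r + r *\<^sub>R ((?e j * r ^ j) *\<^sub>R u (Suc j) r + (?e j * (real j * r ^ (j - 1))) *\<^sub>R u j r))"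
  proof (subst sum.distrib[symmetric], intro sum.cong refl)
    fix j
    show "((?c + real j) * ?e j * r ^ j) *\<^sub>R u j r + (?e j * r ^ Suc j) *\<^sub>R u (Suc j) r =
      (?c * (?e j * r ^ j)) *\<^sub>R u j r + r *\<^sub>R ((?e j * r ^ j) *\<^sub>R u (Suc j) r + (?e j * (real j * r ^ (j - 1))) *\<^sub>R u j r)"
      by (cases j) (simp_all add: algebra_simps)
  qed
  finally show ?thesis
    by (simp add: euler_sum_def sum.distrib scaleR_sum_right scaleR_add_right)
qed

text \<open>
  A common bound for all boundary terms that is integrable over the half line under the hypotheses on
  the compact families.
\<close>

definition boundary_weight :: "nat \<Rightarrow> (nat \<Rightarrow> real \<Rightarrow> complex) \<Rightarrow> real \<Rightarrow> real" where
  "boundary_weight k u T = (\<Sum>i=1..k. \<Sum>l\<le>i. norm (T ^ (i - 1) *\<^sub>R u l T))"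

lemma boundary_weight_ge:
  assumes "1 \<le> i" "i \<le> k" "l \<le> i"
  shows "norm (T ^ (i - 1) *\<^sub>R u l T) \<le> boundary_weight k u T"
proof -
  have "norm (T ^ (i - 1) *\<^sub>R u l T) \<le> (\<Sum>l\<le>i. norm (T ^ (i - 1) *\<^sub>R u l T))"
    using assms by (intro member_le_sum[of l "{..i}" "\<lambda>l. norm (T ^ (i - 1) *\<^sub>R u l T)"]) auto
  also have "\<dots> \<le> boundary_weight k u T"
    unfolding boundary_weight_def
    using assms by (intro member_le_sum[of i "{1..k}" "\<lambda>i. \<Sum>l\<le>i. norm (T ^ (i - 1) *\<^sub>R u l T)"]) (auto intro: sum_nonneg)
  finally show ?thesis .
qed

text \<open>
  With \<open>m = k - Suc s\<close> the kernel of order \<open>m\<close> decays like \<open>1 / T ^ Suc m\<close>. This leaves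
  \<open>T ^ (m + j) * u j T\<close> with \<open>j \<le> s\<close>, and \<open>m + j + 1 \<le> k\<close>.
\<close>

lemma euler_sum_boundary_le:
  assumes R: "R > 0" and "s < k"
  obtains C where "\<And>T. T \<ge> 1 \<Longrightarrow>
    norm (T ^ (2 * (k - Suc s) + 1) *\<^sub>R (odd_ball_kernel R (k - Suc s) T * euler_sum k s u T)) \<le> C * boundary_weight k u T"
proof -
  define m where "m = k - Suc s"
  obtain C where C: "\<And>r. r > 0 \<Longrightarrow> norm (odd_ball_kernel R m r) \<le> C / r ^ Suc m"
    using odd_ball_kernel_decay[OF R] by blast
  have "norm (odd_ball_kernel R m 1) \<le> C"
    using C[of 1] by simp
  then have C0: "C \<ge> 0"
    using norm_ge_zero order_trans by blast
  have "norm (T ^ (2 * m + 1) *\<^sub>R (odd_ball_kernel R m T * euler_sum k s u T)) \<le>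
      (C * (\<Sum>j\<le>s. \<bar>euler_coeff k s j\<bar>)) * boundary_weight k u T" if T: "T \<ge> 1" for T
  proof -
    have "norm (T ^ (2 * m + 1) *\<^sub>R (odd_ball_kernel R m T * euler_sum k s u T)) =
        (T ^ (2 * m + 1) * norm (odd_ball_kernel R m T)) * norm (euler_sum k s u T)"
      using T by (simp add: norm_mult)
    also have "\<dots> \<le> (C * T ^ m) * norm (euler_sum k s u T)"
    proof (rule mult_right_mono)
      have "T ^ (2 * m + 1) * norm (odd_ball_kernel R m T) \<le> T ^ (2 * m + 1) * (C / T ^ Suc m)"
        using C[of T] T by (intro mult_left_mono) auto
      moreover have "T ^ (2 * m + 1) * (C / T ^ Suc m) = C * T ^ m"
        using T by (simp add: mult_2 power_add)
      ultimately show "T ^ (2 * m + 1) * norm (odd_ball_kernel R m T) \<le> C * T ^ m"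
        by simp
    qed simp
    also have "\<dots> = C * norm (T ^ m *\<^sub>R euler_sum k s u T)"
      using T by simp
    also have "T ^ m *\<^sub>R euler_sum k s u T = (\<Sum>j\<le>s. euler_coeff k s j *\<^sub>R (T ^ (m + j + 1 - 1) *\<^sub>R u j T))"
      by (simp add: euler_sum_def scaleR_sum_right power_add mult_ac)
    also have "norm \<dots> \<le> (\<Sum>j\<le>s. \<bar>euler_coeff k s j\<bar> * boundary_weight k u T)"
    proof (intro sum_norm_le)
      fix j assume "j \<in> {..s}"
      then have "norm (T ^ (m + j + 1 - 1) *\<^sub>R u j T) \<le> boundary_weight k u T"
        using \<open>s < k\<close> by (intro boundary_weight_ge) (auto simp: m_def)
      then show "norm (euler_coeff k s j *\<^sub>R (T ^ (m + j + 1 - 1) *\<^sub>R u j T)) \<le> \<bar>euler_coeff k s j\<bar> * boundary_weight k u T"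
        by (simp only: norm_scaleR[of "euler_coeff k s j"]) (intro mult_left_mono, auto)
    qed
    finally show ?thesis
      using C0 by (simp add: mult_left_mono sum_distrib_right mult.assoc)
  qed
  then show thesis
    unfolding m_def by (rule that)
qed

lemma odd_ball_kernel_integral_by_parts:
  assumes R: "R > 0"
    and u: "\<And>j r. j < k \<Longrightarrow> (u j has_vector_derivative u (Suc j) r) (at r)"
    and c: "\<And>j. j \<le> k \<Longrightarrow> continuous_on UNIV (u j)" and "s \<le> k"
  shows "\<exists>C. \<forall>T\<ge>1. norm (integral {0..T} (\<lambda>r. r ^ (2 * k) *\<^sub>R (odd_ball_kernel R k r * u 0 r)) -
    (\<Prod>i<s. 2 * real (k - i)) *\<^sub>R
      integral {0..T} (\<lambda>r. r ^ (2 * (k - s)) *\<^sub>R (odd_ball_kernel R (k - s) r * euler_sum k s u r))) \<le> C * boundary_weight k u T"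
  using \<open>s \<le> k\<close>
proof (induction s)
  case 0
  then show ?case
    by (intro exI[of _ 0]) (simp add: euler_sum_def)
next
  case (Suc s)
  then have s: "s < k"
    by simp
  let ?I = "\<lambda>s T. integral {0..T} (\<lambda>r. r ^ (2 * (k - s)) *\<^sub>R (odd_ball_kernel R (k - s) r * euler_sum k s u r))"
  let ?J = "\<lambda>T. integral {0..T} (\<lambda>r. r ^ (2 * k) *\<^sub>R (odd_ball_kernel R k r * u 0 r))"
  let ?B = "\<lambda>T. T ^ (2 * (k - Suc s) + 1) *\<^sub>R (odd_ball_kernel R (k - Suc s) T * euler_sum k s u T)"
  define p where "p s = (\<Prod>i<s. 2 * real (k - i))" for s
  obtain C where C: "\<And>T. T \<ge> 1 \<Longrightarrow> norm (?J T - p s *\<^sub>R ?I s T) \<le> C * boundary_weight k u T"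
    using Suc by (auto simp: p_def)
  obtain D where D: "\<And>T. T \<ge> 1 \<Longrightarrow> norm (?B T) \<le> D * boundary_weight k u T"
    using euler_sum_boundary_le[OF R s] by blast
  have step: "?I s T = (2 * real (k - s)) *\<^sub>R (?I (Suc s) T - ?B T)" if T: "T \<ge> 1" for T
  proof -
    let ?h' = "\<lambda>r. \<Sum>j\<le>s. (euler_coeff k s j * r ^ j) *\<^sub>R u (Suc j) r + (euler_coeff k s j * (real j * r ^ (j - 1))) *\<^sub>R u j r"
    have "continuous_on UNIV ?h'"
      using s by (intro continuous_intros c) auto
    moreover have "(euler_sum k s u has_vector_derivative ?h' r) (at r)" for r
      using u s by (rule has_vector_derivative_euler_sum)
    moreover have ks: "k - s = Suc (k - Suc s)"
      using s by simp
    moreover have "real (2 * (k - Suc s) + 1) *\<^sub>R euler_sum k s u r + r *\<^sub>R ?h' r = euler_sum k (Suc s) u r" for r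
      using euler_sum_Suc[OF s, of u r] by (simp add: ks)
    ultimately show ?thesis
      using odd_ball_kernel_integral_step[of R T "euler_sum k s u" ?h' "k - Suc s"] R T
      by (simp only: less_imp_le)
  qed
  have "norm (?J T - p (Suc s) *\<^sub>R ?I (Suc s) T) \<le> (C + \<bar>p (Suc s)\<bar> * D) * boundary_weight k u T" if T: "T \<ge> 1" for T
  proof -
    have "?J T - p (Suc s) *\<^sub>R ?I (Suc s) T = (?J T - p s *\<^sub>R ?I s T) - p (Suc s) *\<^sub>R ?B T"
      unfolding step[OF T] by (simp add: p_def algebra_simps)
    also have "norm \<dots> \<le> C * boundary_weight k u T + \<bar>p (Suc s)\<bar> * (D * boundary_weight k u T)"
    proof -
      have "norm ((?J T - p s *\<^sub>R ?I s T) - p (Suc s) *\<^sub>R ?B T) \<le> norm (?J T - p s *\<^sub>R ?I s T) + \<bar>p (Suc s)\<bar> * norm (?B T)"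
        using norm_triangle_ineq4[of "?J T - p s *\<^sub>R ?I s T" "p (Suc s) *\<^sub>R ?B T"] by (simp only: norm_scaleR[of "p (Suc s)"])
      also have "\<dots> \<le> C * boundary_weight k u T + \<bar>p (Suc s)\<bar> * (D * boundary_weight k u T)"
        by (intro add_mono mult_left_mono C D T) simp
      finally show ?thesis .
    qed
    finally show ?thesis
      by (simp add: algebra_simps)
  qed
  then show ?case
    by (auto simp: p_def)
qed

lemma set_integrable_small_somewhere:
  fixes W :: "real \<Rightarrow> real"
  assumes int: "set_integrable lborel {0<..} W" and "e > 0"
  shows "\<exists>T>T0. W T < e"
proof (rule ccontr)
  assume "\<not> ?thesis"
  then have ge: "W T \<ge> e" if "T > T0" for T
    using that by (meson not_le)
  define a where "a = max T0 0"
  define B where "B = (LINT r:{0<..}|lborel. norm (W r))"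
  have abs: "set_integrable lborel {0<..} (\<lambda>r. norm (W r))"
    using int by (rule set_integrable_norm)
  have "e * real n \<le> B" for n
  proof -
    have "(LINT r|lborel. indicator {a<..<a + real n} r * e) \<le> B"
      unfolding B_def set_lebesgue_integral_def
    proof (rule integral_mono)
      show "indicat_real {a<..<a + real n} r * e \<le> indicat_real {0<..} r *\<^sub>R norm (W r)" for r
        using ge[of r] by (auto simp: indicator_def a_def)
    qed (use abs in \<open>auto simp: set_integrable_def\<close>)
    then show ?thesis
      by (simp add: mult.commute)
  qed
  moreover obtain n where "B / e < real n"
    using reals_Archimedean2 by blast
  ultimately show False
    using \<open>e > 0\<close> by (simp add: pos_divide_less_eq mult.commute not_le flip: not_less)
qed

lemma tendsto_integral_atLeastAtMost:
  fixes f :: "real \<Rightarrow> complex"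
  assumes f: "set_integrable lborel {0<..} f"
  shows "((\<lambda>T. integral {0..T} f) \<longlongrightarrow> (LINT r:{0<..}|lborel. f r)) at_top"
proof -
  have eq: "indicator {0..} r *\<^sub>R f r = indicator {0<..} r *\<^sub>R f r + indicator {0} r *\<^sub>R f 0" for r :: real
    by (auto simp: indicator_def)
  have int0: "integrable lborel (\<lambda>r::real. indicator {0} r *\<^sub>R f 0)"
    by (intro integrable_scaleR_left integrable_real_indicator) auto
  have int: "set_integrable lborel {0..} f"
    using f int0 by (simp add: set_integrable_def eq)
  have val: "(LINT r:{0..}|lborel. f r) = (LINT r:{0<..}|lborel. f r)"
    using f int0 unfolding set_lebesgue_integral_def eq set_integrable_def by simp
  have "(LINT r:{0..T}|lborel. f r) = integral {0..T} f" for T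
    by (intro set_borel_integral_eq_integral set_integrable_subset[OF int]) auto
  moreover have "((\<lambda>T. LINT r:{0..T}|lborel. f r) \<longlongrightarrow> (LINT r:{0..}|lborel. f r)) at_top"
    by (rule tendsto_set_lebesgue_integral_at_top[OF _ int]) auto
  ultimately show ?thesis
    by (simp add: val)
qed

lemma LINT_sin_over_r:
  assumes "\<delta> > 0" "R > 0"
  shows "set_integrable lborel {0<..} (\<lambda>r. sin (R * r) * (indicator {0<..<\<delta>} r / r))"
    and "(LINT r:{0<..}|lborel. sin (R * r) * (indicator {0<..<\<delta>} r / r)) = Si (\<delta> * R)"
proof -
  have ind: "indicator {0<..} r *\<^sub>R (sin (R * r) * (indicator {0<..<\<delta>} r / r)) = indicator {0<..<\<delta>} r *\<^sub>R (sin (r * R) / r)" for r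
    by (auto simp: indicator_def mult.commute)
  have "set_integrable lborel {0..\<delta>} (\<lambda>r. R * sinc (r * R))"
    by (intro borel_integrable_atLeastAtMost' continuous_intros)
  then have "set_integrable lborel {0<..<\<delta>} (\<lambda>r. R * sinc (r * R))"
    by (rule set_integrable_subset) auto
  also have "set_integrable lborel {0<..<\<delta>} (\<lambda>r. R * sinc (r * R)) \<longleftrightarrow> set_integrable lborel {0<..<\<delta>} (\<lambda>r. sin (r * R) / r)"
    using assms by (intro set_integrable_cong) auto
  finally show "set_integrable lborel {0<..} (\<lambda>r. sin (R * r) * (indicator {0<..<\<delta>} r / r))"
    unfolding set_integrable_def ind .
  have "(LINT r:{0<..<\<delta>}|lborel. sin (r * R) / r) = Si (\<delta> * R)"
    using LBINT_I0c_sin_scale_divide[of \<delta> R] assms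
    by (simp add: interval_lebesgue_integral_def zero_ereal_def)
  then show "(LINT r:{0<..}|lborel. sin (R * r) * (indicator {0<..<\<delta>} r / r)) = Si (\<delta> * R)"
    unfolding set_lebesgue_integral_def ind .
qed

lemma
  fixes f :: "'i \<Rightarrow> 'a \<Rightarrow> 'b::{banach, second_countable_topology}"
  assumes "\<And>i. i \<in> I \<Longrightarrow> set_integrable M A (f i)"
  shows set_integrable_sum: "set_integrable M A (\<lambda>x. \<Sum>i\<in>I. f i x)"
    and set_integral_sum: "(LINT x:A|M. (\<Sum>i\<in>I. f i x)) = (\<Sum>i\<in>I. LINT x:A|M. f i x)"
  using assms unfolding set_integrable_def set_lebesgue_integral_def scaleR_sum_right
  by (auto intro: Bochner_Integration.integral_sum)

text \<open>
  On \<open>{0..T}\<close> the kernel of order \<open>k\<close> is reduced to \<open>odd_ball_kernel R 0 r = 2 sin (R r) / r\<close> by \<open>k\<close>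
  integrations by parts, with an error of at most a constant times \<open>boundary_weight k u T\<close>. Both main
  terms converge as \<open>T\<close> grows, so their limits are compared along values of \<open>T\<close> at which the error is
  small.
\<close>

lemma odd_ball_kernel_integral_formula:
  fixes u :: "nat \<Rightarrow> real \<Rightarrow> complex" and a :: complex
  assumes R: "R > 0" and \<delta>: "\<delta> > 0"
    and u: "\<And>j r. j < k \<Longrightarrow> (u j has_vector_derivative u (Suc j) r) (at r)"
    and c: "\<And>j. j \<le> k \<Longrightarrow> continuous_on UNIV (u j)"
    and full: "set_integrable lborel {0<..} (\<lambda>r. r ^ (2 * k) *\<^sub>R (odd_ball_kernel R k r * u 0 r))"
    and dini: "set_integrable lborel {0<..} (\<lambda>r. (u 0 r - indicator {0<..<\<delta>} r *\<^sub>R a) /\<^sub>R r)"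
    and lower: "\<And>i l. 1 \<le> i \<Longrightarrow> i \<le> k \<Longrightarrow> l \<le> i \<Longrightarrow> set_integrable lborel {0<..} (\<lambda>r. r ^ (i - 1) *\<^sub>R u l r)"
  shows "(LINT r:{0<..}|lborel. r ^ (2 * k) *\<^sub>R (odd_ball_kernel R k r * u 0 r)) =
    (2 * (\<Prod>i<k. 2 * real (k - i))) *\<^sub>R (euler_coeff k k 0 *\<^sub>R
        ((LINT r:{0<..}|lborel. sin (R * r) *\<^sub>R ((u 0 r - indicator {0<..<\<delta>} r *\<^sub>R a) /\<^sub>R r)) + Si (\<delta> * R) *\<^sub>R a) +
      (\<Sum>j=1..k. euler_coeff k k j *\<^sub>R (LINT r:{0<..}|lborel. sin (R * r) *\<^sub>R (r ^ (j - 1) *\<^sub>R u j r))))"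
proof -
  define p where "p = (\<Prod>i<k. 2 * real (k - i))"
  let ?g = "\<lambda>r. (u 0 r - indicator {0<..<\<delta>} r *\<^sub>R a) /\<^sub>R r"
  let ?e = "euler_coeff k k"
  have osc: "set_integrable lborel {0<..} (\<lambda>r. sin (R * r) *\<^sub>R f r)" if "set_integrable lborel {0<..} f" for f :: "real \<Rightarrow> complex"
  proof -
    have "integrable lborel (\<lambda>r. sin (R * r) *\<^sub>R (indicator {0<..} r *\<^sub>R f r))"
    proof (rule Bochner_Integration.integrable_bound)
      show "integrable lborel (\<lambda>r. indicator {0<..} r *\<^sub>R f r)"
        using that by (simp add: set_integrable_def)
      then show "(\<lambda>r. sin (R * r) *\<^sub>R (indicator {0<..} r *\<^sub>R f r)) \<in> borel_measurable lborel"
        by (intro borel_measurable_scaleR[OF _ borel_measurable_integrable]) measurable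
      show "AE r in lborel. norm (sin (R * r) *\<^sub>R (indicator {0<..} r *\<^sub>R f r)) \<le> norm (indicator {0<..} r *\<^sub>R f r)"
        by (intro AE_I2) (simp only: norm_scaleR[of "sin _"], intro mult_left_le_one_le, auto)
    qed
    then show ?thesis
      by (simp add: set_integrable_def mult.commute)
  qed
  define q where "q r = 2 *\<^sub>R (?e 0 *\<^sub>R (sin (R * r) *\<^sub>R ?g r + (sin (R * r) * (indicator {0<..<\<delta>} r / r)) *\<^sub>R a) +
      (\<Sum>j=1..k. ?e j *\<^sub>R (sin (R * r) *\<^sub>R (r ^ (j - 1) *\<^sub>R u j r))))" for r
  have si: "set_integrable lborel {0<..} (\<lambda>r. (sin (R * r) * (indicator {0<..<\<delta>} r / r)) *\<^sub>R a)"
    using integrable_scaleR_left[OF LINT_sin_over_r(1)[OF \<delta> R, unfolded set_integrable_def], of a]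
    by (simp add: set_integrable_def)
  have low: "set_integrable lborel {0<..} (\<lambda>r. sin (R * r) *\<^sub>R (r ^ (j - 1) *\<^sub>R u j r))" if "j \<in> {1..k}" for j
    using that by (intro osc lower) auto
  have S: "set_integrable lborel {0<..} (\<lambda>r. \<Sum>j=1..k. ?e j *\<^sub>R (sin (R * r) *\<^sub>R (r ^ (j - 1) *\<^sub>R u j r)))"
    using low by (intro set_integrable_sum set_integrable_scaleR_right)
  note AB = set_integral_add[OF osc[OF dini] si]
  note eAB = set_integrable_scaleR_right[OF AB(1), of "?e 0"]
  have q_int: "set_integrable lborel {0<..} q"
    unfolding q_def[abs_def] by (rule set_integrable_scaleR_right[OF set_integral_add(1)[OF eAB S]])
  have q_val: "(LINT r:{0<..}|lborel. q r) = 2 *\<^sub>R (?e 0 *\<^sub>R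
        ((LINT r:{0<..}|lborel. sin (R * r) *\<^sub>R ?g r) + Si (\<delta> * R) *\<^sub>R a) +
      (\<Sum>j=1..k. ?e j *\<^sub>R (LINT r:{0<..}|lborel. sin (R * r) *\<^sub>R (r ^ (j - 1) *\<^sub>R u j r))))"
  proof -
    have "(LINT r:{0<..}|lborel. q r) = 2 *\<^sub>R (?e 0 *\<^sub>R ((LINT r:{0<..}|lborel. sin (R * r) *\<^sub>R ?g r) +
        (LINT r:{0<..}|lborel. (sin (R * r) * (indicator {0<..<\<delta>} r / r)) *\<^sub>R a)) +
        (LINT r:{0<..}|lborel. \<Sum>j=1..k. ?e j *\<^sub>R (sin (R * r) *\<^sub>R (r ^ (j - 1) *\<^sub>R u j r))))"
      unfolding q_def set_integral_scaleR_right set_integral_add(2)[OF eAB S] AB(2) ..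
    also have "(LINT r:{0<..}|lborel. (sin (R * r) * (indicator {0<..<\<delta>} r / r)) *\<^sub>R a) = Si (\<delta> * R) *\<^sub>R a"
    proof -
      have "(LINT r:{0<..}|lborel. (sin (R * r) * (indicator {0<..<\<delta>} r / r)) *\<^sub>R a) =
          (\<integral>r. (indicator {0<..} r *\<^sub>R (sin (R * r) * (indicator {0<..<\<delta>} r / r))) *\<^sub>R a \<partial>lborel)"
        unfolding set_lebesgue_integral_def by (simp add: mult.assoc)
      also have "\<dots> = Si (\<delta> * R) *\<^sub>R a"
        using LINT_sin_over_r[OF \<delta> R] unfolding set_integrable_def set_lebesgue_integral_def
        by (subst integral_scaleR_left) simp_all
      finally show ?thesis .
    qed
    also have "(LINT r:{0<..}|lborel. \<Sum>j=1..k. ?e j *\<^sub>R (sin (R * r) *\<^sub>R (r ^ (j - 1) *\<^sub>R u j r))) =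
        (\<Sum>j=1..k. ?e j *\<^sub>R (LINT r:{0<..}|lborel. sin (R * r) *\<^sub>R (r ^ (j - 1) *\<^sub>R u j r)))"
      by (simp only: set_integral_scaleR_right[symmetric])
         (rule set_integral_sum, rule set_integrable_scaleR_right, rule low)
    finally show ?thesis .
  qed
  have kernel: "r ^ (2 * (k - k)) *\<^sub>R (odd_ball_kernel R (k - k) r * euler_sum k k u r) = q r" if r: "r > 0" for r
  proof -
    (* stated for arbitrary G, so that the quotient by r inside it is not expanded again *)
    have alg: "(2 * s / r) *\<^sub>R (e *\<^sub>R (r *\<^sub>R G + i *\<^sub>R a) + r *\<^sub>R S) =
        2 *\<^sub>R (e *\<^sub>R (s *\<^sub>R G + (s * (i / r)) *\<^sub>R a) + s *\<^sub>R S)" for s e i :: real and G S :: complex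
      using r by (simp add: scaleR_conv_of_real field_simps)
    have set: "{..k} = insert 0 {1..k}"
      by auto
    have "euler_sum k k u r = ?e 0 *\<^sub>R u 0 r + (\<Sum>j=1..k. (?e j * r ^ j) *\<^sub>R u j r)"
      unfolding euler_sum_def set by simp
    also have "u 0 r = r *\<^sub>R ?g r + indicator {0<..<\<delta>} r *\<^sub>R a"
      using r by simp
    also have "(\<Sum>j=1..k. (?e j * r ^ j) *\<^sub>R u j r) = (\<Sum>j=1..k. r *\<^sub>R (?e j *\<^sub>R (r ^ (j - 1) *\<^sub>R u j r)))"
    proof (rule sum.cong[OF refl])
      fix j assume "j \<in> {1..k}"
      then obtain i where "j = Suc i"
        by (cases j) auto
      then show "(?e j * r ^ j) *\<^sub>R u j r = r *\<^sub>R (?e j *\<^sub>R (r ^ (j - 1) *\<^sub>R u j r))"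
        by simp
    qed
    finally have e: "euler_sum k k u r = ?e 0 *\<^sub>R (r *\<^sub>R ?g r + indicator {0<..<\<delta>} r *\<^sub>R a) +
      r *\<^sub>R (\<Sum>j=1..k. ?e j *\<^sub>R (r ^ (j - 1) *\<^sub>R u j r))"
      by (simp only: scaleR_sum_right)
    have "odd_ball_kernel R 0 r * euler_sum k k u r = (2 * sin (R * r) / r) *\<^sub>R euler_sum k k u r"
      using odd_ball_kernel_0[of R r] R r by (simp add: scaleR_conv_of_real)
    also have "\<dots> = 2 *\<^sub>R (?e 0 *\<^sub>R (sin (R * r) *\<^sub>R ?g r + (sin (R * r) * (indicator {0<..<\<delta>} r / r)) *\<^sub>R a) +
        sin (R * r) *\<^sub>R (\<Sum>j=1..k. ?e j *\<^sub>R (r ^ (j - 1) *\<^sub>R u j r)))"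
      unfolding e by (rule alg)
    also have "\<dots> = q r"
      by (simp add: q_def scaleR_sum_right mult_ac)
    finally show ?thesis
      by simp
  qed
  (* k - k stays unevaluated, as the integrations by parts below are used with s = k *)
  have main_int: "set_integrable lborel {0<..} (\<lambda>r. r ^ (2 * (k - k)) *\<^sub>R (odd_ball_kernel R (k - k) r * euler_sum k k u r))"
    using q_int kernel by (subst set_integrable_cong[OF refl refl, of _ _ q]) auto
  have main_val: "(LINT r:{0<..}|lborel. r ^ (2 * (k - k)) *\<^sub>R (odd_ball_kernel R (k - k) r * euler_sum k k u r)) = (LINT r:{0<..}|lborel. q r)"
    using kernel by (intro set_lebesgue_integral_cong) auto
  obtain C where C: "\<And>T. T \<ge> 1 \<Longrightarrow> norm (integral {0..T} (\<lambda>r. r ^ (2 * k) *\<^sub>R (odd_ball_kernel R k r * u 0 r)) -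
    p *\<^sub>R integral {0..T} (\<lambda>r. r ^ (2 * (k - k)) *\<^sub>R (odd_ball_kernel R (k - k) r * euler_sum k k u r))) \<le> C * boundary_weight k u T"
    using odd_ball_kernel_integral_by_parts[of R k u k] R u c unfolding p_def by blast
  let ?d = "\<lambda>T. integral {0..T} (\<lambda>r. r ^ (2 * k) *\<^sub>R (odd_ball_kernel R k r * u 0 r)) -
    p *\<^sub>R integral {0..T} (\<lambda>r. r ^ (2 * (k - k)) *\<^sub>R (odd_ball_kernel R (k - k) r * euler_sum k k u r))"
  let ?D = "(LINT r:{0<..}|lborel. r ^ (2 * k) *\<^sub>R (odd_ball_kernel R k r * u 0 r)) - p *\<^sub>R (LINT r:{0<..}|lborel. q r)"
  have lim: "(?d \<longlongrightarrow> ?D) at_top"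
    using tendsto_integral_atLeastAtMost[OF full] tendsto_integral_atLeastAtMost[OF main_int]
    unfolding main_val by (intro tendsto_intros)
  have W_int: "set_integrable lborel {0<..} (boundary_weight k u)"
    unfolding boundary_weight_def[abs_def] using lower
    by (intro set_integrable_sum set_integrable_norm) auto
  have "norm ?D \<le> e" if "e > 0" for e
  proof -
    have "eventually (\<lambda>T. dist (?d T) ?D < e / 2) at_top"
      using lim \<open>e > 0\<close> by (intro tendstoD) auto
    then obtain T0 where T0: "\<And>T. T \<ge> T0 \<Longrightarrow> dist (?d T) ?D < e / 2"
      by (auto simp: eventually_at_top_linorder)
    have "e / (2 * (\<bar>C\<bar> + 1)) > 0"
      using \<open>e > 0\<close> by simp
    from set_integrable_small_somewhere[OF W_int this, of "max T0 1"]
    obtain T where T: "T > max T0 1" "boundary_weight k u T < e / (2 * (\<bar>C\<bar> + 1))"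
      by blast
    have "norm (?d T) \<le> (\<bar>C\<bar> + 1) * boundary_weight k u T"
    proof -
      have "0 \<le> boundary_weight k u T"
        unfolding boundary_weight_def by (intro sum_nonneg) auto
      then have "C * boundary_weight k u T \<le> (\<bar>C\<bar> + 1) * boundary_weight k u T"
        by (intro mult_right_mono) auto
      then show ?thesis
        using C[of T] T(1) by linarith
    qed
    also have "\<dots> \<le> e / 2"
      using T(2) \<open>e > 0\<close> by (simp add: field_simps)
    finally have "norm (?d T) \<le> e / 2" .
    moreover have "norm (?d T - ?D) < e / 2"
      using T0[of T] T(1) by (simp only: dist_norm)
    ultimately show ?thesis
      using norm_triangle_ineq4[of "?d T" "?d T - ?D"] by simp
  qed
  then have "norm ?D \<le> 0"
    by (rule field_le_epsilon) simp
  then show ?thesis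
    unfolding q_val p_def by (simp add: mult.commute)
qed

section \<open>The Riemann-Lebesgue lemma on compact sets of integrable functions\<close>

abbreviation (input) sine_integral :: "real \<Rightarrow> real set \<Rightarrow> real" where
  "sine_integral R A \<equiv> LINT r:A|lborel. sin (R * r)"

lemma set_integrable_sin:
  fixes A :: "real set"
  assumes "A \<in> sets borel" "emeasure lborel A < \<infinity>"
  shows "set_integrable lborel A (\<lambda>r. sin (R * r))"
  unfolding set_integrable_def
proof (rule Bochner_Integration.integrable_bound)
  show "integrable lborel (indicator A :: real \<Rightarrow> real)"
    using assms by (intro integrable_real_indicator) auto
  show "AE r in lborel. norm (indicator A r *\<^sub>R sin (R * r)) \<le> norm (indicator A r :: real)"
    by (intro AE_I2) (simp add: indicator_def)
qed (use assms in measurable)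

lemma LINT_sin_le_measure:
  fixes A :: "real set"
  assumes "A \<in> sets borel" "emeasure lborel A < \<infinity>"
  shows "\<bar>sine_integral R A\<bar> \<le> measure lborel A"
proof -
  have "norm (LINT r|lborel. indicator A r *\<^sub>R sin (R * r)) \<le> (LINT r|lborel. indicator A r)"
  proof (rule Bochner_Integration.integral_norm_bound_integral)
    show "integrable lborel (\<lambda>r. indicator A r *\<^sub>R sin (R * r))"
      using set_integrable_sin[OF assms] by (simp add: set_integrable_def)
    show "integrable lborel (indicator A :: real \<Rightarrow> real)"
      using assms by (intro integrable_real_indicator) auto
  qed (simp add: indicator_def)
  also have "(LINT r|lborel. indicator A r) = measure lborel A"
    using assms by simp
  finally show ?thesis
    by (simp add: set_lebesgue_integral_def)
qed

lemma riemann_lebesgue_Icc: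
  fixes c d :: real
  shows "((\<lambda>R. sine_integral R {c..d}) \<longlongrightarrow> 0) at_top"
proof (cases "c \<le> d")
  case True
  have val: "sine_integral R {c..d} = (cos (R * c) - cos (R * d)) / R" if R: "R > 0" for R
  proof -
    have "sine_integral R {c..d} = integral {c..d} (\<lambda>r. sin (R * r))"
      by (intro set_borel_integral_eq_integral borel_integrable_atLeastAtMost' continuous_intros)
    also have "((\<lambda>r. sin (R * r)) has_integral (- cos (R * d) / R - (- cos (R * c) / R))) {c..d}"
      using True R by (intro fundamental_theorem_of_calculus)
        (auto intro!: derivative_eq_intros simp flip: has_real_derivative_iff_has_vector_derivative)
    then have "integral {c..d} (\<lambda>r. sin (R * r)) = (cos (R * c) - cos (R * d)) / R"
      by (simp add: integral_unique diff_divide_distrib)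
    finally show ?thesis .
  qed
  have "eventually (\<lambda>R. norm (sine_integral R {c..d}) \<le> 2 / R) at_top"
  proof (intro eventually_mono[OF eventually_gt_at_top[of 0]])
    fix R :: real assume R: "R > 0"
    have "\<bar>cos (R * c) - cos (R * d)\<bar> \<le> 2"
      using abs_cos_le_one[of "R * c"] abs_cos_le_one[of "R * d"] by linarith
    then show "norm (sine_integral R {c..d}) \<le> 2 / R"
      using val[OF R] R by (simp add: divide_right_mono)
  qed
  moreover have "((\<lambda>R. 2 / R) \<longlongrightarrow> (0::real)) at_top"
    by (rule tendsto_divide_0[OF tendsto_const filterlim_at_top_imp_at_infinity[OF filterlim_ident]])
  ultimately show ?thesis
    by (rule Lim_null_comparison)
qed (simp add: set_lebesgue_integral_def)

text \<open>
  The sets with this property contain the intervals \<open>{..a}\<close> and are closed under complements and, by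
  Tannery's theorem, under countable disjoint unions; hence all Borel sets have it.
\<close>

lemma riemann_lebesgue_bounded:
  fixes A :: "real set" and N :: real
  assumes "A \<in> sets borel"
  shows "((\<lambda>R. sine_integral R (A \<inter> {-N..N})) \<longlongrightarrow> 0) at_top"
proof -
  have fin: "emeasure lborel (A \<inter> {-N..N}) < \<infinity>" if "A \<in> sets borel" for A
  proof -
    have "emeasure lborel (A \<inter> {-N..N}) \<le> emeasure lborel {-N..N}"
      using that by (intro emeasure_mono) auto
    also have "\<dots> < \<infinity>"
      by (simp add: emeasure_lborel_Icc_eq)
    finally show ?thesis .
  qed
  have sets: "sets borel = sigma_sets UNIV (range (atMost :: real \<Rightarrow> _))"
    by (subst borel_eq_atMost) simp
  have stable: "Int_stable (range (atMost :: real \<Rightarrow> _))"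
  proof -
    have "{..a} \<inter> {..b} = {..min a b}" for a b :: real
      by auto
    then show ?thesis
      by (auto simp: Int_stable_def)
  qed
  have gen: "A \<in> sigma_sets UNIV (range atMost)"
    using assms sets by simp
  have "range (atMost :: real \<Rightarrow> _) \<subseteq> Pow UNIV"
    by simp
  from stable this gen show ?thesis
  proof (induction rule: sigma_sets_induct_disjoint)
    case (basic A)
    then obtain a where "A = {..a}"
      by auto
    then have "A \<inter> {-N..N} = {-N..min a N}"
      by auto
    then show ?case
      by (simp add: riemann_lebesgue_Icc)
  next
    case empty
    then show ?case
      by (simp add: set_lebesgue_integral_def)
  next
    case (compl A)
    then have A: "A \<in> sets borel"
      using sets by simp
    have "sine_integral R ((UNIV - A) \<inter> {-N..N}) =
        sine_integral R {-N..N} - sine_integral R (A \<inter> {-N..N})" for R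
    proof -
      have "sine_integral R (((UNIV - A) \<inter> {-N..N}) \<union> (A \<inter> {-N..N})) =
          sine_integral R ((UNIV - A) \<inter> {-N..N}) + sine_integral R (A \<inter> {-N..N})"
        using A by (intro set_integral_Un set_integrable_sin fin) auto
      also have "((UNIV - A) \<inter> {-N..N}) \<union> (A \<inter> {-N..N}) = {-N..N}"
        by auto
      finally show ?thesis
        by simp
    qed
    then show ?case
      using tendsto_diff[OF riemann_lebesgue_Icc[of "-N" N] compl(2)] by simp
  next
    case (union A)
    let ?B = "\<lambda>i. A i \<inter> {-N..N}"
    have A: "A i \<in> sets borel" for i
      using union(2) sets by auto
    have UA: "(\<Union>i. A i) \<in> sets borel"
      using A by auto
    have UB: "(\<Union>i. ?B i) = (\<Union>i. A i) \<inter> {-N..N}"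
      by auto
    have disj: "disjoint_family ?B"
      using union(1) by (auto simp: disjoint_family_on_def)
    have "(\<lambda>i. measure lborel (?B i)) sums measure lborel (\<Union>i. ?B i)"
      using A disj fin[OF UA] by (intro measure_UNION) (auto simp: UB simp del: UN_simps)
    then have sm: "summable (\<lambda>i. measure lborel (?B i))"
      by (rule sums_summable)
    have bound: "eventually (\<lambda>(i, R). norm (sine_integral R (?B i)) \<le> measure lborel (?B i)) (at_top \<times>\<^sub>F at_top)"
      using LINT_sin_le_measure[OF _ fin[OF A]] A by (intro always_eventually) auto
    have "((\<lambda>R. \<Sum>i. sine_integral R (?B i)) \<longlongrightarrow> (\<Sum>i. 0)) at_top"
      using tannerys_theorem[OF union(3) bound sm] by simp
    moreover have "sine_integral R (\<Union>i. ?B i) = (\<Sum>i. sine_integral R (?B i))" for R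
    proof (rule lebesgue_integral_countable_add)
      show "set_integrable lborel (\<Union>i. ?B i) (\<lambda>r. sin (R * r))"
        unfolding UB using UA by (intro set_integrable_sin fin) auto
      show "?B i \<inter> ?B j = {}" if "i \<noteq> j" for i j
        using disj that by (auto simp: disjoint_family_on_def)
    qed (use A in auto)
    ultimately show ?case
      by (simp add: UB)
  qed
qed

lemma riemann_lebesgue_finite_measure:
  fixes A :: "real set"
  assumes A: "A \<in> sets borel" "emeasure lborel A < \<infinity>"
  shows "((\<lambda>R. sine_integral R A) \<longlongrightarrow> 0) at_top"
proof (rule tendstoI)
  fix e :: real assume "e > 0"
  have U: "(\<Union>n. A \<inter> {- real n..real n}) = A"
  proof (intro equalityI subsetI)
    fix r assume "r \<in> A"
    moreover obtain n where "\<bar>r\<bar> \<le> real n"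
      using real_arch_simple by blast
    ultimately show "r \<in> (\<Union>n. A \<inter> {- real n..real n})"
      by (intro UN_I[of n]) (auto simp: abs_le_iff)
  qed auto
  have "(\<lambda>n. measure lborel (A \<inter> {- real n..real n})) \<longlonglongrightarrow> measure lborel (\<Union>n. A \<inter> {- real n..real n})"
  proof (rule Lim_measure_incseq)
    show "emeasure lborel (\<Union>n. A \<inter> {- real n..real n}) \<noteq> \<infinity>"
      unfolding U using A(2) by simp
  qed (use A in \<open>auto simp: incseq_def\<close>)
  then have "eventually (\<lambda>n. dist (measure lborel (A \<inter> {- real n..real n})) (measure lborel A) < e / 2) sequentially"
    unfolding U using \<open>e > 0\<close> by (intro tendstoD) auto
  then obtain n where n: "dist (measure lborel (A \<inter> {- real n..real n})) (measure lborel A) < e / 2"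
    by (auto simp: eventually_sequentially)
  let ?B = "A \<inter> {- real n..real n}" and ?C = "A - {- real n..real n}"
  have fin: "emeasure lborel ?B < \<infinity>" "emeasure lborel ?C < \<infinity>"
    using A emeasure_mono[of ?B A lborel] emeasure_mono[of ?C A lborel] by (auto intro: order.strict_trans1)
  have "measure lborel (?B \<union> ?C) = measure lborel ?B + measure lborel ?C"
    using A fin by (intro measure_Union) auto
  moreover have BC: "?B \<union> ?C = A"
    by auto
  ultimately have C: "measure lborel ?C < e / 2"
    using n by (simp add: dist_real_def)
  have split: "sine_integral R A = sine_integral R ?B + sine_integral R ?C" for R
  proof -
    have "sine_integral R (?B \<union> ?C) = sine_integral R ?B + sine_integral R ?C"
      using A fin by (intro set_integral_Un set_integrable_sin) auto
    then show ?thesis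
      by (simp only: BC)
  qed
  have "eventually (\<lambda>R. dist (sine_integral R ?B) 0 < e / 2) at_top"
    using riemann_lebesgue_bounded[OF A(1)] \<open>e > 0\<close> by (intro tendstoD) auto
  then show "eventually (\<lambda>R. dist (sine_integral R A) 0 < e) at_top"
  proof eventually_elim
    case (elim R)
    have "\<bar>sine_integral R ?C\<bar> \<le> measure lborel ?C"
      using A fin by (intro LINT_sin_le_measure) auto
    then show ?case
      using elim C unfolding split by (simp add: dist_real_def)
  qed
qed

abbreviation (input) half_line :: "real measure" where
  "half_line \<equiv> restrict_space lborel {0<..}"

text \<open>
  For a simple function the integral is a finite combination of integrals of the sine over sets of
  finite measure, with coefficients at most twice the norms of the values. This bound does not depend
  on the functional.
\<close>

lemma simple_riemann_lebesgue:
  fixes s :: "real \<Rightarrow> 'a::complex_banach"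
  assumes s: "simple_integrable half_line s" and e: "e > 0"
  shows "eventually (\<lambda>R. \<forall>\<Phi>. complex_functional \<Phi> \<longrightarrow> norm (LINT r|half_line. sin (R * r) *\<^sub>R \<Phi> (s r)) \<le> e) at_top"
proof -
  have sf: "simple_function half_line s" and fin: "emeasure half_line {r \<in> space half_line. s r \<noteq> 0} \<noteq> \<infinity>"
    using s by (auto elim: Bochner_Integration.simple_bochner_integrable.cases)
  define Y where "Y = s ` {0<..} - {0}"
  define A where "A y = {r. 0 < r \<and> s r = y}" for y
  have Y: "finite Y"
    using simple_functionD(1)[OF sf] by (auto simp: Y_def space_restrict_space)
  have A_half: "A y \<in> sets half_line" for y
  proof -
    have "A y = s -` {y} \<inter> space half_line"
      by (auto simp: A_def space_restrict_space)
    then show ?thesis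
      using simple_functionD(2)[OF sf, of "{y}"] by simp
  qed
  then have A: "A y \<in> sets borel" for y
    by (auto simp: sets_restrict_space_iff)
  have A_fin: "emeasure lborel (A y) < \<infinity>" if "y \<in> Y" for y
  proof -
    have "emeasure lborel (A y) = emeasure half_line (A y)"
      by (subst emeasure_restrict_space) (auto simp: A_def)
    also have "\<dots> \<le> emeasure half_line {r \<in> space half_line. s r \<noteq> 0}"
      using that simple_functionD(2)[OF sf, of "- {0}"]
      by (intro emeasure_mono) (auto simp: A_def Y_def space_restrict_space vimage_def Int_def conj_commute)
    also have "\<dots> < \<infinity>"
      using fin by (simp add: less_top)
    finally show ?thesis .
  qed
  have eq: "(LINT r|half_line. sin (R * r) *\<^sub>R \<Phi> (s r)) = (\<Sum>y\<in>Y. sine_integral R (A y) *\<^sub>R \<Phi> y)"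
    if \<Phi>: "complex_functional \<Phi>" for R and \<Phi> :: "'a \<Rightarrow> complex"
  proof -
    interpret bounded_linear \<Phi>
      using \<Phi> by (rule complex_functional_bounded_linear)
    have pt: "indicator {0<..} r *\<^sub>R (sin (R * r) *\<^sub>R \<Phi> (s r)) = (\<Sum>y\<in>Y. (indicator (A y) r *\<^sub>R sin (R * r)) *\<^sub>R \<Phi> y)" for r
    proof (cases "0 < r \<and> s r \<noteq> 0")
      case True
      then have "(\<Sum>y\<in>Y. (indicator (A y) r *\<^sub>R sin (R * r)) *\<^sub>R \<Phi> y) =
          (\<Sum>y\<in>Y. if y = s r then sin (R * r) *\<^sub>R \<Phi> y else 0)"
        by (intro sum.cong) (auto simp: A_def)
      also have "\<dots> = sin (R * r) *\<^sub>R \<Phi> (s r)"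
        using Y True by (simp add: Y_def)
      finally show ?thesis
        using True by simp
    next
      case False
      then show ?thesis
        by (auto simp: A_def Y_def zero intro!: sum.neutral[symmetric])
    qed
    have "(LINT r|half_line. sin (R * r) *\<^sub>R \<Phi> (s r)) = (LINT r|lborel. (\<Sum>y\<in>Y. (indicator (A y) r *\<^sub>R sin (R * r)) *\<^sub>R \<Phi> y))"
      by (subst integral_restrict_space) (simp, simp only: pt)
    also have "\<dots> = (\<Sum>y\<in>Y. (LINT r|lborel. indicator (A y) r *\<^sub>R sin (R * r)) *\<^sub>R \<Phi> y)"
      using set_integrable_sin[OF A A_fin] by (subst Bochner_Integration.integral_sum) (auto simp: set_integrable_def)
    finally show ?thesis
      by (simp add: set_lebesgue_integral_def)
  qed
  have "((\<lambda>R. \<Sum>y\<in>Y. \<bar>sine_integral R (A y)\<bar> * (2 * norm y)) \<longlongrightarrow> (\<Sum>y\<in>Y. \<bar>0\<bar> * (2 * norm y))) at_top"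
    using riemann_lebesgue_finite_measure[OF A A_fin] by (intro tendsto_intros)
  then have "eventually (\<lambda>R. (\<Sum>y\<in>Y. \<bar>sine_integral R (A y)\<bar> * (2 * norm y)) < e) at_top"
    using e by (intro order_tendstoD(2)[where y = 0]) auto
  then show ?thesis
  proof eventually_elim
    case (elim R)
    have "norm (LINT r|half_line. sin (R * r) *\<^sub>R \<Phi> (s r)) \<le> e" if \<Phi>: "complex_functional \<Phi>" for \<Phi> :: "'a \<Rightarrow> complex"
    proof -
      have "norm (LINT r|half_line. sin (R * r) *\<^sub>R \<Phi> (s r)) \<le> (\<Sum>y\<in>Y. \<bar>sine_integral R (A y)\<bar> * (2 * norm y))"
        unfolding eq[OF \<Phi>] using \<Phi>
        by (intro sum_norm_le) (auto simp: complex_functional_def intro!: mult_left_mono)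
      then show ?thesis
        using elim by linarith
    qed
    then show ?case
      by blast
  qed
qed

text \<open>
  Total boundedness of a compact set of classes, expressed for representatives.
\<close>

lemma compact_in_L1_finite_net:
  assumes S: "compact_in_L1 M S" and e: "e > 0"
  obtains K where "finite K" "K \<subseteq> S" "S \<subseteq> L1_fun M"
    "\<And>g. g \<in> S \<Longrightarrow> \<exists>h\<in>K. L1_gap M g h < ennreal e"
proof -
  interpret Metric_space "L1 M" "L1_dist M"
    by (rule Metric_space_L1)
  have comp: "compactin mtopology (L1_class M ` S)"
    using S by (simp add: compact_in_L1_def L1_topology_def)
  have sub: "S \<subseteq> L1_fun M"
    using compactin_subset_topspace[OF comp] by (auto simp flip: L1_class_in_L1_iff)
  have "\<exists>K'. finite K' \<and> K' \<subseteq> L1_class M ` S \<and> L1_class M ` S \<subseteq> (\<Union>x\<in>K'. mball x e)"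
    using compactin_imp_mtotally_bounded[OF comp] e unfolding mtotally_bounded_def by simp
  then obtain K' where K': "finite K'" "K' \<subseteq> L1_class M ` S" "L1_class M ` S \<subseteq> (\<Union>x\<in>K'. mball x e)"
    by (elim exE conjE)
  obtain K where K: "K \<subseteq> S" "finite K" "K' = L1_class M ` K"
    using finite_subset_image[OF K'(1,2)] by blast
  show thesis
  proof
    fix g assume g: "g \<in> S"
    then obtain h where h: "h \<in> K" "L1_class M g \<in> mball (L1_class M h) e"
      using K'(3) K(3) by blast
    have gh: "g \<in> L1_fun M" "h \<in> L1_fun M"
      using g h K sub by auto
    have "L1_dist M (L1_class M g) (L1_class M h) < e"
      using h(2) by (simp add: commute)
    then have "enn2real (L1_gap M g h) < e"
      using gh by (simp add: L1_dist_class)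
    then have "ennreal (enn2real (L1_gap M g h)) < ennreal e"
      using e by (intro ennreal_lessI)
    then have "L1_gap M g h < ennreal e"
      using L1_dist_finite[OF gh] by simp
    then show "\<exists>h\<in>K. L1_gap M g h < ennreal e"
      using h(1) by blast
  qed (use K sub in auto)
qed

text \<open>
  Each function of the compact set is close in mean to one of finitely many simple functions, and
  oscillation kills those finitely many at once.
\<close>

lemma uniform_riemann_lebesgue:
  fixes S :: "(real \<Rightarrow> 'a::complex_banach) set"
  assumes S: "compact_in_L1 half_line S"
    and meas: "\<And>g \<Phi>. g \<in> S \<Longrightarrow> complex_functional \<Phi> \<Longrightarrow> (\<lambda>r. \<Phi> (g r)) \<in> borel_measurable half_line"
    and e: "e > 0"
  shows "eventually (\<lambda>R. \<forall>g\<in>S. \<forall>\<Phi>. complex_functional \<Phi> \<longrightarrow> norm (LINT r|half_line. sin (R * r) *\<^sub>R \<Phi> (g r)) \<le> e) at_top"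
proof -
  have "e / 8 > 0"
    using e by simp
  (* two gaps of size e / 8 and the bound 2 of the functional amount to e / 2 *)
  from compact_in_L1_finite_net[OF S this]
  obtain K where K: "finite K" "K \<subseteq> S" and sub: "S \<subseteq> L1_fun half_line"
    and net: "\<And>g. g \<in> S \<Longrightarrow> \<exists>h\<in>K. L1_gap half_line g h < ennreal (e / 8)"
    by blast
  have "\<exists>s. simple_integrable half_line s \<and>
      L1_gap half_line h s < ennreal (e / 8)" if "h \<in> K" for h
  proof -
    have "h \<in> L1_fun half_line"
      using that K sub by auto
    then obtain s where s: "\<And>i::nat. simple_integrable half_line (s i)"
      "(\<lambda>i. L1_gap half_line h (s i)) \<longlonglongrightarrow> 0"
      using L1_fun_simple_approximation by blast
    have "eventually (\<lambda>i. L1_gap half_line h (s i) < ennreal (e / 8)) sequentially"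
      using e by (intro order_tendstoD(2)[OF s(2)]) auto
    then show ?thesis
      using s(1) by (auto simp: eventually_sequentially)
  qed
  then obtain s where s: "\<And>h. h \<in> K \<Longrightarrow> simple_integrable half_line (s h)"
    "\<And>h. h \<in> K \<Longrightarrow> (L1_gap half_line h (s h)) < ennreal (e / 8)"
    by metis
  have "eventually (\<lambda>R. \<forall>h\<in>K. \<forall>\<Phi>. complex_functional \<Phi> \<longrightarrow> norm (LINT r|half_line. sin (R * r) *\<^sub>R \<Phi> (s h r)) \<le> e / 2) at_top"
    using K(1) s(1) e by (intro eventually_ball_finite ballI simple_riemann_lebesgue) auto
  then show ?thesis
  proof eventually_elim
    case (elim R)
    have "norm (LINT r|half_line. sin (R * r) *\<^sub>R \<Phi> (g r)) \<le> e" if g: "g \<in> S" and \<Phi>: "complex_functional \<Phi>" for g \<Phi>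
    proof -
      interpret bounded_linear \<Phi>
        using \<Phi> by (rule complex_functional_bounded_linear)
      obtain h where h: "h \<in> K" "L1_gap half_line g h < ennreal (e / 8)"
        using net[OF g] by blast
      have sh: "simple_function half_line (s h)"
        using s(1)[OF h(1)] by (auto elim: Bochner_Integration.simple_bochner_integrable.cases)
      have gL: "g \<in> L1_fun half_line" and hL: "h \<in> L1_fun half_line"
        using g h K sub by auto
      have "L1_gap half_line g (s h) \<le>
          L1_gap half_line g h + L1_gap half_line h (s h)"
        using gL hL sh by (intro nn_integral_norm_diff_triangle) (auto simp: L1_fun_def simple_function_imp_strongly_measurable)
      also have "\<dots> \<le> ennreal (e / 8) + ennreal (e / 8)"
        using h(2) s(2)[OF h(1)] by (intro add_mono less_imp_le)
      also have "\<dots> = ennreal (e / 4)"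
        using e by (simp flip: ennreal_plus)
      finally have close: "L1_gap half_line g (s h) \<le> ennreal (e / 4)" .
      have sm: "(\<lambda>r. \<Phi> (s h r)) \<in> borel_measurable half_line"
        using simple_function_compose1[OF sh, of \<Phi>] by (rule borel_measurable_simple_function)
      have sin_m: "(\<lambda>r. sin (R * r)) \<in> borel_measurable half_line"
        by (intro measurable_restrict_space1) measurable
      have si: "integrable half_line (\<lambda>r. sin (R * r) *\<^sub>R \<Phi> (s h r))"
      proof (rule Bochner_Integration.integrable_bound)
        show "integrable half_line (\<lambda>r. \<Phi> (s h r))"
          using simple_bochner_integrable_compose2[of "\<lambda>a b. \<Phi> a", OF _ s(1)[OF h(1)] s(1)[OF h(1)]]
          by (intro integrableI_simple_bochner_integrable) (simp add: zero)
        show "AE r in half_line. norm (sin (R * r) *\<^sub>R \<Phi> (s h r)) \<le> norm (\<Phi> (s h r))"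
          by (intro AE_I2) (simp only: norm_scaleR, intro mult_left_le_one_le, auto)
      qed (use sin_m sm in \<open>intro borel_measurable_scaleR\<close>)
      let ?d = "\<lambda>r. sin (R * r) *\<^sub>R (\<Phi> (g r) - \<Phi> (s h r))"
      have dm: "?d \<in> borel_measurable half_line"
        using sin_m sm meas[OF g \<Phi>] by (intro borel_measurable_scaleR borel_measurable_diff)
      have "norm (?d r) / 2 \<le> norm (g r - s h r)" for r
      proof -
        have "norm (?d r) \<le> norm (\<Phi> (g r - s h r))"
          by (simp only: norm_scaleR diff) (intro mult_left_le_one_le, auto)
        also have "\<dots> \<le> 2 * norm (g r - s h r)"
          using \<Phi> by (simp add: complex_functional_def)
        finally show ?thesis
          by simp
      qed
      then have "(\<integral>\<^sup>+r. ennreal (norm (?d r) / 2) \<partial>half_line) \<le> ennreal (e / 4)"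
        by (intro order_trans[OF nn_integral_mono close] ennreal_leI)
      then have "2 * (\<integral>\<^sup>+r. ennreal (norm (?d r) / 2) \<partial>half_line) \<le> 2 * ennreal (e / 4)"
        by (rule mult_left_mono) simp
      also have "2 * ennreal (e / 4) = ennreal (2 * (e / 4))"
        using e by (simp only: ennreal_mult' ennreal_numeral)
      also have "2 * (\<integral>\<^sup>+r. ennreal (norm (?d r) / 2) \<partial>half_line) = (\<integral>\<^sup>+r. 2 * ennreal (norm (?d r) / 2) \<partial>half_line)"
        using measurable_compose[OF dm borel_measurable_norm] by (intro nn_integral_cmult[symmetric] measurable_compose[OF _ measurable_ennreal] borel_measurable_divide) simp_all
      also have "\<dots> = (\<integral>\<^sup>+r. ennreal (norm (?d r)) \<partial>half_line)"
        by (intro nn_integral_cong) (simp flip: ennreal_numeral ennreal_mult')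
      finally have le: "(\<integral>\<^sup>+r. ennreal (norm (?d r)) \<partial>half_line) \<le> ennreal (e / 2)"
        by simp
      then have di: "integrable half_line ?d"
        by (intro integrableI_bounded dm) (auto intro: order.strict_trans1)
      have "ennreal (norm (LINT r|half_line. ?d r)) \<le> ennreal (e / 2)"
        using integral_norm_bound_ennreal[OF di] le by (rule order_trans)
      then have dn: "norm (LINT r|half_line. ?d r) \<le> e / 2"
        using e by (simp add: ennreal_le_iff)
      have "(LINT r|half_line. sin (R * r) *\<^sub>R \<Phi> (g r)) = (LINT r|half_line. sin (R * r) *\<^sub>R \<Phi> (s h r) + ?d r)"
        by (intro Bochner_Integration.integral_cong) (simp_all add: algebra_simps)
      also have "\<dots> = (LINT r|half_line. sin (R * r) *\<^sub>R \<Phi> (s h r)) + (LINT r|half_line. ?d r)"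
        using si di by (rule Bochner_Integration.integral_add)
      finally show ?thesis
        using elim h(1) \<Phi> dn norm_triangle_ineq[of "LINT r|half_line. sin (R * r) *\<^sub>R \<Phi> (s h r)" "LINT r|half_line. ?d r"]
        by fastforce
    qed
    then show ?case
      by blast
  qed
qed

section \<open>Partial sums as radial integrals\<close>

lemma bounded_bilinear_scaleC: "bounded_bilinear (scaleC :: complex \<Rightarrow> 'a::complex_banach \<Rightarrow> 'a)"
proof
  show "\<exists>K. \<forall>a (b::'a). norm (a *\<^sub>C b) \<le> norm a * norm b * K"
    by (intro exI[of _ 1]) (simp add: norm_scaleC)
qed (simp_all add: scaleC_add_left scaleC_add_right scaleC_scaleC scaleR_conv_of_real mult_ac flip: scaleC_of_real)

lemma continuous_on_scaleC [continuous_intros]: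
  "continuous_on S f \<Longrightarrow> continuous_on S g \<Longrightarrow> continuous_on S (\<lambda>x. f x *\<^sub>C (g x :: 'a::complex_banach))"
  by (rule bounded_bilinear.continuous_on[OF bounded_bilinear_scaleC])

lemma measure_sphere: "measure sphere_measure (sphere 0 1 :: 'a::euclidean_space set) = DIM('a) * unit_ball_vol DIM('a)"
proof -
  have "emeasure lborel {x::'a. x \<noteq> 0 \<and> x /\<^sub>R norm x \<in> sphere 0 1 \<and> norm x < 1} = emeasure lborel (ball (0::'a) 1 - {0})"
    by (intro arg_cong[where f = "emeasure lborel"]) auto
  also have "\<dots> = emeasure lborel (ball (0::'a) 1)"
    by (intro emeasure_Diff_null_set) auto
  also have "\<dots> = ennreal (unit_ball_vol DIM('a))"
    by (simp add: emeasure_ball)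
  finally have "emeasure sphere_measure (sphere 0 1 :: 'a set) = ennreal (DIM('a) * unit_ball_vol DIM('a))"
    using emeasure_scaled_cone[of "sphere 0 1 :: 'a set" 1]
    by (simp add: ennreal_of_nat_eq_real_of_nat ennreal_mult')
  then show ?thesis
    by (simp add: measure_def)
qed

lemma L1_fun_lborel_integrable_norm:
  fixes F :: "'a::euclidean_space \<Rightarrow> 'b::banach"
  assumes F: "F \<in> L1_fun lborel" and c: "continuous_on UNIV F"
  shows "integrable lborel (\<lambda>s. norm (F s))"
proof (rule integrableI_bounded)
  show "(\<lambda>s. norm (F s)) \<in> borel_measurable lborel"
    using c by (simp add: borel_measurable_continuous_onI continuous_on_norm)
  show "(\<integral>\<^sup>+s. ennreal (norm (norm (F s))) \<partial>lborel) < \<infinity>"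
    using F by (simp add: L1_fun_def)
qed

lemma cis_times_L1_fun:
  fixes F :: "'a::euclidean_space \<Rightarrow> 'b::complex_banach"
  assumes F: "F \<in> L1_fun lborel" and c: "continuous_on UNIV F"
  shows "(\<lambda>s. cis (- (\<xi> \<bullet> s)) *\<^sub>C F s) \<in> L1_fun lborel"
proof -
  have "strongly_measurable lborel (\<lambda>s. cis (- (\<xi> \<bullet> s)) *\<^sub>C F s)"
    by (rule continuous_imp_strongly_measurable[where g = "\<lambda>x. x"]) (auto intro!: continuous_intros c)
  then show ?thesis
    using F by (simp add: L1_fun_def norm_scaleC)
qed

lemma fourier_eq_cis: "fourier F \<xi> = banach_integral lborel (\<lambda>s. cis (- (\<xi> \<bullet> s)) *\<^sub>C F s)"
  by (simp add: fourier_def cis_conv_exp)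

lemma complex_functional_fourier:
  fixes F :: "'a::euclidean_space \<Rightarrow> 'b::complex_banach"
  assumes \<Phi>: "complex_functional \<Phi>" and F: "F \<in> L1_fun lborel" and c: "continuous_on UNIV F"
  shows "integrable lborel (\<lambda>s. cis (- (\<xi> \<bullet> s)) * \<Phi> (F s))"
    and "\<Phi> (fourier F \<xi>) = (\<integral>s. cis (- (\<xi> \<bullet> s)) * \<Phi> (F s) \<partial>lborel)"
proof -
  interpret bounded_linear \<Phi>
    using \<Phi> by (rule complex_functional_bounded_linear)
  have mult: "\<Phi> (a *\<^sub>C v) = a * \<Phi> v" for a v
    using \<Phi> by (simp add: complex_functional_def)
  have m: "(\<lambda>s. \<Phi> (cis (- (\<xi> \<bullet> s)) *\<^sub>C F s)) \<in> borel_measurable lborel"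
    by (simp add: borel_measurable_continuous_onI continuous_on continuous_on_scaleC c continuous_intros)
  show "integrable lborel (\<lambda>s. cis (- (\<xi> \<bullet> s)) * \<Phi> (F s))"
    using complex_functional_integrable[OF \<Phi> cis_times_L1_fun[OF F c] m] by (simp add: mult)
  show "\<Phi> (fourier F \<xi>) = (\<integral>s. cis (- (\<xi> \<bullet> s)) * \<Phi> (F s) \<partial>lborel)"
    using complex_functional_banach_integral[OF \<Phi> cis_times_L1_fun[OF F c] m] by (simp add: mult fourier_eq_cis)
qed

lemma isCont_cis: "isCont cis t"
proof -
  have "continuous_on UNIV cis"
    by (intro continuous_intros)
  then show ?thesis
    by (simp add: continuous_on_eq_continuous_at)
qed

text \<open>
  For a fixed norming functional the difference of two values is bounded by an integral that does not
  involve the functional; dominated convergence applies to that integral.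
\<close>

lemma continuous_on_fourier:
  fixes F :: "'a::euclidean_space \<Rightarrow> 'b::complex_banach"
  assumes F: "F \<in> L1_fun lborel" and c: "continuous_on UNIV F"
  shows "continuous_on UNIV (fourier F)"
proof -
  have "isCont (fourier F) \<xi>" for \<xi>
    unfolding continuous_at_sequentially comp_def
  proof (intro allI impI)
    fix X :: "nat \<Rightarrow> 'a" assume X: "X \<longlonglongrightarrow> \<xi>"
    (* the factor 2 is the bound of the norming functionals, which vary with n *)
    define D where "D n s = cmod (cis (- (X n \<bullet> s)) - cis (- (\<xi> \<bullet> s))) * (2 * norm (F s))" for n s
    have Dm: "D n \<in> borel_measurable lborel" for n
      unfolding D_def[abs_def] using c by (simp add: borel_measurable_continuous_onI continuous_intros)
    have bound: "D n s \<le> 4 * norm (F s)" for n s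
    proof -
      have "cmod (cis (- (X n \<bullet> s)) - cis (- (\<xi> \<bullet> s))) \<le> 2"
        using norm_triangle_ineq4[of "cis (- (X n \<bullet> s))" "cis (- (\<xi> \<bullet> s))"] by simp
      from mult_right_mono[OF this, of "2 * norm (F s)"] show ?thesis
        by (simp add: D_def)
    qed
    have dom: "integrable lborel (\<lambda>s. 4 * norm (F s))"
      using L1_fun_lborel_integrable_norm[OF F c] by simp
    have lim: "(\<lambda>n. \<integral>s. D n s \<partial>lborel) \<longlonglongrightarrow> integral\<^sup>L lborel (\<lambda>s::'a. 0)"
    proof (rule integral_dominated_convergence[OF _ Dm dom])
      show "AE s in lborel. (\<lambda>n. D n s) \<longlonglongrightarrow> 0"
      proof (rule AE_I2)
        fix s
        have "(\<lambda>n. D n s) \<longlonglongrightarrow> cmod (cis (- (\<xi> \<bullet> s)) - cis (- (\<xi> \<bullet> s))) * (2 * norm (F s))"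
          unfolding D_def using X by (intro tendsto_intros isCont_tendsto_compose[OF isCont_cis])
        then show "(\<lambda>n. D n s) \<longlonglongrightarrow> 0"
          by simp
      qed
      show "AE s in lborel. norm (D n s) \<le> 4 * norm (F s)" for n
        using bound by (intro AE_I2) (simp add: D_def)
    qed simp
    have "norm (fourier F (X n) - fourier F \<xi>) \<le> (\<integral>s. D n s \<partial>lborel)" for n
    proof -
      obtain \<Phi> :: "'b \<Rightarrow> complex" where \<Phi>: "complex_functional \<Phi>"
        and le: "norm (fourier F (X n) - fourier F \<xi>) \<le> cmod (\<Phi> (fourier F (X n) - fourier F \<xi>))"
        by (rule norming_complex_functional)
      interpret bounded_linear \<Phi>
        using \<Phi> by (rule complex_functional_bounded_linear)
      note int = complex_functional_fourier(1)[OF \<Phi> F c]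
      have "\<Phi> (fourier F (X n) - fourier F \<xi>) = (\<integral>s. cis (- (X n \<bullet> s)) * \<Phi> (F s) - cis (- (\<xi> \<bullet> s)) * \<Phi> (F s) \<partial>lborel)"
        using int by (simp add: diff complex_functional_fourier(2)[OF \<Phi> F c])
      also have "cmod \<dots> \<le> (\<integral>s. D n s \<partial>lborel)"
      proof (rule Bochner_Integration.integral_norm_bound_integral)
        show "integrable lborel (D n)"
          by (rule Bochner_Integration.integrable_bound[OF dom Dm]) (use bound in \<open>auto simp: D_def\<close>)
        show "cmod (cis (- (X n \<bullet> s)) * \<Phi> (F s) - cis (- (\<xi> \<bullet> s)) * \<Phi> (F s)) \<le> D n s" for s
        proof -
          have "cmod (\<Phi> (F s)) \<le> 2 * norm (F s)"
            using \<Phi> by (simp add: complex_functional_def)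
          then show ?thesis
            by (simp add: D_def norm_mult mult_left_mono flip: left_diff_distrib)
        qed
      qed (use int in simp)
      finally show ?thesis
        using le by simp
    qed
    then have "eventually (\<lambda>n. norm (fourier F (X n) - fourier F \<xi>) \<le> (\<integral>s. D n s \<partial>lborel)) sequentially"
      by (intro always_eventually allI)
    moreover have "(\<lambda>n. \<integral>s. D n s \<partial>lborel) \<longlonglongrightarrow> 0"
      using lim by simp
    ultimately have "(\<lambda>n. fourier F (X n) - fourier F \<xi>) \<longlonglongrightarrow> 0"
      by (rule Lim_null_comparison)
    then show "(\<lambda>n. fourier F (X n)) \<longlonglongrightarrow> fourier F \<xi>"
      by (simp add: LIM_zero_iff)
  qed
  then show ?thesis
    by (simp add: continuous_on_eq_continuous_at)
qed

lemma complex_functional_partial_sum: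
  fixes F :: "'a::euclidean_space \<Rightarrow> 'b::complex_banach"
  assumes \<Phi>: "complex_functional \<Phi>" and F: "F \<in> L1_fun lborel" and c: "continuous_on UNIV F"
  shows "\<Phi> (partial_sum R F x) = (1 / (2 * pi) ^ DIM('a)) *\<^sub>R
    (\<integral>\<xi>. indicator (cball 0 R) \<xi> *\<^sub>R (cis (x \<bullet> \<xi>) * (\<integral>s. cis (- (\<xi> \<bullet> s)) * \<Phi> (F s) \<partial>lborel)) \<partial>lborel)"
proof -
  let ?M = "restrict_space lborel (cball (0::'a) R)"
  let ?g = "\<lambda>\<xi>. cis (x \<bullet> \<xi>) *\<^sub>C fourier F \<xi>"
  interpret bounded_linear \<Phi>
    using \<Phi> by (rule complex_functional_bounded_linear)
  have gc: "continuous_on UNIV ?g"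
    by (intro continuous_intros continuous_on_fourier F c)
  have id: "(\<lambda>\<xi>. \<xi>) \<in> borel_measurable ?M"
    by (intro measurable_restrict_space1) simp
  have "finite_measure ?M"
    using emeasure_bounded_finite[of "cball (0::'a) R"]
    by (intro finite_measureI) (auto simp: space_restrict_space emeasure_restrict_space)
  then have gL: "?g \<in> L1_fun ?M"
    using id gc by (intro L1_fun_finite_measure_compact[where C = "cball 0 R"]) (auto simp: space_restrict_space)
  have gm: "(\<lambda>\<xi>. \<Phi> (?g \<xi>)) \<in> borel_measurable ?M"
    using measurable_compose[OF id borel_measurable_continuous_onI[OF continuous_on[OF gc]]] .
  have "\<Phi> (banach_integral ?M ?g) = (\<integral>\<xi>. \<Phi> (?g \<xi>) \<partial>?M)"
    using \<Phi> gL gm by (rule complex_functional_banach_integral)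
  also have "\<dots> = (\<integral>\<xi>. indicator (cball 0 R) \<xi> *\<^sub>R \<Phi> (?g \<xi>) \<partial>lborel)"
    by (subst integral_restrict_space) auto
  finally have "\<Phi> (banach_integral ?M ?g) = (\<integral>\<xi>. indicator (cball 0 R) \<xi> *\<^sub>R \<Phi> (?g \<xi>) \<partial>lborel)" .
  moreover have "\<Phi> (?g \<xi>) = cis (x \<bullet> \<xi>) * (\<integral>s. cis (- (\<xi> \<bullet> s)) * \<Phi> (F s) \<partial>lborel)" for \<xi>
    using \<Phi> complex_functional_fourier(2)[OF \<Phi> F c] by (simp add: complex_functional_def)
  ultimately show ?thesis
    by (simp add: partial_sum_def scaleR cis_conv_exp)
qed

text \<open>
  The order of integration may be exchanged because the frequencies are restricted to a set of finite
  measure; the inner integral is then the Fourier transform of the ball.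
\<close>

lemma fubini_cball:
  fixes h :: "'a::euclidean_space \<Rightarrow> complex"
  assumes h: "integrable lborel h"
  shows "(\<integral>\<xi>. indicator (cball 0 R) \<xi> *\<^sub>R (cis (x \<bullet> \<xi>) * (\<integral>s. cis (- (\<xi> \<bullet> s)) * h s \<partial>lborel)) \<partial>lborel) =
    (\<integral>s. (\<integral>\<xi>. indicator (cball 0 R) \<xi> *\<^sub>R cis ((x - s) \<bullet> \<xi>) \<partial>lborel) * h s \<partial>lborel)"
proof -
  have [measurable]: "h \<in> borel_measurable borel"
    using h by simp
  have cis_m [measurable]: "(cis :: real \<Rightarrow> complex) \<in> borel_measurable borel"
    by (intro borel_measurable_continuous_onI continuous_intros)
  have B [measurable]: "cball (0::'a) R \<in> sets borel"
    by simp
  have fin: "integrable lborel (indicator (cball (0::'a) R) :: 'a \<Rightarrow> real)"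
    using emeasure_bounded_finite[of "cball (0::'a) R"] by (intro integrable_real_indicator) auto
  define I where "I = (indicator (cball 0 R) :: 'a \<Rightarrow> real)"
  have [measurable]: "I \<in> borel_measurable borel"
    unfolding I_def by simp
  let ?f = "\<lambda>(\<xi>, s). I \<xi> *\<^sub>R (cis ((x - s) \<bullet> \<xi>) * h s)"
  have fm: "?f \<in> borel_measurable (lborel \<Otimes>\<^sub>M lborel)"
    by measurable
  have int: "integrable (lborel \<Otimes>\<^sub>M lborel) ?f"
  proof (rule lborel_pair.Fubini_integrable[OF fm])
    have "(\<lambda>\<xi>. \<integral>s. norm (?f (\<xi>, s)) \<partial>lborel) = (\<lambda>\<xi>. I \<xi> * (\<integral>s. norm (h s) \<partial>lborel))"
      by (simp add: norm_mult I_def fun_eq_iff)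
    then show "integrable lborel (\<lambda>\<xi>. \<integral>s. norm (?f (\<xi>, s)) \<partial>lborel)"
      using fin by (simp add: I_def)
    show "AE \<xi> in lborel. integrable lborel (\<lambda>s. ?f (\<xi>, s))"
    proof (intro AE_I2)
      fix \<xi>
      show "integrable lborel (\<lambda>s. ?f (\<xi>, s))"
        by (rule Bochner_Integration.integrable_bound[OF h]) (auto simp: I_def norm_mult indicator_def)
    qed
  qed
  have "(\<integral>\<xi>. I \<xi> *\<^sub>R (cis (x \<bullet> \<xi>) * (\<integral>s. cis (- (\<xi> \<bullet> s)) * h s \<partial>lborel)) \<partial>lborel) = (\<integral>\<xi>. (\<integral>s. ?f (\<xi>, s) \<partial>lborel) \<partial>lborel)"
  proof (rule Bochner_Integration.integral_cong[OF refl])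
    fix \<xi>
    have "cis ((x - s) \<bullet> \<xi>) * h s = cis (x \<bullet> \<xi>) * (cis (- (\<xi> \<bullet> s)) * h s)" for s
      by (simp add: cis_mult inner_diff_left inner_diff_right inner_commute flip: mult.assoc)
    then have "(\<integral>s. ?f (\<xi>, s) \<partial>lborel) = (\<integral>s. I \<xi> *\<^sub>R (cis (x \<bullet> \<xi>) * (cis (- (\<xi> \<bullet> s)) * h s)) \<partial>lborel)"
      by (simp only: prod.case)
    then show "I \<xi> *\<^sub>R (cis (x \<bullet> \<xi>) * (\<integral>s. cis (- (\<xi> \<bullet> s)) * h s \<partial>lborel)) = (\<integral>s. ?f (\<xi>, s) \<partial>lborel)"
      by (simp only: integral_scaleR_right integral_mult_right_zero)
  qed
  also have "\<dots> = (\<integral>s. (\<integral>\<xi>. ?f (\<xi>, s) \<partial>lborel) \<partial>lborel)"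
    using lborel_pair.Fubini_integral[OF int] by simp
  also have "\<dots> = (\<integral>s. (\<integral>\<xi>. I \<xi> *\<^sub>R cis ((x - s) \<bullet> \<xi>) \<partial>lborel) * h s \<partial>lborel)"
    by (simp only: prod.case mult_scaleR_left[symmetric] integral_mult_left_zero)
  finally show ?thesis
    by (simp add: I_def)
qed

text \<open>
  The partial sum is the convolution of \<open>F\<close> with the radial kernel of \<open>fourier_cball\<close>. In polar
  coordinates around \<open>x\<close> the kernel is constant on spheres, so only the spherical mean of \<open>F\<close> remains.
\<close>

lemma
  fixes F :: "real ^ 'n \<Rightarrow> 'b::complex_banach"
  assumes n: "CARD('n) = 2 * k + 1" and R: "R > 0"
    and \<Phi>: "complex_functional \<Phi>" and F: "F \<in> L1_fun lborel" and c: "continuous_on UNIV F"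
  shows set_integrable_odd_ball_kernel_spherical_mean:
      "set_integrable lborel {0<..} (\<lambda>r. r ^ (2 * k) *\<^sub>R (odd_ball_kernel R k r * \<Phi> (spherical_mean F x r)))"
    and complex_functional_partial_sum_radial: "\<Phi> (partial_sum R F x) =
      (unit_ball_vol (real (2 * k)) * (real (2 * k + 1) * unit_ball_vol (real (2 * k + 1))) / (2 * pi) ^ (2 * k + 1)) *\<^sub>R
      (LINT r:{0<..}|lborel. r ^ (2 * k) *\<^sub>R (odd_ball_kernel R k r * \<Phi> (spherical_mean F x r)))"
proof -
  interpret bounded_linear \<Phi>
    using \<Phi> by (rule complex_functional_bounded_linear)
  let ?K = "odd_ball_kernel R k"
  define S where "S = measure sphere_measure (sphere 0 1 :: (real ^ 'n) set)"
  have S: "S = real (2 * k + 1) * unit_ball_vol (real (2 * k + 1))"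
    by (simp add: S_def measure_sphere n)
  have S0: "S > 0"
    unfolding S using unit_ball_vol_pos[of "real (2 * k + 1)"] by (intro mult_pos_pos) auto
  have hc: "continuous_on UNIV (\<lambda>s. \<Phi> (F s))"
    by (rule continuous_on[OF c])
  have h: "integrable lborel (\<lambda>s. \<Phi> (F s))"
    using hc F by (intro complex_functional_integrable[OF \<Phi>]) (auto simp: borel_measurable_continuous_onI)
  have shift: "distr lborel borel ((+) x) = lborel"
    by (rule lborel_distr_plus)
  have h': "integrable lborel (\<lambda>y. \<Phi> (F (x + y)))"
    using h integrable_distr_eq[of "(+) x" lborel borel "\<lambda>s. \<Phi> (F s)"] borel_measurable_continuous_onI[OF hc] by (simp add: shift)
  let ?f = "\<lambda>y. ?K (norm y) * \<Phi> (F (x + y))"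
  have Kc: "continuous_on UNIV (\<lambda>y::real ^ 'n. ?K (norm y))"
    using R by (intro continuous_on_compose2[OF continuous_on_odd_ball_kernel[of R UNIV]] continuous_intros) auto
  have fi: "integrable lborel ?f"
  proof (rule Bochner_Integration.integrable_bound)
    let ?C = "integral {-R..R} (\<lambda>t. \<bar>R\<^sup>2 - t\<^sup>2\<bar> ^ k)"
    show "integrable lborel (\<lambda>y. of_real ?C * \<Phi> (F (x + y)))"
      using h' by simp
    have "continuous_on UNIV ?f"
      by (intro continuous_intros Kc continuous_on continuous_on_compose2[OF c]) auto
    then show "?f \<in> borel_measurable lborel"
      by (simp add: borel_measurable_continuous_onI)
    have "norm (?K (norm y)) \<le> \<bar>?C\<bar>" for y :: "real ^ 'n"
      using odd_ball_kernel_bounded[of R k "norm y"] R by linarith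
    then show "AE y in lborel. norm (?f y) \<le> norm (of_real ?C * \<Phi> (F (x + y)))"
      by (intro AE_I2) (simp add: norm_mult mult_right_mono)
  qed
  have mean: "(\<integral>\<omega>. ?f (r *\<^sub>R \<omega>) \<partial>sphere_measure) = S *\<^sub>R (?K r * \<Phi> (spherical_mean F x r))" if r: "r > 0" for r
  proof -
    have Fc: "continuous_on UNIV (\<lambda>\<omega>. F (x + r *\<^sub>R \<omega>))"
      by (intro continuous_on_compose2[OF c] continuous_intros) auto
    have "(\<integral>\<omega>. ?f (r *\<^sub>R \<omega>) \<partial>sphere_measure) = (\<integral>\<omega>. ?K r * \<Phi> (F (x + r *\<^sub>R \<omega>)) \<partial>sphere_measure)"
      using r by (intro Bochner_Integration.integral_cong[OF refl]) (simp add: space_sphere_measure)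
    also have "\<dots> = ?K r * (\<integral>\<omega>. \<Phi> (F (x + r *\<^sub>R \<omega>)) \<partial>sphere_measure)"
      by simp
    also have "(\<integral>\<omega>. \<Phi> (F (x + r *\<^sub>R \<omega>)) \<partial>sphere_measure) = \<Phi> (sphere_integral (\<lambda>\<omega>. F (x + r *\<^sub>R \<omega>)))"
      using complex_functional_banach_integral[OF \<Phi> L1_fun_sphere_measure[OF Fc] borel_measurable_sphere_measure[OF continuous_on[OF Fc]]] by simp
    also have "sphere_integral (\<lambda>\<omega>. F (x + r *\<^sub>R \<omega>)) = S *\<^sub>R spherical_mean F x r"
      using S0 by (simp add: spherical_mean_def S_def)
    finally show ?thesis
      by (simp add: scaleR)
  qed
  have dim: "DIM(real ^ 'n) - 1 = 2 * k"
    by (simp add: n)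
  have cong: "r ^ (DIM(real ^ 'n) - 1) *\<^sub>R (\<integral>\<omega>. ?f (r *\<^sub>R \<omega>) \<partial>sphere_measure) =
      S *\<^sub>R (r ^ (2 * k) *\<^sub>R (?K r * \<Phi> (spherical_mean F x r)))" if "r \<in> {0<..}" for r
    using mean[of r] that unfolding dim by (simp add: mult.commute)
  have "set_integrable lborel {0<..} (\<lambda>r. S *\<^sub>R (r ^ (2 * k) *\<^sub>R (?K r * \<Phi> (spherical_mean F x r))))"
    using integrable_polar[OF fi] cong by (subst set_integrable_cong[OF refl refl cong[symmetric]]) auto
  from set_integrable_scaleR_right[OF this, of "1 / S"]
  show "set_integrable lborel {0<..} (\<lambda>r. r ^ (2 * k) *\<^sub>R (?K r * \<Phi> (spherical_mean F x r)))"
    using S0 by simp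
  have "(\<integral>y. ?f y \<partial>lborel) = (LINT r:{0<..}|lborel. S *\<^sub>R (r ^ (2 * k) *\<^sub>R (?K r * \<Phi> (spherical_mean F x r))))"
    unfolding integral_polar[OF fi] by (intro set_lebesgue_integral_cong) (simp, intro allI impI, rule cong)
  then have polar: "(\<integral>y. ?f y \<partial>lborel) = S *\<^sub>R (LINT r:{0<..}|lborel. r ^ (2 * k) *\<^sub>R (?K r * \<Phi> (spherical_mean F x r)))"
    by (simp only: set_integral_scaleR_right)
  have "\<Phi> (partial_sum R F x) = (1 / (2 * pi) ^ (2 * k + 1)) *\<^sub>R
      (\<integral>s. (unit_ball_vol (real (2 * k)) *\<^sub>R ?K (norm (x - s))) * \<Phi> (F s) \<partial>lborel)"
    unfolding complex_functional_partial_sum[OF \<Phi> F c] fubini_cball[OF h] fourier_cball[OF n R] by (simp add: n)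
  also have "(\<integral>s. (unit_ball_vol (real (2 * k)) *\<^sub>R ?K (norm (x - s))) * \<Phi> (F s) \<partial>lborel) =
      unit_ball_vol (real (2 * k)) *\<^sub>R (\<integral>s. ?K (norm (x - s)) * \<Phi> (F s) \<partial>lborel)"
    by (simp only: mult_scaleR_left integral_scaleR_right)
  also have "(\<integral>s. ?K (norm (x - s)) * \<Phi> (F s) \<partial>lborel) = (\<integral>s. ?K (norm (x - s)) * \<Phi> (F s) \<partial>distr lborel borel ((+) x))"
    by (simp only: shift)
  also have "\<dots> = (\<integral>y. ?K (norm (x - (x + y))) * \<Phi> (F (x + y)) \<partial>lborel)"
  proof (rule integral_distr)
    have "continuous_on UNIV (\<lambda>s. ?K (norm (x - s)) * \<Phi> (F s))"
      by (intro continuous_intros hc continuous_on_compose2[OF continuous_on_odd_ball_kernel[of R UNIV]]) (use R in auto)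
    then show "(\<lambda>s. ?K (norm (x - s)) * \<Phi> (F s)) \<in> borel_measurable borel"
      by (rule borel_measurable_continuous_onI)
  qed simp
  also have "\<dots> = (\<integral>y. ?f y \<partial>lborel)"
    by simp
  finally show "\<Phi> (partial_sum R F x) =
      (unit_ball_vol (real (2 * k)) * (real (2 * k + 1) * unit_ball_vol (real (2 * k + 1))) / (2 * pi) ^ (2 * k + 1)) *\<^sub>R
      (LINT r:{0<..}|lborel. r ^ (2 * k) *\<^sub>R (?K r * \<Phi> (spherical_mean F x r)))"
    unfolding polar S by (simp add: mult_ac)
qed

lemma prod_even_reverse: "(\<Prod>i<k. 2 * real (k - i)) = 2 ^ k * fact k"
proof -
  have "(\<Prod>i<k. 2 * real (k - i)) = (\<Prod>i<k. 2 * real (Suc (k - Suc i)))"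
    by (intro prod.cong) (auto simp: Suc_diff_Suc)
  also have "\<dots> = (\<Prod>i<k. 2 * real (Suc i))"
    by (rule prod.nat_diff_reindex)
  also have "\<dots> = 2 ^ k * fact k"
    by (induction k) (simp_all add: algebra_simps)
  finally show ?thesis .
qed

lemma euler_coeff_top_0: "euler_coeff k k 0 * (2 ^ k * fact k) = fact (2 * k)"
proof -
  have "euler_coeff k k 0 = (\<Prod>i<k. 2 * real (Suc (k - Suc i)) - 1)"
    unfolding euler_coeff_at_0 by (intro prod.cong) (auto simp: Suc_diff_Suc)
  also have "\<dots> = (\<Prod>i<k. 2 * real (Suc i) - 1)"
    by (rule prod.nat_diff_reindex)
  also have "\<dots> * (2 ^ k * fact k) = fact (2 * k)"
  proof (induction k)
    case (Suc k)
    have "(\<Prod>i<Suc k. 2 * real (Suc i) - 1) * (2 ^ Suc k * fact (Suc k)) =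
        ((\<Prod>i<k. 2 * real (Suc i) - 1) * (2 ^ k * fact k)) * ((2 * real k + 1) * (2 * (real k + 1)))"
      by (simp add: algebra_simps)
    also have "\<dots> = fact (2 * Suc k)"
      unfolding Suc by (simp add: algebra_simps)
    finally show ?case .
  qed simp
  finally show ?thesis .
qed

text \<open>
  The volumes of unit balls in dimensions \<open>2 k\<close> and \<open>2 k + 1\<close>, the factors from the integrations by parts
  and the limit \<open>\<pi> / 2\<close> of the sine integral combine to one, as they must if partial sums are to
  reproduce \<open>F\<close>.
\<close>

lemma normalising_constant:
  "unit_ball_vol (real (2 * k)) * (real (2 * k + 1) * unit_ball_vol (real (2 * k + 1))) / (2 * pi) ^ (2 * k + 1) *
    (2 * (\<Prod>i<k. 2 * real (k - i))) * euler_coeff k k 0 * (pi / 2) = 1"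
proof -
  define A p t where "A = (fact k :: real)" and "p = pi ^ k" and "t = (2::real) ^ k"
  define B where "B = (fact (2 * k) :: real)"
  define a where "a = real k"
  have pos: "A > 0" "B > 0" "p > 0" "t > 0" "a \<ge> 0" "pi > 0"
    by (simp_all add: A_def B_def p_def t_def a_def)
  have even: "unit_ball_vol (real (2 * k)) = p / A"
    by (simp only: unit_ball_vol_even A_def p_def)
  have odd: "unit_ball_vol (real (2 * k + 1)) = (4 * t * t * ((a + 1) * A)) / ((2 * a + 2) * (2 * a + 1) * B) * p"
    unfolding unit_ball_vol_odd by (simp add: A_def B_def p_def t_def a_def power_mult power2_eq_square power_mult_distrib algebra_simps)
  have e: "euler_coeff k k 0 = B / (t * A)"
    using euler_coeff_top_0[of k] pos by (simp add: A_def B_def t_def field_simps)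
  have P: "(2 * pi) ^ (2 * k + 1) = 2 * pi * (t * t) * (p * p)"
  proof -
    have "(2 * pi) ^ (2 * k + 1) = 2 * pi * ((2 * pi) ^ k * (2 * pi) ^ k)"
      by (simp only: power_add[symmetric] mult_2[of k, symmetric] power_Suc[symmetric] Suc_eq_plus1)
    also have "\<dots> = 2 * pi * (t * t) * (p * p)"
      by (simp only: power_mult_distrib p_def t_def mult_ac)
    finally show ?thesis .
  qed
  have n: "real (2 * k + 1) = 2 * a + 1"
    by (simp add: a_def)
  have "p / A * ((2 * a + 1) * ((4 * t * t * ((a + 1) * A)) / ((2 * a + 2) * (2 * a + 1) * B) * p)) / (2 * pi * (t * t) * (p * p)) *
    (2 * (t * A)) * (B / (t * A)) * (pi / 2) = 1"
    using pos by (simp add: divide_simps)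
  then show ?thesis
    unfolding even odd e P prod_even_reverse by (simp only: n A_def t_def)
qed

section \<open>Uniform convergence of the partial sums\<close>

lemma compact_in_L1_imp_subset: "compact_in_L1 M S \<Longrightarrow> S \<subseteq> L1_fun M"
  using compact_in_L1_finite_net[of M S 1] by (metis zero_less_one)

lemma
  fixes f :: "real \<Rightarrow> complex"
  shows integrable_half_line_iff: "integrable half_line f \<longleftrightarrow> set_integrable lborel {0<..} f"
    and integral_half_line: "(LINT r|half_line. f r) = (LINT r:{0<..}|lborel. f r)"
  by (simp_all add: integrable_restrict_space integral_restrict_space set_integrable_def set_lebesgue_integral_def)

lemma borel_measurable_half_line_continuous:
  fixes f :: "real \<Rightarrow> complex"
  assumes "continuous_on UNIV f"
  shows "f \<in> borel_measurable half_line"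
  using assms by (intro measurable_restrict_space1) (simp add: borel_measurable_continuous_onI)

lemma dini_quotient_measurable:
  fixes F :: "'a::euclidean_space \<Rightarrow> 'b::complex_banach"
  assumes \<Phi>: "complex_functional \<Phi>" and F: "times_cont_diff k F"
  shows "(\<lambda>r. \<Phi> ((spherical_mean F x r - indicat_real {0<..<\<delta>} r *\<^sub>R F x) /\<^sub>R r)) \<in> borel_measurable half_line"
proof -
  interpret bounded_linear \<Phi>
    using \<Phi> by (rule complex_functional_bounded_linear)
  have "continuous_on UNIV (spherical_mean F x)"
    using continuous_on_higher_derivative_spherical_mean[OF F, of 0 x] by (simp add: higher_vector_derivative_def)
  from borel_measurable_continuous_onI[OF continuous_on[OF this]]
  have m: "(\<lambda>r. \<Phi> (spherical_mean F x r)) \<in> borel_measurable borel" .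
  have "(\<lambda>r. (\<Phi> (spherical_mean F x r) - indicat_real {0<..<\<delta>} r *\<^sub>R \<Phi> (F x)) /\<^sub>R r) \<in> borel_measurable half_line"
    using m by (intro measurable_restrict_space1) simp
  then show ?thesis
    by (simp add: scaleR diff)
qed

lemma weighted_derivative_measurable:
  fixes F :: "'a::euclidean_space \<Rightarrow> 'b::complex_banach"
  assumes \<Phi>: "complex_functional \<Phi>" and F: "times_cont_diff k F" and "l \<le> k"
  shows "(\<lambda>r. \<Phi> (r ^ m *\<^sub>R higher_vector_derivative l (spherical_mean F x) r)) \<in> borel_measurable half_line"
proof -
  interpret bounded_linear \<Phi>
    using \<Phi> by (rule complex_functional_bounded_linear)
  show ?thesis
    by (intro borel_measurable_half_line_continuous continuous_on continuous_intros
        continuous_on_higher_derivative_spherical_mean[OF F \<open>l \<le> k\<close>])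
qed

text \<open>
  The normalisation turns the coefficient of the sine integral into \<open>2 / \<pi>\<close>. What remains are integrals
  of the sine against members of the compact families and a multiple of \<open>F x\<close> that tends to zero.
\<close>

lemma partial_sum_minus_value:
  fixes F :: "real ^ 'n \<Rightarrow> 'b::complex_banach"
  assumes n: "CARD('n) = 2 * k + 1" and R: "R > 0" and \<delta>: "\<delta> > 0"
    and \<Phi>: "complex_functional \<Phi>" and F: "F \<in> L1_fun lborel" "times_cont_diff k F"
    and dini: "(\<lambda>r. (spherical_mean F x r - indicat_real {0<..<\<delta>} r *\<^sub>R F x) /\<^sub>R r) \<in> L1_fun half_line"
    and lower: "\<And>j l. j \<in> {1..k} \<Longrightarrow> l \<in> {0..j} \<Longrightarrow>
      (\<lambda>r. r ^ (j - 1) *\<^sub>R higher_vector_derivative l (spherical_mean F x) r) \<in> L1_fun half_line"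
  defines "A \<equiv> 2 / (pi * euler_coeff k k 0)"
  shows "\<Phi> (partial_sum R F x - F x) =
    A *\<^sub>R (euler_coeff k k 0 *\<^sub>R
        (LINT r|half_line. sin (R * r) *\<^sub>R \<Phi> ((spherical_mean F x r - indicat_real {0<..<\<delta>} r *\<^sub>R F x) /\<^sub>R r)) +
      (\<Sum>j=1..k. euler_coeff k k j *\<^sub>R
        (LINT r|half_line. sin (R * r) *\<^sub>R \<Phi> (r ^ (j - 1) *\<^sub>R higher_vector_derivative j (spherical_mean F x) r)))) +
    (2 / pi * Si (\<delta> * R) - 1) *\<^sub>R \<Phi> (F x)"
proof -
  interpret bounded_linear \<Phi>
    using \<Phi> by (rule complex_functional_bounded_linear)
  let ?e = "euler_coeff k k"
  define u where "u l r = \<Phi> (higher_vector_derivative l (spherical_mean F x) r)" for l r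
  have u0: "u 0 r = \<Phi> (spherical_mean F x r)" for r
    by (simp add: u_def higher_vector_derivative_def)
  have u_deriv: "(u l has_vector_derivative u (Suc l) r) (at r)" if "l < k" for l r
    unfolding u_def[abs_def]
    by (rule has_vector_derivative[OF has_vector_derivative_higher_derivative_spherical_mean[OF F(2) that]])
  have u_cont: "continuous_on UNIV (u l)" if "l \<le> k" for l
    unfolding u_def[abs_def]
    by (rule continuous_on[OF continuous_on_higher_derivative_spherical_mean[OF F(2) that]])
  have dini_eq: "\<Phi> ((spherical_mean F x r - indicat_real {0<..<\<delta>} r *\<^sub>R F x) /\<^sub>R r) =
      (u 0 r - indicat_real {0<..<\<delta>} r *\<^sub>R \<Phi> (F x)) /\<^sub>R r" for r
    by (simp add: u0 scaleR diff)
  have lower_eq: "\<Phi> (r ^ (j - 1) *\<^sub>R higher_vector_derivative l (spherical_mean F x) r) = r ^ (j - 1) *\<^sub>R u l r" for j l r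
    by (simp add: u_def scaleR)
  have dini_int: "set_integrable lborel {0<..} (\<lambda>r. (u 0 r - indicat_real {0<..<\<delta>} r *\<^sub>R \<Phi> (F x)) /\<^sub>R r)"
    using complex_functional_integrable[OF \<Phi> dini dini_quotient_measurable[OF \<Phi> F(2)]]
    unfolding dini_eq integrable_half_line_iff .
  have lower_int: "set_integrable lborel {0<..} (\<lambda>r. r ^ (j - 1) *\<^sub>R u l r)" if "1 \<le> j" "j \<le> k" "l \<le> j" for j l
    using complex_functional_integrable[OF \<Phi> lower[of j l] weighted_derivative_measurable[OF \<Phi> F(2), of l]] that
    unfolding lower_eq integrable_half_line_iff by simp
  have Fc: "continuous_on UNIV F"
    using F(2) by (rule times_cont_diff_imp_continuous)
  note full = set_integrable_odd_ball_kernel_spherical_mean[OF n R \<Phi> F(1) Fc, of x, folded u0]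
  define c where "c = unit_ball_vol (real (2 * k)) * (real (2 * k + 1) * unit_ball_vol (real (2 * k + 1))) / (2 * pi) ^ (2 * k + 1)"
  define p where "p = 2 * (\<Prod>i<k. 2 * real (k - i))"
  have one: "c * p * ?e 0 * (pi / 2) = 1"
    using normalising_constant[of k] by (simp only: c_def p_def)
  then have e0: "?e 0 \<noteq> 0"
    by auto
  have cp: "c * p = A"
    using one e0 by (simp add: A_def field_simps)
  let ?O = "LINT r:{0<..}|lborel. sin (R * r) *\<^sub>R ((u 0 r - indicat_real {0<..<\<delta>} r *\<^sub>R \<Phi> (F x)) /\<^sub>R r)"
  let ?Q = "\<Sum>j=1..k. ?e j *\<^sub>R (LINT r:{0<..}|lborel. sin (R * r) *\<^sub>R (r ^ (j - 1) *\<^sub>R u j r))"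
  have "\<Phi> (partial_sum R F x) = c *\<^sub>R (LINT r:{0<..}|lborel. r ^ (2 * k) *\<^sub>R (odd_ball_kernel R k r * u 0 r))"
    unfolding u0 c_def by (rule complex_functional_partial_sum_radial[OF n R \<Phi> F(1) Fc])
  also have "(LINT r:{0<..}|lborel. r ^ (2 * k) *\<^sub>R (odd_ball_kernel R k r * u 0 r)) =
      p *\<^sub>R (?e 0 *\<^sub>R (?O + Si (\<delta> * R) *\<^sub>R \<Phi> (F x)) + ?Q)"
    unfolding p_def by (rule odd_ball_kernel_integral_formula[OF R \<delta> u_deriv u_cont full dini_int lower_int])
  also have "c *\<^sub>R (p *\<^sub>R (?e 0 *\<^sub>R (?O + Si (\<delta> * R) *\<^sub>R \<Phi> (F x)) + ?Q)) =
      A *\<^sub>R (?e 0 *\<^sub>R ?O + ?Q) + (A * ?e 0 * Si (\<delta> * R)) *\<^sub>R \<Phi> (F x)"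
    by (simp add: cp[symmetric] scaleR_add_right mult_ac)
  also have "A * ?e 0 * Si (\<delta> * R) = 2 / pi * Si (\<delta> * R)"
    using e0 by (simp add: A_def)
  finally show ?thesis
    unfolding integral_half_line dini_eq lower_eq by (simp add: diff scaleR_diff_left)
qed

theorem proposition2p9:
  fixes F :: "real ^ 'n \<Rightarrow> 'x::complex_banach" and K :: "(real ^ 'n) set"
    and k :: nat and \<delta> :: real
  assumes "k \<ge> 1" and "CARD('n) = 2 * k + 1"
    and "compact K"
    and "F \<in> L1_fun lborel"
    and "times_cont_diff k F"
    and "\<delta> > 0"
    and "compact_in_L1 (restrict_space lborel {0<..})
      {(\<lambda>r. (spherical_mean F x r - indicat_real {0<..<\<delta>} r *\<^sub>R F x) /\<^sub>R r) | x. x \<in> K}"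
    and "\<And>j. j \<in> {1..k} \<Longrightarrow> compact_in_L1 (restrict_space lborel {0<..})
      {(\<lambda>r. r ^ (j - 1) *\<^sub>R higher_vector_derivative l (spherical_mean F x) r) | x l. x \<in> K \<and> l \<in> {0..j}}"
  shows "uniform_limit K (\<lambda>R x. partial_sum R F x) F at_top"
  unfolding uniform_limit_iff
proof (intro allI impI)
  fix \<epsilon> :: real assume \<epsilon>: "\<epsilon> > 0"
  let ?g = "\<lambda>x r. (spherical_mean F x r - indicat_real {0<..<\<delta>} r *\<^sub>R F x) /\<^sub>R r"
  let ?h = "\<lambda>j l x r. r ^ (j - 1) *\<^sub>R higher_vector_derivative l (spherical_mean F x) r"
  let ?e = "euler_coeff k k"
  define A where "A = 2 / (pi * ?e 0)"
  define E where "E = (\<Sum>j\<le>k. \<bar>?e j\<bar>)"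
  have E: "E \<ge> 0"
    unfolding E_def by (rule sum_nonneg) simp
  have "compact (F ` K)"
    using assms(3) continuous_on_subset[OF times_cont_diff_imp_continuous[OF assms(5)]]
    by (intro compact_continuous_image) auto
  then obtain B where "B > 0" "\<forall>v\<in>F ` K. norm v \<le> B"
    using compact_imp_bounded bounded_pos by metis
  then have B: "B > 0" "\<And>x. x \<in> K \<Longrightarrow> norm (F x) \<le> B"
    by auto
  (* the oscillating terms together then contribute at most \<epsilon> / 4 *)
  define \<eta> where "\<eta> = \<epsilon> / (4 * (\<bar>A\<bar> * E + 1))"
  have \<eta>: "\<eta> > 0"
    using \<epsilon> E by (simp add: \<eta>_def add_nonneg_pos)
  have "filterlim (\<lambda>R. \<delta> * R) at_top at_top"
    using assms(6) by (intro filterlim_tendsto_pos_mult_at_top[OF tendsto_const]) (auto simp: filterlim_ident)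
  from filterlim_compose[OF Si_at_top this]
  have "((\<lambda>R. 2 / pi * Si (\<delta> * R) - 1) \<longlongrightarrow> 2 / pi * (pi / 2) - 1) at_top"
    by (intro tendsto_intros)
  then have Si: "eventually (\<lambda>R. \<bar>2 / pi * Si (\<delta> * R) - 1\<bar> < \<epsilon> / (4 * B)) at_top"
    using \<epsilon> B(1) tendstoD[of "\<lambda>R. 2 / pi * Si (\<delta> * R) - 1" 0 at_top "\<epsilon> / (4 * B)"] by (simp add: dist_real_def)
  have RL0: "eventually (\<lambda>R. \<forall>x\<in>K. \<forall>\<Phi>. complex_functional \<Phi> \<longrightarrow>
      norm (LINT r|half_line. sin (R * r) *\<^sub>R \<Phi> (?g x r)) \<le> \<eta>) at_top"
  proof -
    have meas: "(\<lambda>r. \<Phi> (g r)) \<in> borel_measurable half_line"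
      if "g \<in> {?g x | x. x \<in> K}" "complex_functional \<Phi>" for g \<Phi>
      using that(1) by (auto intro!: dini_quotient_measurable[OF that(2) assms(5)])
    have "eventually (\<lambda>R. \<forall>g\<in>{?g x | x. x \<in> K}. \<forall>\<Phi>. complex_functional \<Phi> \<longrightarrow>
        norm (LINT r|half_line. sin (R * r) *\<^sub>R \<Phi> (g r)) \<le> \<eta>) at_top"
      using assms(7) meas \<eta> by (rule uniform_riemann_lebesgue)
    then show ?thesis
    proof eventually_elim
      case (elim R)
      show ?case
      proof (intro ballI)
        fix x assume "x \<in> K"
        then have "?g x \<in> {?g x | x. x \<in> K}"
          by auto
        from bspec[OF elim this] show "\<forall>\<Phi>. complex_functional \<Phi> \<longrightarrow>
            norm (LINT r|half_line. sin (R * r) *\<^sub>R \<Phi> (?g x r)) \<le> \<eta>" .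
      qed
    qed
  qed
  have RL: "eventually (\<lambda>R. \<forall>j\<in>{1..k}. \<forall>x\<in>K. \<forall>\<Phi>. complex_functional \<Phi> \<longrightarrow>
      norm (LINT r|half_line. sin (R * r) *\<^sub>R \<Phi> (?h j j x r)) \<le> \<eta>) at_top"
  proof (rule eventually_ball_finite[OF finite_atLeastAtMost], rule ballI)
    fix j assume j: "j \<in> {1..k}"
    have meas: "(\<lambda>r. \<Phi> (g r)) \<in> borel_measurable half_line"
      if "g \<in> {?h j l x | x l. x \<in> K \<and> l \<in> {0..j}}" "complex_functional \<Phi>" for g \<Phi>
      using that(1) j by (auto intro!: weighted_derivative_measurable[OF that(2) assms(5)])
    have "eventually (\<lambda>R. \<forall>g\<in>{?h j l x | x l. x \<in> K \<and> l \<in> {0..j}}. \<forall>\<Phi>. complex_functional \<Phi> \<longrightarrow>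
        norm (LINT r|half_line. sin (R * r) *\<^sub>R \<Phi> (g r)) \<le> \<eta>) at_top"
      using assms(8)[OF j] meas \<eta> by (rule uniform_riemann_lebesgue)
    then show "eventually (\<lambda>R. \<forall>x\<in>K. \<forall>\<Phi>. complex_functional \<Phi> \<longrightarrow>
      norm (LINT r|half_line. sin (R * r) *\<^sub>R \<Phi> (?h j j x r)) \<le> \<eta>) at_top"
    proof eventually_elim
      case (elim R)
      show ?case
      proof (intro ballI)
        fix x assume "x \<in> K"
        then have "?h j j x \<in> {?h j l x | x l. x \<in> K \<and> l \<in> {0..j}}"
          by auto
        from bspec[OF elim this] show "\<forall>\<Phi>. complex_functional \<Phi> \<longrightarrow>
            norm (LINT r|half_line. sin (R * r) *\<^sub>R \<Phi> (?h j j x r)) \<le> \<eta>" .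
      qed
    qed
  qed
  show "eventually (\<lambda>R. \<forall>x\<in>K. dist (partial_sum R F x) (F x) < \<epsilon>) at_top"
    using RL0 RL Si eventually_gt_at_top[of 0]
  proof eventually_elim
    case (elim R)
    show ?case
    proof
      fix x assume x: "x \<in> K"
      obtain \<Phi> :: "'x \<Rightarrow> complex" where \<Phi>: "complex_functional \<Phi>"
        and norming: "norm (partial_sum R F x - F x) \<le> cmod (\<Phi> (partial_sum R F x - F x))"
        by (rule norming_complex_functional)
      let ?O = "LINT r|half_line. sin (R * r) *\<^sub>R \<Phi> (?g x r)"
      let ?P = "\<lambda>j. LINT r|half_line. sin (R * r) *\<^sub>R \<Phi> (?h j j x r)"
      have O: "norm ?O \<le> \<eta>" and P: "\<And>j. j \<in> {1..k} \<Longrightarrow> norm (?P j) \<le> \<eta>"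
        using elim(1,2) x \<Phi> by blast+
      have dini: "?g x \<in> L1_fun half_line"
        using compact_in_L1_imp_subset[OF assms(7)] x by blast
      have lower: "?h j l x \<in> L1_fun half_line" if "j \<in> {1..k}" "l \<in> {0..j}" for j l
        using compact_in_L1_imp_subset[OF assms(8)[OF that(1)]] x that(2) by blast
      have eq: "\<Phi> (partial_sum R F x - F x) = A *\<^sub>R (?e 0 *\<^sub>R ?O + (\<Sum>j=1..k. ?e j *\<^sub>R ?P j)) +
          (2 / pi * Si (\<delta> * R) - 1) *\<^sub>R \<Phi> (F x)"
        unfolding A_def using partial_sum_minus_value[OF assms(2) elim(4) assms(6) \<Phi> assms(4,5) dini lower] .
      have "norm (?e 0 *\<^sub>R ?O + (\<Sum>j=1..k. ?e j *\<^sub>R ?P j)) \<le> \<bar>?e 0\<bar> * \<eta> + (\<Sum>j=1..k. \<bar>?e j\<bar> * \<eta>)"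
        using O P by (intro order_trans[OF norm_triangle_ineq] add_mono sum_norm_le) (auto intro: mult_left_mono)
      also have "\<dots> = E * \<eta>"
      proof -
        have "{..k} = insert 0 {1..k}"
          by auto
        then show ?thesis
          by (simp add: E_def sum_distrib_right distrib_right)
      qed
      finally have "norm (A *\<^sub>R (?e 0 *\<^sub>R ?O + (\<Sum>j=1..k. ?e j *\<^sub>R ?P j))) \<le> \<bar>A\<bar> * (E * \<eta>)"
        by (simp add: mult_left_mono)
      also have "\<dots> \<le> \<epsilon> / 4"
      proof -
        have "\<bar>A\<bar> * E + 1 > 0"
          using E by (intro add_nonneg_pos) auto
        then have "(\<bar>A\<bar> * E + 1) * \<eta> = \<epsilon> / 4"
          by (simp add: \<eta>_def divide_simps)
        then show ?thesis
          using \<eta> by (simp add: algebra_simps)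
      qed
      finally have 1: "norm (A *\<^sub>R (?e 0 *\<^sub>R ?O + (\<Sum>j=1..k. ?e j *\<^sub>R ?P j))) \<le> \<epsilon> / 4" .
      have "cmod (\<Phi> (F x)) \<le> 2 * norm (F x)"
        using \<Phi> by (simp add: complex_functional_def)
      also have "\<dots> \<le> 2 * B"
        using B(2)[OF x] by simp
      finally have "cmod (\<Phi> (F x)) \<le> 2 * B" .
      then have "norm ((2 / pi * Si (\<delta> * R) - 1) *\<^sub>R \<Phi> (F x)) \<le> \<epsilon> / (4 * B) * (2 * B)"
        unfolding norm_scaleR using elim(3) by (intro mult_mono) auto
      also have "\<dots> = \<epsilon> / 2"
        using B(1) by simp
      finally have 2: "norm ((2 / pi * Si (\<delta> * R) - 1) *\<^sub>R \<Phi> (F x)) \<le> \<epsilon> / 2" .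
      have "norm (partial_sum R F x - F x) \<le> \<epsilon> / 4 + \<epsilon> / 2"
        using norming unfolding eq by (rule order_trans) (intro order_trans[OF norm_triangle_ineq] add_mono 1 2)
      then show "dist (partial_sum R F x) (F x) < \<epsilon>"
        using \<epsilon> by (simp add: dist_norm)
    qed
  qed
qed

end
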